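(* Let $\alpha$ be an irrational number of bounded type, and let $\beta=2\alpha-1=[2m_0;2m_1,2m_2,\ldots]$ be the even continued fraction expansion of $\beta$. Then there exist a non-decreasing sequence of non-negative integers $\nu_n$ with bounded jumps ($\sup_n(\nu_{n+1}-\nu_n)<\infty$) and $\nu_n\asymp\log n$, and a sequence $B_n>0$ with $B_n\asymp\sqrt{\log n}$, such that, setting $$A_n:=\frac14\sum_{j=1}^{\nu_n}\bigl[\operatorname{sgn}(m_{2j})-\operatorname{sgn}(m_{2j-1})\bigr],$$ we have for all $a<b$ $$\frac1n\#\left\{1\le N\le n:\frac{D_N(\alpha)-A_n}{B_n}\in[a,b]\right\}\xrightarrow[n\to\infty]{}\frac1{\sqrt{2\pi}}\int_a^be^{-t^2/2}\,dt .$$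
   Context: $\{x\}\in[0,1)$ denotes the fractional part of $x$. For irrational $\alpha$, $D_N(\alpha):=\#\{0\le j\le N-1:\{j\alpha\}\in[0,\tfrac12)\}-\tfrac12N$. An irrational number is of bounded type if the partial quotients of its regular continued fraction expansion are bounded. Every irrational $\beta$ has a unique even continued fraction expansion $\beta=[2m_0;2m_1,2m_2,\ldots]:=\lim_n\bigl(2m_0+\cfrac{1}{2m_1+\cfrac1{\cdots+\cfrac1{2m_n}}}\bigr)$ with $m_0\in\mathbb Z$ and $m_i\in\mathbb Z\setminus\{0\}$ for $i\ge1$. $a_n\asymp b_n$ means that there are $C,N>1$ such that $C^{-1}\le a_n/b_n\le C$ for all $n>N$. *)

theory Defs
  imports "HOL-Analysis.Analysis"
begin

text \<open>\<open>cf_conv c n\<close> is the finite continued fraction \<open>[c 0; c 1, \<dots>, c n]\<close>. For the two kinds of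
  expansions below the denominators never vanish, since all proper tails have absolute value
  at least \<open>1\<close>, so the convention \<open>1 / 0 = 0\<close> plays no role.\<close>

primrec cf_conv :: "(nat \<Rightarrow> int) \<Rightarrow> nat \<Rightarrow> real" where
  "cf_conv c 0 = of_int (c 0)"
| "cf_conv c (Suc n) = of_int (c 0) + 1 / cf_conv (\<lambda>i. c (Suc i)) n"

definition regular_cf_expansion :: "real \<Rightarrow> (nat \<Rightarrow> int) \<Rightarrow> bool" where
  "regular_cf_expansion x a \<longleftrightarrow> (\<forall>i\<ge>1. a i \<ge> 1) \<and> cf_conv a \<longlonglongrightarrow> x"

definition even_cf_expansion :: "real \<Rightarrow> (nat \<Rightarrow> int) \<Rightarrow> bool" where
  "even_cf_expansion x m \<longleftrightarrow> (\<forall>i\<ge>1. m i \<noteq> 0) \<and> cf_conv (\<lambda>i. 2 * m i) \<longlonglongrightarrow> x"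

text \<open>The regular expansion of an irrational number exists and is unique, so the existential
  quantifier merely names it.\<close>

definition bounded_type :: "real \<Rightarrow> bool" where
  "bounded_type x \<longleftrightarrow> x \<notin> \<rat> \<and> (\<exists>a. regular_cf_expansion x a \<and> bdd_above (range a))"

definition discrepancy :: "nat \<Rightarrow> real \<Rightarrow> real" where
  "discrepancy N \<alpha> = real (card {j. j < N \<and> frac (real j * \<alpha>) \<in> {0..<1/2}}) - real N / 2"

definition asymp_comparable :: "(nat \<Rightarrow> real) \<Rightarrow> (nat \<Rightarrow> real) \<Rightarrow> bool" where
  "asymp_comparable a b \<longleftrightarrow>
     (\<exists>C>1. \<exists>N>1. \<forall>n>N. inverse C \<le> a n / b n \<and> a n / b n \<le> C)"

definition sgn_drift :: "(nat \<Rightarrow> int) \<Rightarrow> nat \<Rightarrow> real" where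
  "sgn_drift m k = 1/4 * (\<Sum>j=1..k. of_int (sgn (m (2 * j)) - sgn (m (2 * j - 1))))"

end

theory Submission
  imports Defs "HOL-Probability.Probability" "HOL-Real_Asymp.Real_Asymp"
begin

text \<open>Put \<open>r(t) = (-1) ^ \<lfloor>t\<rfloor>\<close> and \<open>U x N = (\<Sum>j=1..N. r (j (x + 1)))\<close>, so that
  \<open>2 D_N = 1 + U \<beta> (N - 1)\<close>. The order in which a line of slope \<open>x\<close> crosses the unit grid gives a
  reciprocity law between \<open>U x\<close> and \<open>U (1/x)\<close>, while \<open>U\<close> is odd and \<open>2\<close>-periodic in \<open>x\<close>. Hence the even
  expansion of \<open>\<beta>\<close> drives a renormalisation. Written with a common real time \<open>u\<close> (and \<open>N - 1 = \<lfloor>u\<rfloor>\<close>)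
  it unfolds exactly into
  \<open>D_N - A_n = 1/2 - 1/4 (\<Sum>k. \<plusminus> r (\<pi>\<^sub>k u) r (\<pi>\<^sub>k\<^sub>+\<^sub>1 u))\<close>, where \<open>\<pi>\<^sub>k = \<bar>x\<^sub>1 \<dots> x\<^sub>k\<bar>\<close> is the product of the
  tails; the drift \<open>A_n\<close> is the sum of the boundary terms.

  Bounded type makes \<open>\<pi>\<^sub>k\<close> decay geometrically and each ratio \<open>\<pi>\<^sub>k\<^sub>+\<^sub>1 / \<pi>\<^sub>k\<close> uniformly badly approximable.
  By quantitative equidistribution of the linear flow with frequencies \<open>(\<pi>\<^sub>k, \<pi>\<^sub>k\<^sub>+\<^sub>1)\<close>, a wave of index \<open>k\<close>
  is nearly uncorrelated with every function of waves of index at least \<open>k + g\<close>. Removing the waves one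
  at a time from the fine end shows that the characteristic function is multiplied each time by
  \<open>exp (- s\<^sup>2 v\<^sub>k)\<close> up to a summable error, which gives the Gaussian limit.

  The variance grows linearly by Bessel's inequality for the frequencies \<open>\<pi> (P\<^sub>k + P\<^sub>k\<^sub>+\<^sub>1)\<close> (\<open>P\<^sub>k\<close> the signed
  product of tails): each is a combination of \<open>P\<^sub>j\<close> and \<open>P\<^sub>j\<^sub>+\<^sub>1\<close> with odd integer coefficients for every \<open>j\<close>,
  and the Fourier coefficients \<open>\<plusminus> 4 / (\<pi>\<^sup>2 a\<^sub>j a\<^sub>j\<^sub>+\<^sub>1)\<close> of the waves form a telescoping sum that is bounded
  away from \<open>0\<close>.\<close>

section \<open>Square waves and reciprocity\<close>

text \<open>Each reciprocity step changes the number of terms, and these numbers are rounded.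
  Measured in one real time \<open>u\<close> they are \<open>\<lfloor>u\<rfloor>\<close> and
  \<open>\<lfloor>u * x\<rfloor>\<close>, so no rounding error builds up and averages over
  \<open>N\<close> become integrals over \<open>u\<close>. Neighbouring waves share a frequency and
  remain correlated. The remedy is a gap \<open>g\<close> of order \<open>log K\<close>: waves
  inside it are expanded to first order in \<open>s\<close>, which is of size
  \<open>1 / sqrt K\<close>, and only waves beyond it have to decouple. The accumulated error is of
  order \<open>(1 + g)^2 / sqrt K\<close>. Correlations are means over \<open>{0..S}\<close> with
  \<open>S\<close> much longer than the observation time \<open>T\<close>. No limit of them has to
  exist, and for each \<open>K\<close> the time \<open>S\<close> can be taken so long that the
  asymptotic Bessel bound for the variance applies. Evenness of the digits is used twice: it hides
  them from the 2-periodic sums, and it preserves parities in every integer recursion, which keeps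
  the chosen frequencies at odd harmonics of all waves.\<close>

definition square_wave :: "real \<Rightarrow> real" where
  "square_wave t = (if even \<lfloor>t\<rfloor> then 1 else -1)"

lemma square_wave_cases: "square_wave t = 1 \<or> square_wave t = -1"
  by (simp add: square_wave_def)

lemma abs_square_wave [simp]: "\<bar>square_wave t\<bar> = 1"
  by (simp add: square_wave_def)

lemma square_wave_measurable [measurable]: "square_wave \<in> borel_measurable borel"
  unfolding square_wave_def [abs_def] by measurable

lemma square_wave_add_even: "square_wave (t + 2 * of_int k) = square_wave t"
proof -
  have "\<lfloor>t + 2 * of_int k\<rfloor> = \<lfloor>t\<rfloor> + 2 * k"
    using floor_add_int[of t "2 * k"] by simp
  then show ?thesis by (simp add: square_wave_def)
qed

lemma square_wave_minus:
  assumes "t \<notin> \<int>"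
  shows "square_wave (- t) = - square_wave t"
proof -
  have "\<lfloor>- t\<rfloor> = - \<lfloor>t\<rfloor> - 1"
    using assms by (auto simp: floor_minus ceiling_altdef) (metis Ints_of_int)
  then show ?thesis by (simp add: square_wave_def)
qed

lemma square_wave_twice: "square_wave (2 * y) = (if frac y < 1 / 2 then 1 else -1)"
proof -
  have "square_wave (2 * y) = square_wave (2 * frac y)"
    using square_wave_add_even[of "2 * frac y" "\<lfloor>y\<rfloor>"] by (simp add: frac_def algebra_simps)
  moreover have "\<lfloor>2 * frac y\<rfloor> = (if frac y < 1 / 2 then 0 else 1)"
    using frac_ge_0[of y] frac_lt_1[of y] by (auto simp: floor_eq_iff)
  ultimately show ?thesis by (simp add: square_wave_def)
qed

text \<open>A sign change costs 2 and needs an integer between the arguments. The floors thus bound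
  the variation of the wave by that of a monotone function, which is the form used in all window
  estimates.\<close>

lemma square_wave_diff:
  assumes "u \<le> v"
  shows "\<bar>square_wave v - square_wave u\<bar> \<le> 2 * (of_int \<lfloor>v\<rfloor> - of_int \<lfloor>u\<rfloor>)"
proof (cases "\<lfloor>u\<rfloor> = \<lfloor>v\<rfloor>")
  case True
  then show ?thesis by (simp add: square_wave_def)
next
  case False
  with floor_mono[OF assms] have "\<lfloor>u\<rfloor> + 1 \<le> \<lfloor>v\<rfloor>" by linarith
  then have "(of_int \<lfloor>u\<rfloor> :: real) + 1 \<le> of_int \<lfloor>v\<rfloor>" by linarith
  then show ?thesis
    using square_wave_cases[of u] square_wave_cases[of v] by auto
qed

text \<open>The shift by 1 multiplies the \<open>j\<close>-th sign by \<open>(-1) ^ j\<close>. It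
  comes from \<open>\<beta> + 1 = 2 * \<alpha>\<close>, and it turns the sign at a crossing into the
  parity of the total number of crossings so far, so that the reciprocity law closes.\<close>

definition wave_sum :: "real \<Rightarrow> nat \<Rightarrow> real" where
  "wave_sum x N = (\<Sum>j=1..N. square_wave (real j * (x + 1)))"

lemma wave_sum_0 [simp]: "wave_sum x 0 = 0"
  by (simp add: wave_sum_def)

lemma wave_sum_Suc: "wave_sum x (Suc N) = wave_sum x N + square_wave (real (Suc N) * (x + 1))"
  by (simp add: wave_sum_def)

lemma discrepancy_wave_sum:
  assumes "N \<ge> 1"
  shows "2 * discrepancy N \<alpha> = 1 + wave_sum (2 * \<alpha> - 1) (N - 1)"
proof -
  let ?P = "\<lambda>j. frac (real j * \<alpha>) < 1 / 2"
  have "{j. j < N \<and> frac (real j * \<alpha>) \<in> {0..<1/2}} = {j \<in> {..<N}. ?P j}"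
    by auto
  then have "2 * discrepancy N \<alpha> = 2 * (\<Sum>j<N. if ?P j then 1 else 0) - real N"
    by (simp add: discrepancy_def flip: sum.inter_filter)
  also have "\<dots> = (\<Sum>j<N. 2 * (if ?P j then 1 else 0) - 1)"
    by (simp add: sum_subtractf sum_distrib_left)
  also have "\<dots> = (\<Sum>j<N. square_wave (2 * (real j * \<alpha>)))"
    by (intro sum.cong) (auto simp: square_wave_twice)
  also have "\<dots> = (\<Sum>j=0..<Suc (N - 1). square_wave (real j * ((2 * \<alpha> - 1) + 1)))"
    using assms by (intro sum.cong) (auto simp: algebra_simps)
  also have "\<dots> = 1 + wave_sum (2 * \<alpha> - 1) (N - 1)"
  proof -
    have "{0..<Suc (N - 1)} = insert 0 {1..N-1}" by auto
    then show ?thesis by (simp add: wave_sum_def) (simp add: square_wave_def)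
  qed
  finally show ?thesis .
qed

lemma wave_sum_add_even: "wave_sum (x + 2 * of_int k) N = wave_sum x N"
  unfolding wave_sum_def
proof (rule sum.cong [OF refl])
  fix j
  have "real j * (x + 2 * of_int k + 1) = real j * (x + 1) + 2 * of_int (int j * k)"
    by (simp add: algebra_simps)
  then show "square_wave (real j * (x + 2 * of_int k + 1)) = square_wave (real j * (x + 1))"
    using square_wave_add_even by metis
qed

lemma irrational_mult_nat:
  assumes "x \<notin> \<rat>" "j > 0"
  shows "real j * x \<notin> \<rat>"
proof
  assume "real j * x \<in> \<rat>"
  then have "real j * x / real j \<in> \<rat>" by (intro Rats_divide) auto
  with assms show False by simp
qed

text \<open>The wave is odd except at integers, and irrationality keeps \<open>j * (x + 1)\<close>
  away from them.\<close>

lemma wave_sum_minus: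
  assumes "x \<notin> \<rat>"
  shows "wave_sum (- x) N = - wave_sum x N"
  unfolding wave_sum_def sum_negf [symmetric]
proof (rule sum.cong [OF refl])
  fix j assume j: "j \<in> {1..N}"
  have "x + 1 \<notin> \<rat>" using assms Rats_diff[of "x + 1" 1] by auto
  then have "real j * (x + 1) \<notin> \<rat>" using j by (intro irrational_mult_nat) auto
  then have *: "real j * (x + 1) \<notin> \<int>" using Ints_subset_Rats by blast
  have "real j * (- x + 1) = - (real j * (x + 1)) + 2 * of_int (int j)"
    by (simp add: algebra_simps)
  then have "square_wave (real j * (- x + 1)) = square_wave (- (real j * (x + 1)))"
    using square_wave_add_even by metis
  then show "square_wave (real j * (- x + 1)) = - square_wave (real j * (x + 1))"
    using square_wave_minus [OF *] by simp
qed

text \<open>The line \<open>y = x t\<close> meets the vertical lines at \<open>j\<close> and the horizontal lines at \<open>k\<close> in an order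
  for which the summands are the alternating signs of the positions.\<close>

lemma wave_sum_reciprocity:
  assumes "x \<notin> \<rat>" "x > 0" "real J * x < real K + 1" "real K < (real J + 1) * x"
  shows "wave_sum x J + wave_sum (1 / x) K = (if odd (J + K) then -1 else 0)"
  using assms(3,4)
proof (induction "J + K" arbitrary: J K)
  case 0
  then show ?case by simp
next
  case (Suc M)
  have neq: "real J * x \<noteq> real K"
  proof (cases "J = 0")
    case True
    with Suc.hyps show ?thesis by auto
  next
    case False
    with irrational_mult_nat[OF assms(1), of J] show ?thesis by auto
  qed
  show ?case
  proof (cases "real J * x > real K")
    case True
    \<comment> \<open>The last crossing is the vertical line at \<open>J\<close>. Removing it flips
      the parity of \<open>J + K\<close>, in step with the value of the deleted summand.\<close>
    then obtain J' where J: "J = Suc J'" by (cases J) auto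
    have "(real J' + 1) * x < real K + 1" using Suc.prems(1) by (simp add: J add.commute)
    then have less: "real J' * x < real K + 1"
      using \<open>x > 0\<close> by (simp add: algebra_simps)
    have "real K < (real J' + 1) * x" using True by (simp add: J add.commute)
    from Suc.hyps(1)[OF _ less this] Suc.hyps(2)
    have IH: "wave_sum x J' + wave_sum (1 / x) K = (if odd (J' + K) then -1 else 0)"
      by (simp add: J)
    have "\<lfloor>real J * x\<rfloor> = int K"
      using True Suc.prems(1) by (intro floor_unique) auto
    moreover have "\<lfloor>real J * (x + 1)\<rfloor> = \<lfloor>real J * x\<rfloor> + int J"
      using floor_add_int[of "real J * x" "int J"] by (simp add: algebra_simps)
    ultimately have "square_wave (real J * (x + 1)) = (if even (J + K) then 1 else -1)"
      by (simp add: square_wave_def add.commute flip: of_nat_add)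
    with IH show ?thesis unfolding J wave_sum_Suc by (auto simp: J)
  next
    case False
    with neq have less: "real J * x < real K" by simp
    then obtain K' where K: "K = Suc K'" 
      using \<open>x > 0\<close> by (cases K) (auto simp: not_less mult_less_0_iff)
    have "real J * x < real K' + 1" using less by (simp add: K add.commute)
    moreover have "real K' < (real J + 1) * x" using Suc.prems(2) by (simp add: K)
    ultimately have IH: "wave_sum x J + wave_sum (1 / x) K' = (if odd (J + K') then -1 else 0)"
      using Suc.hyps by (simp add: K)
    have "\<lfloor>real K * (1 / x)\<rfloor> = int J"
      using less Suc.prems(2) \<open>x > 0\<close> by (intro floor_unique) (auto simp: field_simps)
    moreover have "\<lfloor>real K * (1 / x + 1)\<rfloor> = \<lfloor>real K * (1 / x)\<rfloor> + int K"
      using floor_add_int[of "real K * (1 / x)" "int K"] by (simp add: algebra_simps)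
    ultimately have "square_wave (real K * (1 / x + 1)) = (if even (J + K) then 1 else -1)"
      by (simp add: square_wave_def flip: of_nat_add)
    with IH show ?thesis unfolding K wave_sum_Suc by (auto simp: K)
  qed
qed

text \<open>With the crossing counts taken at a common time \<open>u\<close>, the interlacing
  hypotheses of the reciprocity law hold automatically, and the parity correction becomes a product
  of two square waves. Negative \<open>x\<close> is reduced to positive by oddness, which is where
  \<open>sgn x\<close> enters.\<close>

lemma wave_sum_inverse:
  assumes "x \<notin> \<rat>" "u \<ge> 0"
  shows "wave_sum x (nat \<lfloor>u\<rfloor>) = - wave_sum (1 / x) (nat \<lfloor>u * \<bar>x\<bar>\<rfloor>)
           - sgn x * (1 - square_wave u * square_wave (u * \<bar>x\<bar>)) / 2"
proof -
  have x0: "x \<noteq> 0" using assms by auto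
  have pos: "wave_sum y (nat \<lfloor>u\<rfloor>) = - wave_sum (1 / y) (nat \<lfloor>u * y\<rfloor>)
           - (1 - square_wave u * square_wave (u * y)) / 2" if y: "y \<notin> \<rat>" "y > 0" for y
  proof -
    have uy: "u * y \<ge> 0" using y assms by simp
    have f1: "of_int \<lfloor>u\<rfloor> \<le> u" "u < of_int \<lfloor>u\<rfloor> + 1" by linarith+
    have f2: "of_int \<lfloor>u * y\<rfloor> \<le> u * y" "u * y < of_int \<lfloor>u * y\<rfloor> + 1" by linarith+
    have "of_int \<lfloor>u\<rfloor> * y \<le> u * y" using f1 y by simp
    with f2 have c1: "of_int \<lfloor>u\<rfloor> * y < of_int \<lfloor>u * y\<rfloor> + 1" by linarith
    have "u * y < (of_int \<lfloor>u\<rfloor> + 1) * y" using f1 y by simp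
    with f2 have c2: "of_int \<lfloor>u * y\<rfloor> < (of_int \<lfloor>u\<rfloor> + 1) * y" by linarith
    have r: "real (nat \<lfloor>u\<rfloor>) = of_int \<lfloor>u\<rfloor>" "real (nat \<lfloor>u * y\<rfloor>) = of_int \<lfloor>u * y\<rfloor>"
      using assms uy by auto
    have "wave_sum y (nat \<lfloor>u\<rfloor>) + wave_sum (1 / y) (nat \<lfloor>u * y\<rfloor>)
        = (if odd (nat \<lfloor>u\<rfloor> + nat \<lfloor>u * y\<rfloor>) then -1 else 0)"
      using c1 c2 y by (intro wave_sum_reciprocity) (auto simp: r)
    also have "\<dots> = - (1 - square_wave u * square_wave (u * y)) / 2"
      using assms uy by (auto simp: square_wave_def even_nat_iff)
    finally show ?thesis by linarith
  qed
  show ?thesis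
  proof (cases "x > 0")
    case True
    with pos[of x] assms show ?thesis by simp
  next
    case False
    with x0 have neg: "x < 0" by simp
    have "- x \<notin> \<rat>" using assms by simp
    with pos[of "-x"] neg have "wave_sum (-x) (nat \<lfloor>u\<rfloor>) = - wave_sum (1 / (-x)) (nat \<lfloor>u * \<bar>x\<bar>\<rfloor>)
           - (1 - square_wave u * square_wave (u * \<bar>x\<bar>)) / 2" by simp
    moreover have "1 / x \<notin> \<rat>" using assms Rats_inverse[of "1 / x"] by (auto simp: field_simps)
    then have "wave_sum (1 / (-x)) (nat \<lfloor>u * \<bar>x\<bar>\<rfloor>) = - wave_sum (1 / x) (nat \<lfloor>u * \<bar>x\<bar>\<rfloor>)"
      using wave_sum_minus[of "1 / x"] by simp
    ultimately show ?thesis using neg wave_sum_minus[OF assms(1)] by (simp add: field_simps)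
  qed
qed

section \<open>Continued fractions and badly approximable numbers\<close>

text \<open>These are the complete quotients. Running the algorithm on \<open>x\<close> itself makes
  every step an exact identity; that the digits really belong to \<open>x\<close> enters through
  \<open>cf_conv_tail_limit\<close>.\<close>

primrec cf_tail :: "real \<Rightarrow> (nat \<Rightarrow> int) \<Rightarrow> nat \<Rightarrow> real" where
  "cf_tail x c 0 = x"
| "cf_tail x c (Suc k) = 1 / (cf_tail x c k - of_int (c k))"

lemma cf_tail_irrational:
  assumes "x \<notin> \<rat>"
  shows "cf_tail x c k \<notin> \<rat>"
proof (induction k)
  case 0
  then show ?case using assms by simp
next
  case (Suc k)
  show ?case
  proof
    assume "cf_tail x c (Suc k) \<in> \<rat>"
    then have "1 / cf_tail x c (Suc k) + of_int (c k) \<in> \<rat>" by (intro Rats_add Rats_divide) auto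
    with Suc show False by simp
  qed
qed

lemma cf_tail_step: "cf_tail x c k = of_int (c k) + 1 / cf_tail x c (Suc k)"
  by simp

lemma cf_conv_tail_limit:
  assumes "cf_conv c \<longlonglongrightarrow> x" "x \<notin> \<rat>"
  shows "cf_conv (\<lambda>i. c (i + k)) \<longlonglongrightarrow> cf_tail x c k"
proof (induction k)
  case 0
  then show ?case using assms by simp
next
  case (Suc k)
  have "cf_tail x c k \<noteq> of_int (c k)"
    using cf_tail_irrational[OF assms(2), of c k] by auto
  moreover have "(\<lambda>n. cf_conv (\<lambda>i. c (i + k)) (Suc n)) \<longlonglongrightarrow> cf_tail x c k"
    using Suc by (rule LIMSEQ_Suc)
  ultimately have "(\<lambda>n. 1 / (cf_conv (\<lambda>i. c (i + k)) (Suc n) - of_int (c k)))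
      \<longlonglongrightarrow> 1 / (cf_tail x c k - of_int (c k))"
    by (intro tendsto_intros) auto
  then show ?case by simp
qed

lemma cf_conv_ge_1:
  assumes "\<And>i. c i \<ge> 1"
  shows "cf_conv c n \<ge> 1"
  using assms
proof (induction n arbitrary: c)
  case 0
  then show ?case by simp
next
  case (Suc n)
  have "cf_conv (\<lambda>i. c (Suc i)) n \<ge> 1" using Suc by simp
  moreover have "(of_int (c 0) :: real) \<ge> 1" using Suc.prems[of 0] by simp
  ultimately show ?case by (simp add: add_increasing2)
qed

lemma abs_cf_conv_ge_1:
  assumes "\<And>i. \<bar>c i\<bar> \<ge> 2"
  shows "\<bar>cf_conv c n\<bar> \<ge> 1"
  using assms
proof (induction n arbitrary: c)
  case 0
  show ?case using "0"[of 0] by simp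
next
  case (Suc n)
  have "\<bar>cf_conv (\<lambda>i. c (Suc i)) n\<bar> \<ge> 1" using Suc by simp
  then have "\<bar>1 / cf_conv (\<lambda>i. c (Suc i)) n\<bar> \<le> 1" by (simp add: field_simps)
  moreover have "\<bar>of_int (c 0) :: real\<bar> \<ge> 2" using Suc.prems[of 0] by linarith
  ultimately show ?case unfolding cf_conv.simps by linarith
qed

text \<open>Feeding the upper bound for the next tail back into the step gives the third estimate:
  the tails stay away from 1 by a fixed amount. This uniform expansion drives the descent
  below.\<close>

lemma regular_cf_tail_bounds:
  assumes "x \<notin> \<rat>" "regular_cf_expansion x a" "\<And>i. a i \<le> M" "k \<ge> 1"
  shows "1 < cf_tail x a k" "cf_tail x a k < of_int M + 1"
    "1 + 1 / (of_int M + 1) < cf_tail x a k"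
proof -
  have gt: "1 < cf_tail x a k" if "k \<ge> 1" for k
  proof -
    have "cf_conv (\<lambda>i. a (i + k)) \<longlonglongrightarrow> cf_tail x a k"
      using assms by (intro cf_conv_tail_limit) (auto simp: regular_cf_expansion_def)
    moreover have "cf_conv (\<lambda>i. a (i + k)) n \<ge> 1" for n
      using assms(2) that by (intro cf_conv_ge_1) (auto simp: regular_cf_expansion_def)
    ultimately have "cf_tail x a k \<ge> 1" by (meson LIMSEQ_le_const)
    moreover have "cf_tail x a k \<noteq> 1" using cf_tail_irrational[OF assms(1), of a k] by auto
    ultimately show ?thesis by simp
  qed
  have lt: "cf_tail x a k < of_int M + 1" if "k \<ge> 1" for k
  proof -
    have "1 / cf_tail x a (Suc k) < 1" using gt[of "Suc k"] by (simp del: cf_tail.simps)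
    moreover have "(of_int (a k) :: real) \<le> of_int M" using assms(3) by simp
    ultimately show ?thesis using cf_tail_step[of x a k] by linarith
  qed
  show "1 < cf_tail x a k" "cf_tail x a k < of_int M + 1" using gt lt assms(4) by auto
  have "1 / (of_int M + 1) < 1 / cf_tail x a (Suc k)"
    using gt[of "Suc k"] lt[of "Suc k"] by (intro divide_strict_left_mono) (auto simp del: cf_tail.simps)
  moreover have "(of_int (a k) :: real) \<ge> 1"
    using assms(2,4) by (simp add: regular_cf_expansion_def)
  ultimately show "1 + 1 / (of_int M + 1) < cf_tail x a k"
    using cf_tail_step[of x a k] by linarith
qed

section \<open>Small linear forms in a number of bounded type\<close>

lemma irrational_combination_nonzero:
  fixes p q :: int
  assumes "x \<notin> \<rat>" "p \<noteq> 0 \<or> q \<noteq> 0"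
  shows "of_int q * x - of_int p \<noteq> 0"
proof
  assume *: "of_int q * x - of_int p = 0"
  show False
  proof (cases "q = 0")
    case True
    with * assms show False by simp
  next
    case False
    with * have "x = of_int p / of_int q" by (simp add: field_simps)
    with assms show False by simp
  qed
qed

text \<open>The product \<open>q \<bar>q y - p\<bar>\<close> is almost invariant under one step of the continued fraction
  algorithm; the loss is controlled by the correction term \<open>C (q y - p)\<^sup>2\<close>.\<close>

lemma regular_cf_descent:
  fixes p q :: int and C \<eta> L D :: real
  assumes "\<And>k. k \<ge> 1 \<Longrightarrow> L < y k \<and> y k < D" "L > 1" 
    and "\<And>k. y k = of_int (a k) + 1 / y (Suc k)" "\<And>k. y k \<notin> \<rat>"
    and "C * (1 - 1 / L\<^sup>2) \<ge> 1" "0 < \<eta>" "\<eta> < 1" "C * \<eta> \<le> 1 / 2"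
    and "p \<noteq> 0 \<or> q \<noteq> 0" "\<bar>of_int q * y k - of_int p\<bar> \<le> \<eta>" 
    and "\<bar>of_int q * y k - of_int p\<bar> * L ^ n > \<eta>"
  shows "\<bar>of_int q\<bar> * \<bar>of_int q * y k - of_int p\<bar> - C * (of_int q * y k - of_int p)\<^sup>2 \<ge> \<eta> / (2 * D)"
  using assms(9-11)
proof (induction n arbitrary: k p q)
  case 0
  then show ?case by simp
next
  case (Suc n)
  define \<xi> where "\<xi> = of_int q * y k - of_int p"
  \<comment> \<open>\<open>\<xi>'\<close> is the same form one level deeper. Up to sign it equals
    \<open>y (Suc k) * \<xi>\<close>, so small forms expand at every step and \<open>n\<close>
    bounds the number of steps until \<open>\<eta>\<close> is exceeded.\<close>
  define q' where "q' = p - a k * q"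
  define \<xi>' where "\<xi>' = of_int q' * y (Suc k) - of_int q"
  have bnd: "L < y (Suc k)" "y (Suc k) < D" using assms(1)[of "Suc k"] by auto
  then have pos: "y (Suc k) > 0" "D > 0" using assms(2) by linarith+
  have yk: "y k = of_int (a k) + 1 / y (Suc k)" by (rule assms(3))
  have step: "\<xi> = - \<xi>' / y (Suc k)"
    unfolding \<xi>_def \<xi>'_def q'_def yk using pos(1) by (simp add: field_simps)
  have ab: "\<bar>\<xi>'\<bar> = y (Suc k) * \<bar>\<xi>\<bar>" using step pos by (simp add: abs_divide)
  have \<xi>0: "\<xi> \<noteq> 0" unfolding \<xi>_def
    using irrational_combination_nonzero[OF assms(4) Suc.prems(1)] by simp
  have ab2: "\<bar>\<xi>'\<bar> \<ge> L * \<bar>\<xi>\<bar>" unfolding ab using bnd by (intro mult_right_mono) auto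
  have C: "C \<ge> 1"
  proof -
    have "1 - 1 / L\<^sup>2 \<le> 1" by simp
    moreover have "1 - 1 / L\<^sup>2 > 0" using assms(2) by (simp add: field_simps one_less_power)
    ultimately show ?thesis using assms(5)
      by (smt (verit) mult_left_le mult_nonpos_nonneg)
  qed
  show ?case
  proof (cases "\<bar>\<xi>'\<bar> > \<eta>")
    \<comment> \<open>First step beyond \<open>\<eta>\<close>: then \<open>\<bar>\<xi>\<bar>\<close>
      is already at least \<open>\<eta> / D\<close>, while \<open>q = 0\<close> would force a
      nonzero integer of modulus below 1.\<close>
    case True
    have "q \<noteq> 0"
    proof
      assume "q = 0"
      with Suc.prems have "p \<noteq> 0" "\<bar>of_int p :: real\<bar> \<le> \<eta>" by auto
      then have "\<bar>p\<bar> \<ge> 1" "\<bar>of_int p :: real\<bar> < 1" using assms(7) by linarith+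
      then show False by linarith
    qed
    then have q1: "\<bar>of_int q :: real\<bar> \<ge> 1" by linarith
    have "\<bar>\<xi>'\<bar> \<le> D * \<bar>\<xi>\<bar>" unfolding ab using bnd by (intro mult_right_mono) auto
    with True pos have low: "\<bar>\<xi>\<bar> \<ge> \<eta> / D" by (simp add: field_simps)
    have "C * \<bar>\<xi>\<bar> \<le> 1 / 2"
    proof -
      have "C * \<bar>\<xi>\<bar> \<le> C * \<eta>" using C Suc.prems(2) by (intro mult_left_mono) (auto simp: \<xi>_def)
      with assms(8) show ?thesis by linarith
    qed
    then have "C * \<bar>\<xi>\<bar> * \<bar>\<xi>\<bar> \<le> 1 / 2 * \<bar>\<xi>\<bar>" by (intro mult_right_mono) auto
    moreover have "1 * \<bar>\<xi>\<bar> \<le> \<bar>of_int q\<bar> * \<bar>\<xi>\<bar>" using q1 by (intro mult_right_mono) auto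
    ultimately have "\<bar>of_int q\<bar> * \<bar>\<xi>\<bar> - C * \<xi>\<^sup>2 \<ge> 1 / 2 * \<bar>\<xi>\<bar>"
      by (simp add: power2_eq_square mult.assoc)
    moreover have "1 / 2 * \<bar>\<xi>\<bar> \<ge> \<eta> / (2 * D)" using low by (simp add: field_simps)
    ultimately show ?thesis unfolding \<xi>_def by linarith
  next
    case False
    have nz: "q \<noteq> 0 \<or> q' \<noteq> 0" using Suc.prems(1) by (auto simp: q'_def)
    have "\<bar>\<xi>'\<bar> * L ^ n \<ge> L * \<bar>\<xi>\<bar> * L ^ n" using ab2 assms(2) by (intro mult_right_mono) auto
    with Suc.prems(3) have big: "\<bar>\<xi>'\<bar> * L ^ n > \<eta>" by (simp add: \<xi>_def mult_ac)
    have IH: "\<bar>of_int q'\<bar> * \<bar>\<xi>'\<bar> - C * \<xi>'\<^sup>2 \<ge> \<eta> / (2 * D)"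
      using Suc.IH[OF nz, of "Suc k"] False big by (simp add: \<xi>'_def)
    have "of_int q * \<xi> = - of_int q' * \<xi>' + \<xi>'\<^sup>2 / y (Suc k)"
      unfolding step using pos(1) by (simp add: \<xi>'_def power2_eq_square field_simps)
    then have "\<bar>of_int q * \<xi>\<bar> \<ge> \<bar>of_int q' * \<xi>'\<bar> - \<bar>\<xi>'\<^sup>2 / y (Suc k)\<bar>" by linarith
    moreover have "\<bar>\<xi>'\<^sup>2 / y (Suc k)\<bar> \<le> \<xi>'\<^sup>2"
      using bnd assms(2) mult_left_mono[of 1 "y (Suc k)" "\<xi>'\<^sup>2"] by (simp add: field_simps)
    \<comment> \<open>The choice of \<open>C\<close> makes the correction at the deeper level pay
      for the loss in the triangle inequality as well as for the correction at level
      \<open>k\<close>.\<close>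
    moreover have "C * \<xi>'\<^sup>2 - \<xi>'\<^sup>2 \<ge> C * \<xi>\<^sup>2"
    proof -
      have "(L * \<bar>\<xi>\<bar>)\<^sup>2 \<le> \<bar>\<xi>'\<bar>\<^sup>2" using ab2 assms(2) by (intro power_mono) auto
      then have "\<xi>\<^sup>2 \<le> \<xi>'\<^sup>2 / L\<^sup>2" using assms(2) by (simp add: power_mult_distrib field_simps)
      then have "C * \<xi>\<^sup>2 \<le> C * (\<xi>'\<^sup>2 / L\<^sup>2)" using C by (intro mult_left_mono) auto
      moreover have "1 * \<xi>'\<^sup>2 \<le> (C * (1 - 1 / L\<^sup>2)) * \<xi>'\<^sup>2"
        using assms(5) by (intro mult_right_mono) auto
      ultimately show ?thesis by (simp add: algebra_simps)
    qed
    ultimately show ?thesis using IH unfolding \<xi>_def abs_mult by linarith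
  qed
qed

lemma bounded_type_badly_approximable:
  assumes "bounded_type x"
  shows "\<exists>c>0. \<forall>(p::int) (q::int). q \<noteq> 0 \<longrightarrow> c \<le> \<bar>of_int q\<bar> * \<bar>of_int q * x - of_int p\<bar>"
proof -
  from assms obtain a where irr: "x \<notin> \<rat>" and reg: "regular_cf_expansion x a" 
    and bdd: "bdd_above (range a)" by (auto simp: bounded_type_def)
  from bdd obtain M where M: "\<And>i. a i \<le> M" by (auto simp: bdd_above_def)
  have "1 \<le> a 1" using reg by (auto simp: regular_cf_expansion_def)
  with M[of 1] have M1: "M \<ge> 1" by linarith
  define D where "D = of_int M + (1::real)"
  define L where "L = 1 + 1 / D"
  have D: "D \<ge> 2" using M1 by (simp add: D_def)
  have L: "L > 1" using D by (simp add: L_def)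
  then have "1 - 1 / L\<^sup>2 > 0" by (simp add: field_simps one_less_power)
  \<comment> \<open>\<open>C\<close> solves \<open>C * (1 - 1 / L\<^sup>2) = 1\<close>, and
    \<open>\<eta>\<close> is small enough for the correction to cost at most half of the main
    term.\<close>
  define C where "C = 1 / (1 - 1 / L\<^sup>2)"
  have C: "C * (1 - 1 / L\<^sup>2) \<ge> 1" "C > 0" using \<open>1 - 1 / L\<^sup>2 > 0\<close> by (auto simp: C_def)
  define \<eta> where "\<eta> = min (1/2) (1 / (2 * C))"
  have \<eta>: "0 < \<eta>" "\<eta> < 1" "C * \<eta> \<le> 1 / 2"
    using C(2) by (auto simp: \<eta>_def min_def field_simps)
  have "\<eta> / (2 * D) \<le> \<bar>of_int q\<bar> * \<bar>of_int q * x - of_int p\<bar>" if q: "q \<noteq> 0" for p q :: int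
  proof (cases "\<bar>of_int q * x - of_int p\<bar> \<le> \<eta>")
    case True
    have nz: "\<bar>of_int q * x - of_int p\<bar> > 0"
      using irrational_combination_nonzero[OF irr, of p q] q by simp
    from real_arch_pow[OF L, of "\<eta> / \<bar>of_int q * x - of_int p\<bar>"]
    obtain n where "L ^ n > \<eta> / \<bar>of_int q * x - of_int p\<bar>" by blast
    with nz have big: "\<bar>of_int q * x - of_int p\<bar> * L ^ n > \<eta>" by (simp add: field_simps)
    have "\<bar>of_int q\<bar> * \<bar>of_int q * cf_tail x a 0 - of_int p\<bar> 
         - C * (of_int q * cf_tail x a 0 - of_int p)\<^sup>2 \<ge> \<eta> / (2 * D)"
    proof (rule regular_cf_descent[where y = "cf_tail x a" and a = a and L = L and D = D and n = n])
      show "L < cf_tail x a k \<and> cf_tail x a k < D" if "k \<ge> 1" for k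
        using regular_cf_tail_bounds[OF irr reg M that] by (simp add: L_def D_def)
    qed (use True big L C \<eta> q cf_tail_irrational[OF irr] in \<open>auto\<close>)
    moreover have "C * (of_int q * cf_tail x a 0 - of_int p)\<^sup>2 \<ge> 0" using C by simp
    ultimately show ?thesis by simp
  next
    case False
    have "\<eta> / (2 * D) \<le> \<eta> / 1" using D \<eta> by (intro divide_left_mono) auto
    also have "\<dots> \<le> 1 * \<bar>of_int q * x - of_int p\<bar>" using False by simp
    also have "\<dots> \<le> \<bar>of_int q\<bar> * \<bar>of_int q * x - of_int p\<bar>"
    proof (intro mult_right_mono)
      show "(1::real) \<le> \<bar>of_int q\<bar>" using q by linarith
    qed auto
    finally show ?thesis .
  qed
  moreover have "\<eta> / (2 * D) > 0" using \<eta> D by simp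
  ultimately show ?thesis by blast
qed

section \<open>Even continued fractions and their integer recursions\<close>

fun even_rec :: "(nat \<Rightarrow> int) \<Rightarrow> int \<Rightarrow> int \<Rightarrow> nat \<Rightarrow> int" where
  "even_rec m a b 0 = a"
| "even_rec m a b (Suc 0) = b"
| "even_rec m a b (Suc (Suc k)) = even_rec m a b k - 2 * m (Suc k) * even_rec m a b (Suc k)"

lemma even_rec_induct:
  assumes "Q 0" "Q (Suc 0)" "\<And>k. Q k \<Longrightarrow> Q (Suc k) \<Longrightarrow> Q (Suc (Suc k))"
  shows "Q (k :: nat)"
proof -
  have "Q k \<and> Q (Suc k)" by (induction k) (use assms in auto)
  then show ?thesis by simp
qed

text \<open>The digits enter the recursion with the factor 2, so modulo 2 every solution has period
  two.\<close>

lemma odd_even_rec: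
  assumes "odd a" "odd b"
  shows "odd (even_rec m a b k)"
  by (induction k rule: even_rec_induct) (use assms in auto)

lemma odd_even_rec_add:
  assumes "odd (a + b)"
  shows "odd (even_rec m a b k + even_rec m a b (Suc k))"
  by (induction k) (use assms in auto)

lemma abs_diff_opposite_signs: "x * z \<le> 0 \<Longrightarrow> \<bar>x - z\<bar> = \<bar>x\<bar> + \<bar>z\<bar>" for x z :: real
  by (auto simp: mult_le_0_iff)

lemma abs_diff_same_signs: "x * z > 0 \<Longrightarrow> \<bar>x - z\<bar> = \<bar>\<bar>x\<bar> - \<bar>z\<bar>\<bar>" for x z :: real
  by (auto simp: zero_less_mult_iff)

locale even_cf =
  fixes \<beta> :: real and m :: "nat \<Rightarrow> int"
  assumes irr: "\<beta> \<notin> \<rat>" and expansion: "even_cf_expansion \<beta> m"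
begin

definition y :: "nat \<Rightarrow> real" where "y = cf_tail \<beta> (\<lambda>i. 2 * m i)"

lemma y_0: "y 0 = \<beta>" by (simp add: y_def)

lemma y_irrational: "y k \<notin> \<rat>"
  unfolding y_def by (rule cf_tail_irrational [OF irr])

lemma y_nonzero: "y k \<noteq> 0"
  using y_irrational[of k] by auto

lemma y_step: "y k = 2 * of_int (m k) + 1 / y (Suc k)"
  unfolding y_def using cf_tail_step[of \<beta> "\<lambda>i. 2 * m i" k] by (simp only: of_int_mult of_int_numeral)

lemma m_nonzero: "m (Suc k) \<noteq> 0"
  using expansion by (auto simp: even_cf_expansion_def)

lemma abs_y: "\<bar>y (Suc k)\<bar> > 1"
proof -
  have "cf_conv (\<lambda>i. 2 * m (i + Suc k)) \<longlonglongrightarrow> y (Suc k)"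
    using expansion irr unfolding y_def
    by (intro cf_conv_tail_limit) (auto simp: even_cf_expansion_def)
  then have "(\<lambda>n. \<bar>cf_conv (\<lambda>i. 2 * m (i + Suc k)) n\<bar>) \<longlonglongrightarrow> \<bar>y (Suc k)\<bar>"
    by (rule tendsto_rabs)
  moreover have "\<bar>cf_conv (\<lambda>i. 2 * m (i + Suc k)) n\<bar> \<ge> 1" for n
  proof (rule abs_cf_conv_ge_1)
    fix i
    show "2 \<le> \<bar>2 * m (i + Suc k)\<bar>" using m_nonzero[of "i + k"] by (simp add: abs_mult)
  qed
  ultimately have "\<bar>y (Suc k)\<bar> \<ge> 1" by (meson LIMSEQ_le_const)
  moreover have "\<bar>y (Suc k)\<bar> \<noteq> 1" using y_irrational[of "Suc k"] by (auto simp: abs_if split: if_splits)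
  ultimately show ?thesis by simp
qed

text \<open>The digit \<open>2 * m\<close> has modulus at least 2 and the remainder
  \<open>1 / y\<close> less than 1, so the digit decides the sign. This is how
  \<open>sgn (m j)\<close> gets into the drift.\<close>

lemma sgn_y: "sgn (y (Suc k)) = of_int (sgn (m (Suc k)))"
proof -
  define z where "z = 1 / y (Suc (Suc k))"
  have "\<bar>z\<bar> < 1" using abs_y[of "Suc k"] by (simp add: z_def field_simps)
  moreover have "m (Suc k) \<ge> 1 \<or> m (Suc k) \<le> -1" using m_nonzero[of k] by linarith
  then have "(of_int (m (Suc k)) :: real) \<ge> 1 \<and> m (Suc k) \<ge> 1 \<or> (of_int (m (Suc k)) :: real) \<le> -1 \<and> m (Suc k) \<le> -1"
    by linarith
  moreover have "y (Suc k) = 2 * of_int (m (Suc k)) + z" unfolding z_def by (rule y_step)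
  ultimately show ?thesis by (auto simp: sgn_if)
qed

primrec P :: "nat \<Rightarrow> real" where
  "P 0 = 1"
| "P (Suc k) = P k / y (Suc k)"

lemma P_nonzero: "P k \<noteq> 0"
  by (induction k) (auto simp: y_nonzero)

lemma P_rec: "P k = 2 * of_int (m (Suc k)) * P (Suc k) + P (Suc (Suc k))"
proof -
  have "P k = y (Suc k) * P (Suc k)" by (simp add: y_nonzero)
  also have "\<dots> = 2 * of_int (m (Suc k)) * P (Suc k) + P (Suc (Suc k))"
    by (subst y_step) (simp add: algebra_simps)
  finally show ?thesis .
qed

lemma P_decreasing: "\<bar>P (Suc k)\<bar> < \<bar>P k\<bar>"
  using abs_y[of k] P_nonzero[of k] by (simp add: abs_divide field_simps)

lemma P_antimono: "k \<le> l \<Longrightarrow> \<bar>P l\<bar> \<le> \<bar>P k\<bar>"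
  by (induction rule: dec_induct) (use P_decreasing in \<open>auto intro: less_imp_le order.trans\<close>)

definition t where "t = even_rec m 0 1"
definition s where "s = even_rec m 1 (- 2 * m 0)"

lemma t_simps: "t 0 = 0" "t (Suc 0) = 1" "t (Suc (Suc k)) = t k - 2 * m (Suc k) * t (Suc k)"
  by (simp_all add: t_def)

lemma s_simps: "s 0 = 1" "s (Suc 0) = - 2 * m 0" "s (Suc (Suc k)) = s k - 2 * m (Suc k) * s (Suc k)"
  by (simp_all add: s_def)

lemma P_eq: "P k = of_int (s k) + of_int (t k) * \<beta>"
proof (induction k rule: even_rec_induct)
  case 1
  then show ?case by (simp add: s_simps t_simps)
next
  case 2
  then show ?case using y_step[of 0] by (simp add: s_simps t_simps y_0)
next
  case (3 k)
  have "P (Suc (Suc k)) = P k - 2 * of_int (m (Suc k)) * P (Suc k)"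
    using P_rec[of k] by linarith
  then show ?case unfolding 3 by (simp add: s_simps t_simps algebra_simps)
qed

text \<open>The digit contributes at least two copies of \<open>\<bar>t (Suc k)\<bar>\<close>, and
  the previous term cancels strictly less than one of them.\<close>

lemma t_increasing: "\<bar>t k\<bar> < \<bar>t (Suc k)\<bar>"
proof (induction k)
  case 0
  then show ?case by (simp add: t_simps)
next
  case (Suc k)
  have "1 * \<bar>t (Suc k)\<bar> \<le> \<bar>m (Suc k)\<bar> * \<bar>t (Suc k)\<bar>"
    using m_nonzero[of k] by (intro mult_right_mono) auto
  then have "2 * \<bar>t (Suc k)\<bar> \<le> \<bar>2 * m (Suc k) * t (Suc k)\<bar>" by (simp add: abs_mult)
  with Suc show ?case unfolding t_simps(3) by linarith
qed

lemma t_mono: "k \<le> l \<Longrightarrow> \<bar>t k\<bar> \<le> \<bar>t l\<bar>"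
  by (induction rule: dec_induct) (use t_increasing in \<open>auto intro: less_imp_le order.trans\<close>)

lemma t_nonzero: "t (Suc k) \<noteq> 0"
  using t_increasing[of k] by auto

lemma t_P_det: "of_int (t (Suc k)) * P k - of_int (t k) * P (Suc k) = (-1) ^ k"
proof (induction k)
  case 0
  then show ?case by (simp add: t_simps)
next
  case (Suc k)
  have "of_int (t (Suc (Suc k))) * P (Suc k) - of_int (t (Suc k)) * P (Suc (Suc k)) 
      = - (of_int (t (Suc k)) * P k - of_int (t k) * P (Suc k))"
    using P_rec[of k] by (simp add: t_simps algebra_simps del: P.simps)
  with Suc show ?case by simp
qed

definition A0 :: "nat \<Rightarrow> int" where "A0 k = t k + t (Suc k)"

text \<open>\<open>A k (Suc j)\<close> and \<open>A k j\<close> are the coordinates of the frequency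
  \<open>P k + P (Suc k)\<close> in the basis \<open>P j\<close>, \<open>P (Suc j)\<close>.
  Coordinates follow the dual recursion, hence \<open>- m i\<close>; the initial values rewrite
  \<open>s + t * \<beta>\<close> in terms of \<open>P 0 = 1\<close> and
  \<open>P 1 = \<beta> - 2 * m 0\<close>.\<close>

definition A :: "nat \<Rightarrow> nat \<Rightarrow> int" where
  "A k = even_rec (\<lambda>i. - m i) (A0 k) (s k + s (Suc k) + 2 * m 0 * A0 k)"

lemma A_simps: "A k 0 = A0 k" "A k (Suc (Suc j)) = A k j + 2 * m (Suc j) * A k (Suc j)"
  by (simp_all add: A_def)

text \<open>\<open>s\<close> and \<open>t\<close> alternate in parity, so sums of consecutive terms
  are odd. This is the reason for the frequency \<open>P k + P (Suc k)\<close> instead of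
  \<open>P k\<close>: a square wave contains odd harmonics only.\<close>

lemma A_odd: "odd (A k j)"
proof -
  have "odd (A0 k)" unfolding A0_def t_def by (rule odd_even_rec_add) simp
  moreover have "odd (s k + s (Suc k))" unfolding s_def by (rule odd_even_rec_add) simp
  ultimately show ?thesis unfolding A_def by (intro odd_even_rec) auto
qed

lemma A_nonzero: "A k j \<noteq> 0"
  using A_odd[of k j] by auto

lemma A_frequency: "P k + P (Suc k) = of_int (A k (Suc j)) * P j + of_int (A k j) * P (Suc j)"
proof (induction j)
  case 0
  have "P (Suc 0) = \<beta> - 2 * of_int (m 0)" using P_eq[of 1] by (simp add: s_simps t_simps)
  then show ?case unfolding P_eq[of k] P_eq[of "Suc k"] \<open>P (Suc 0) = _\<close>
    by (simp add: A_def A0_def algebra_simps)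
next
  case (Suc j)
  have "of_int (A k (Suc (Suc j))) * P (Suc j) + of_int (A k (Suc j)) * P (Suc (Suc j))
    = of_int (A k (Suc j)) * P j + of_int (A k j) * P (Suc j)"
    using P_rec[of j] by (simp add: A_simps algebra_simps del: P.simps)
  with Suc show ?case by simp
qed

text \<open>A conserved pairing of the two dual recursions; it supplies the Wronskian for the
  telescoping sum.\<close>

lemma A_t: "A0 k = A k (Suc j) * t j + A k j * t (Suc j)"
proof (induction j)
  case 0
  then show ?case by (simp add: t_simps A_simps)
next
  case (Suc j)
  have "A k (Suc (Suc j)) * t (Suc j) + A k (Suc j) * t (Suc (Suc j))
    = A k (Suc j) * t j + A k j * t (Suc j)"
    by (simp add: A_simps t_simps algebra_simps)
  with Suc show ?case by simp
qed

text \<open>Telescoping: \<open>(-1) ^ j * t j\<close> and \<open>A k j\<close> solve the same recursion, so their Wronskian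
  alternates in sign.\<close>

lemma A_telescope:
  "(\<Sum>j<K. (-1) ^ Suc j / of_int (A k (Suc j) * A k j))
     = (-1) ^ K * of_int (t K) / (of_int (A0 k * A k K) :: real)"
proof (induction K)
  case 0
  then show ?case by (simp add: t_simps)
next
  case (Suc K)
  have A: "of_int (A0 k) = (of_int (A k (Suc K) * t K + A k K * t (Suc K)) :: real)"
    using A_t[of k K] by simp
  have nz: "of_int (A k K) \<noteq> (0::real)" "of_int (A k (Suc K)) \<noteq> (0::real)" "of_int (A0 k) \<noteq> (0::real)"
    using A_nonzero A_simps(1)[of k] by (metis of_int_eq_0_iff)+
  have "(-1) ^ K * of_int (t K) / (of_int (A0 k * A k K) :: real) + (-1) ^ Suc K / of_int (A k (Suc K) * A k K)
      = (-1) ^ K * (of_int (t K) * of_int (A k (Suc K)) - of_int (A0 k)) / of_int (A0 k * A k K * A k (Suc K))"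
    using nz by (simp add: field_simps)
  also have "of_int (t K) * of_int (A k (Suc K)) - of_int (A0 k) = (- of_int (A k K) * of_int (t (Suc K)) :: real)"
    unfolding A by simp
  also have "(-1) ^ K * (- of_int (A k K) * of_int (t (Suc K))) / of_int (A0 k * A k K * A k (Suc K))
      = (-1) ^ Suc K * of_int (t (Suc K)) / (of_int (A0 k * A k (Suc K)) :: real)"
    using nz by simp
  finally show ?case using Suc by simp
qed

end

section \<open>Uniform estimates from bad approximability\<close>

locale badly_approximable_even_cf = even_cf +
  fixes c :: real
  assumes c_pos: "c > 0" and c_le_1: "c \<le> 1"
    and badly: "\<And>(p::int) (q::int). q \<noteq> 0 \<Longrightarrow> c \<le> \<bar>of_int q\<bar> * \<bar>of_int q * \<beta> - of_int p\<bar>"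
begin

text \<open>When the two terms of the determinant \<open>t_P_det\<close> have opposite signs they
  add up in modulus and the bound is immediate. Even digits of either sign also allow cancellation;
  then bad approximability, applied to the intermediate denominator
  \<open>t k - \<sigma> * t (Suc k)\<close>, excludes large products.\<close>

lemma t_P_bound: "c * (\<bar>of_int (t (Suc k))\<bar> * \<bar>P k\<bar>) \<le> 1"
proof -
  define a b p p' where "a = \<bar>of_int (t k) :: real\<bar>" and "b = \<bar>of_int (t (Suc k)) :: real\<bar>"
    and "p = \<bar>P k\<bar>" and "p' = \<bar>P (Suc k)\<bar>"
  have ab: "0 \<le> a" "a < b" unfolding a_def b_def using t_increasing[of k] by linarith+
  have pp: "0 < p'" "p' < p" unfolding p_def p'_def 
    using P_decreasing[of k] P_nonzero[of "Suc k"] by (auto simp del: P.simps)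
  have det: "\<bar>of_int (t (Suc k)) * P k - of_int (t k) * P (Suc k)\<bar> = 1"
    unfolding t_P_det by simp
  have "c * (b * p) \<le> 1"
  proof (cases "of_int (t (Suc k)) * P k * (of_int (t k) * P (Suc k)) \<le> 0")
    case True
    then have "\<bar>of_int (t (Suc k)) * P k - of_int (t k) * P (Suc k)\<bar>
        = \<bar>of_int (t (Suc k)) * P k\<bar> + \<bar>of_int (t k) * P (Suc k)\<bar>"
      by (rule abs_diff_opposite_signs)
    with det have "b * p + a * p' = 1" by (simp add: abs_mult a_def b_def p_def p'_def)
    moreover have "a * p' \<ge> 0" using ab pp by simp
    moreover have "0 \<le> b * p" using ab pp by simp
    ultimately have "b * p \<le> 1" "0 \<le> b * p" by linarith+
    then have "c * (b * p) \<le> 1 * 1" using c_le_1 c_pos by (intro mult_mono) auto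
    then show ?thesis by simp
  next
    case False
    then have "\<bar>of_int (t (Suc k)) * P k - of_int (t k) * P (Suc k)\<bar>
        = \<bar>\<bar>of_int (t (Suc k)) * P k\<bar> - \<bar>of_int (t k) * P (Suc k)\<bar>\<bar>"
      by (intro abs_diff_same_signs) simp
    with det have d: "\<bar>b * p - a * p'\<bar> = 1" by (simp only: abs_mult a_def b_def p_def p'_def)
    have "a * p' \<le> b * p" using ab pp by (intro mult_mono) auto
    with d have d: "b * p - a * p' = 1" by simp
    \<comment> \<open>Here the two terms of the determinant have equal signs. The sign
      \<open>\<sigma>\<close> makes both the denominators and the forms subtract in modulus, giving
      \<open>b - a\<close> and \<open>p - p'\<close>.\<close>
    obtain \<sigma> :: int where \<sigma>: "\<sigma> = 1 \<or> \<sigma> = -1" and 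
      sg: "\<bar>of_int (t k) - of_int \<sigma> * of_int (t (Suc k))\<bar> = b - a"
          "\<bar>P k - of_int \<sigma> * P (Suc k)\<bar> = p - p'"
    proof -
      define \<sigma> :: int where "\<sigma> = (if P k * P (Suc k) > 0 then 1 else -1)"
      have tt: "P k * P (Suc k) > 0 \<longleftrightarrow> (of_int (t k) :: real) * of_int (t (Suc k)) > 0"
      proof -
        have "(P k * P (Suc k)) * (of_int (t k) * of_int (t (Suc k))) > 0"
          using False by (simp add: not_le mult_ac del: P.simps)
        moreover have "x * z > 0 \<Longrightarrow> (x > 0) = (z > 0)" for x z :: real
          by (auto simp: zero_less_mult_iff)
        ultimately show ?thesis by blast
      qed
      have nz: "(of_int (t k) :: real) * of_int (t (Suc k)) \<noteq> 0" "P k * P (Suc k) \<noteq> 0"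
        using False by auto
      have gen: "\<bar>x - (if x * z > 0 then 1 else -1) * z\<bar> = \<bar>\<bar>z\<bar> - \<bar>x\<bar>\<bar>" if "x * z \<noteq> 0" for x z :: real
        using that by (auto simp: zero_less_mult_iff abs_if)
      have 1: "\<bar>of_int (t k) - of_int \<sigma> * of_int (t (Suc k))\<bar> = b - a"
      proof -
        have "(of_int \<sigma> :: real) = (if (of_int (t k) :: real) * of_int (t (Suc k)) > 0 then 1 else -1)"
          unfolding \<sigma>_def tt by simp
        then show ?thesis using gen[OF nz(1)] ab unfolding a_def b_def by (simp only: abs_of_nonneg)
      qed
      have 2: "\<bar>P k - of_int \<sigma> * P (Suc k)\<bar> = p - p'"
      proof -
        have "(of_int \<sigma> :: real) = (if P k * P (Suc k) > 0 then 1 else -1)"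
          unfolding \<sigma>_def by simp
        then show ?thesis using gen[OF nz(2)] pp unfolding p_def p'_def by (simp only:) linarith
      qed
      show ?thesis using that[of \<sigma>] 1 2 by (auto simp: \<sigma>_def)
    qed
    define q where "q = t k - \<sigma> * t (Suc k)"
    have "q \<noteq> 0" using sg(1) ab by (auto simp: q_def simp flip: of_int_mult of_int_diff)
    from badly[OF this, of "- (s k - \<sigma> * s (Suc k))"]
    have "c \<le> \<bar>of_int q\<bar> * \<bar>P k - of_int \<sigma> * P (Suc k)\<bar>"
      unfolding P_eq q_def by (simp add: algebra_simps)
    also have "\<dots> = (b - a) * (p - p')" using sg by (simp add: q_def)
    finally have "c * p \<le> (b - a) * (p - p') * p" using pp by (intro mult_right_mono) auto
    also have "\<dots> = ((b - a) * p) * (p - p')" by simp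
    \<comment> \<open>Since \<open>a * p'\<close> is at most \<open>a * p\<close> and at most
      \<open>b * p'\<close>, the determinant bounds both \<open>(b - a) * p\<close> and
      \<open>b * (p - p')\<close> by 1.\<close>
    also have "\<dots> \<le> 1 * (p - p')"
    proof (intro mult_right_mono)
      have "a * p' \<le> a * p" using ab pp by (intro mult_left_mono) auto
      with d show "(b - a) * p \<le> 1" by (simp add: algebra_simps)
    qed (use pp in auto)
    finally have "b * (c * p) \<le> b * (p - p')" using ab by (intro mult_left_mono) auto
    also have "\<dots> \<le> b * p - a * p'" using ab pp by (simp add: algebra_simps)
    finally show ?thesis using d by (simp add: mult_ac)
  qed
  then show ?thesis by (simp add: b_def p_def)
qed

text \<open>In terms of 1 and \<open>\<beta>\<close> the combination has denominator at most
  \<open>(\<bar>a\<bar> + \<bar>b\<bar>) * \<bar>t (Suc k)\<bar>\<close>. One factor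
  \<open>c\<close> comes from the approximation bound for \<open>\<beta>\<close>, the other from
  \<open>t_P_bound\<close>, which converts \<open>1 / \<bar>t (Suc k)\<bar>\<close> into
  \<open>\<bar>P k\<bar>\<close>. If \<open>\<beta>\<close> drops out, the form is a nonzero
  integer.\<close>

lemma P_badly_approximable:
  fixes a b :: int
  assumes "a \<noteq> 0 \<or> b \<noteq> 0"
  shows "c\<^sup>2 * \<bar>P k\<bar> / (\<bar>of_int a\<bar> + \<bar>of_int b\<bar>) \<le> \<bar>of_int a * P k + of_int b * P (Suc k)\<bar>"
proof -
  define q where "q = a * t k + b * t (Suc k)"
  define p where "p = - (a * s k + b * s (Suc k))"
  define n where "n = (\<bar>of_int a\<bar> + \<bar>of_int b\<bar> :: real)"
  have n: "n \<ge> 1" unfolding n_def using assms by linarith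
  have \<xi>: "of_int a * P k + of_int b * P (Suc k) = of_int q * \<beta> - of_int p"
    unfolding P_eq q_def p_def by (simp add: algebra_simps)
  have Pk: "0 < \<bar>P k\<bar>" "\<bar>P k\<bar> \<le> 1" using P_nonzero[of k] P_antimono[of 0 k] by auto
  show ?thesis
  proof (cases "q = 0")
    case True
    have "of_int a * P k + of_int b * P (Suc k) = (P k / y (Suc k)) * (of_int a * y (Suc k) - of_int (- b))"
      using y_nonzero[of "Suc k"] by (simp add: field_simps)
    also have "\<dots> \<noteq> 0"
      using irrational_combination_nonzero[OF y_irrational, of "- b" a] assms P_nonzero[of k] y_nonzero[of "Suc k"]
      by auto
    finally have "p \<noteq> 0" unfolding \<xi> True by auto
    then have "1 \<le> \<bar>of_int q * \<beta> - of_int p\<bar>" unfolding True by simp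
    moreover have "c\<^sup>2 * \<bar>P k\<bar> / n \<le> 1 * 1 / 1"
      using c_pos c_le_1 Pk n by (intro frac_le mult_mono power_le_one) auto
    ultimately show ?thesis unfolding \<xi> n_def by linarith
  next
    case False
    have q: "\<bar>of_int q :: real\<bar> \<le> n * \<bar>of_int (t (Suc k))\<bar>"
    proof -
      have "\<bar>of_int q :: real\<bar> \<le> \<bar>of_int a\<bar> * \<bar>of_int (t k)\<bar> + \<bar>of_int b\<bar> * \<bar>of_int (t (Suc k))\<bar>"
        unfolding q_def by (simp flip: abs_mult)
      also have "\<dots> \<le> \<bar>of_int a\<bar> * \<bar>of_int (t (Suc k))\<bar> + \<bar>of_int b\<bar> * \<bar>of_int (t (Suc k))\<bar>"
        using t_increasing[of k] by (intro add_mono mult_left_mono) auto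
      finally show ?thesis by (simp add: n_def algebra_simps)
    qed
    have qpos: "\<bar>of_int q :: real\<bar> > 0" using False by simp
    have "c\<^sup>2 * \<bar>P k\<bar> * \<bar>of_int q\<bar> \<le> c\<^sup>2 * \<bar>P k\<bar> * (n * \<bar>of_int (t (Suc k))\<bar>)"
      using q by (intro mult_left_mono) auto
    also have "\<dots> = n * c * (c * (\<bar>of_int (t (Suc k))\<bar> * \<bar>P k\<bar>))" by (simp add: power2_eq_square)
    also have "\<dots> \<le> n * c * 1" using t_P_bound[of k] n c_pos by (intro mult_left_mono) auto
    also have "\<dots> \<le> n * (\<bar>of_int q\<bar> * \<bar>of_int q * \<beta> - of_int p\<bar>)"
      using badly[OF False, of p] n by simp
    finally have "c\<^sup>2 * \<bar>P k\<bar> \<le> n * \<bar>of_int q * \<beta> - of_int p\<bar>"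
      using qpos by (simp add: mult_ac)
    then show ?thesis unfolding \<xi> n_def[symmetric] using n by (simp add: field_simps)
  qed
qed

text \<open>Up to sign the sum telescopes to \<open>t K / (A0 k * A k K)\<close>. The first
  denominator factor is at most of size \<open>t (Suc k)\<close>, the second at most of size
  \<open>P k * t K\<close>, so \<open>t K\<close> cancels and \<open>t_P_bound\<close> finishes.
  Uniformity in \<open>k\<close> and \<open>K\<close> gives every frequency a fixed weight.\<close>

lemma A_telescope_bound:
  assumes "k < K"
  shows "c / 8 \<le> \<bar>\<Sum>j<K. (-1) ^ Suc j / of_int (A k (Suc j) * A k j) :: real\<bar>"
proof -
  define T where "T = \<bar>of_int (t K) :: real\<bar>"
  define T1 where "T1 = \<bar>of_int (t (Suc k)) :: real\<bar>"
  define p where "p = \<bar>P k\<bar>"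
  have T: "T1 \<le> T" "T1 > 0" unfolding T_def T1_def
    using t_mono[of "Suc k" K] t_nonzero[of k] assms by auto
  have PK: "\<bar>P K\<bar> \<le> p" unfolding p_def using assms by (intro P_antimono) auto
  have p0: "p > 0" unfolding p_def using P_nonzero by simp
  have A0: "\<bar>of_int (A0 k) :: real\<bar> \<le> 2 * T1"
    unfolding A0_def T1_def using t_increasing[of k] by simp
  have \<xi>: "\<bar>P k + P (Suc k)\<bar> \<le> 2 * p" unfolding p_def using P_decreasing[of k] by linarith
  \<comment> \<open>Cramer's rule: the inserted factor is the determinant \<open>t_P_det\<close> of
    modulus 1, which eliminates \<open>A k (Suc K)\<close> from the two linear relations
    \<open>A_frequency\<close> and \<open>A_t\<close>.\<close>
  have "\<bar>of_int (A k K) :: real\<bar> = \<bar>of_int (A k K) * (of_int (t (Suc K)) * P K - of_int (t K) * P (Suc K))\<bar>"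
    unfolding t_P_det by (simp add: abs_mult)
  also have "of_int (A k K) * (of_int (t (Suc K)) * P K - of_int (t K) * P (Suc K))
     = of_int (A0 k) * P K - (P k + P (Suc k)) * of_int (t K)"
    unfolding A_frequency[of k K] A_t[of k K] by (simp add: algebra_simps del: P.simps)
  also have "\<bar>\<dots>\<bar> \<le> \<bar>of_int (A0 k)\<bar> * \<bar>P K\<bar> + \<bar>P k + P (Suc k)\<bar> * T"
    unfolding T_def by (simp flip: abs_mult)
  also have "\<dots> \<le> (2 * T) * p + (2 * p) * T"
    using A0 \<xi> PK T by (intro add_mono mult_mono) auto
  finally have AK: "\<bar>of_int (A k K) :: real\<bar> \<le> 4 * p * T" by (simp add: mult_ac)
  have "c * \<bar>of_int (A0 k * A k K)\<bar> \<le> c * ((2 * T1) * (4 * p * T))"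
    unfolding of_int_mult abs_mult using A0 AK c_pos T p0 by (intro mult_left_mono mult_mono) auto
  also have "\<dots> = 8 * T * (c * (T1 * p))" by simp
  also have "\<dots> \<le> 8 * T * 1"
    using t_P_bound[of k] T by (intro mult_left_mono) (auto simp: T1_def p_def)
  finally have "c * \<bar>of_int (A0 k * A k K)\<bar> \<le> 8 * T" by simp
  moreover have "\<bar>of_int (A0 k * A k K) :: real\<bar> > 0"
    using A_nonzero[of k K] A_nonzero[of k 0] by (simp add: A_simps)
  ultimately have "c / 8 \<le> T / \<bar>of_int (A0 k * A k K)\<bar>" by (simp add: field_simps)
  then show ?thesis unfolding A_telescope by (simp add: abs_mult abs_divide power_abs T_def)
qed

end

section \<open>Averages of bounded measurable functions\<close>

text \<open>Boundedness on the whole line and Borel measurability survive all operations used below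
  and imply integrability on every compact interval.\<close>

definition tame :: "(real \<Rightarrow> 'a::euclidean_space) \<Rightarrow> bool" where
  "tame f \<longleftrightarrow> f \<in> borel_measurable borel \<and> bounded (range f)"

lemma tame_integrable:
  assumes "tame f"
  shows "f integrable_on {a..b}"
proof -
  obtain B where B: "\<And>x. norm (f x) \<le> B"
    using assms by (auto simp: tame_def bounded_iff)
  have "f \<in> borel_measurable (lebesgue_on {a..b})"
    using assms by (auto simp: tame_def measurable_completion measurable_restrict_space1)
  then show ?thesis
    by (rule measurable_bounded_by_integrable_imp_integrable [where g = "\<lambda>_. B"]) (use B in auto)
qed

lemma tame_I: "f \<in> borel_measurable borel \<Longrightarrow> (\<And>x. norm (f x) \<le> B) \<Longrightarrow> tame f"
  by (auto simp: tame_def bounded_iff)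

lemma tame_const: "tame (\<lambda>_. c)"
  by (rule tame_I [where B = "norm c"]) auto

lemma tame_add: "tame f \<Longrightarrow> tame g \<Longrightarrow> tame (\<lambda>x. f x + g x)"
  by (auto simp: tame_def intro: bounded_plus_comp)

lemma tame_diff: "tame f \<Longrightarrow> tame g \<Longrightarrow> tame (\<lambda>x. f x - g x)"
  by (auto simp: tame_def intro: bounded_minus_comp)

lemma tame_mult:
  fixes f g :: "real \<Rightarrow> 'a::{euclidean_space, real_normed_algebra}"
  assumes "tame f" "tame g"
  shows "tame (\<lambda>x. f x * g x)"
proof -
  obtain A B where "\<And>x. norm (f x) \<le> A" "\<And>x. norm (g x) \<le> B"
    using assms by (auto simp: tame_def bounded_iff)
  then have "norm (f x * g x) \<le> A * B" for x
    by (meson mult_mono norm_ge_zero norm_mult_ineq order_trans)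
  then show ?thesis using assms by (intro tame_I) (auto simp: tame_def)
qed

lemma tame_sum: "(\<And>i. i \<in> I \<Longrightarrow> tame (f i)) \<Longrightarrow> tame (\<lambda>x. \<Sum>i\<in>I. f i x)"
  by (induction I rule: infinite_finite_induct) (auto intro: tame_const tame_add)

lemma tame_norm: "tame f \<Longrightarrow> tame (\<lambda>x. norm (f x))"
  by (auto simp: tame_def bounded_iff)

lemma tame_of_real: "tame f \<Longrightarrow> tame (\<lambda>x. complex_of_real (f x))"
  by (auto simp: tame_def bounded_iff)

lemma tame_power2: "tame f \<Longrightarrow> tame (\<lambda>x. (f x :: real)\<^sup>2)"
  unfolding power2_eq_square by (rule tame_mult)

lemma tame_shift: "tame f \<Longrightarrow> tame (\<lambda>x. f (x + d))"
  by (auto simp: tame_def bounded_iff)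

lemma tame_cis: "tame f \<Longrightarrow> tame (\<lambda>x. cis (f x))"
proof (rule tame_I [where B = 1])
  assume "tame f"
  then have [measurable]: "f \<in> borel_measurable borel" by (simp add: tame_def)
  show "(\<lambda>x. cis (f x)) \<in> borel_measurable borel"
    unfolding cis_conv_exp by measurable
qed auto

lemma tame_square_wave: "tame (\<lambda>x. square_wave (z * x))"
  by (rule tame_I [where B = 1]) auto

lemmas tame_intros = tame_const tame_add tame_diff tame_mult tame_sum tame_norm
  tame_of_real tame_power2 tame_cis tame_square_wave tame_shift

lemma integral_shift: "integral {a..b} (\<lambda>u. f (u + d)) = integral {a + d..b + d} f" for a :: real
  using integral_shift_Icc_real[of a b f d] by (simp add: o_def add.commute)

lemma norm_integral_le:
  assumes "tame f" "\<And>x. norm (f x) \<le> B" "T \<ge> 0"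
  shows "norm (integral {a..a+T} f) \<le> B * T"
proof -
  have "norm (integral {a..a+T} f) \<le> integral {a..a+T} (\<lambda>_. B)"
    using assms by (intro integral_norm_bound_integral) (auto intro: tame_integrable)
  also have "\<dots> = B * T" using assms(3) by simp
  finally show ?thesis .
qed

lemma tame_integral_combine:
  assumes "tame f" "a \<le> b" "b \<le> c"
  shows "integral {a..c} f = integral {a..b} f + integral {b..c} f"
  using Henstock_Kurzweil_Integration.integral_combine[OF assms(2,3) tame_integrable[OF assms(1)]] by simp

lemma integral_window_shift:
  fixes f :: "real \<Rightarrow> real"
  assumes "tame f" "\<And>x. \<bar>f x\<bar> \<le> 1" "0 \<le> \<tau>" "0 \<le> T"
  shows "\<bar>integral {a..a+T} f - integral {a+\<tau>..a+\<tau>+T} f\<bar> \<le> 2 * \<tau>"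
proof -
  have "integral {a..a+T+\<tau>} f = integral {a..a+T} f + integral {a+T..a+T+\<tau>} f"
    using assms by (intro tame_integral_combine) auto
  moreover have "integral {a..a+T+\<tau>} f = integral {a..a+\<tau>} f + integral {a+\<tau>..a+T+\<tau>} f"
    using assms by (intro tame_integral_combine) auto
  moreover have "\<bar>integral {a..a+\<tau>} f\<bar> \<le> 1 * \<tau>" "\<bar>integral {a+T..a+T+\<tau>} f\<bar> \<le> 1 * \<tau>"
    using norm_integral_le[OF assms(1), of 1 \<tau>] assms(2,3) by auto
  ultimately show ?thesis by (simp add: add_ac)
qed

text \<open>The integral telescopes to two end pieces of length \<open>h\<close>. Applied to a
  crossing count, this bounds the time during which a shifted wave differs from the
  original.\<close>

lemma integral_increment_mono:
  fixes H :: "real \<Rightarrow> real"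
  assumes "mono H" "0 \<le> h" "0 \<le> T"
  shows "integral {a..a+T} (\<lambda>u. H (u + h) - H u) \<le> h * (H (a + T + h) - H a)"
proof -
  have int: "H integrable_on {x..y}" for x y
    using assms(1) by (intro integrable_on_mono_on) (auto simp: mono_on_def mono_def)
  have int': "(\<lambda>u. H (u + h)) integrable_on {x..y}" for x y
    using assms(1) by (intro integrable_on_mono_on) (auto simp: mono_on_def mono_def)
  have "integral {a..a+T} (\<lambda>u. H (u + h) - H u) = integral {a+h..a+T+h} H - integral {a..a+T} H"
    using int int' integral_shift[of a "a+T" H h] by (simp add: Henstock_Kurzweil_Integration.integral_diff)
  moreover have "integral {a..a+h} H + integral {a+h..a+T+h} H = integral {a..a+T+h} H"
    using assms by (intro Henstock_Kurzweil_Integration.integral_combine int) auto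
  moreover have "integral {a..a+T} H + integral {a+T..a+T+h} H = integral {a..a+T+h} H"
    using assms by (intro Henstock_Kurzweil_Integration.integral_combine int) auto
  moreover have "integral {a+T..a+T+h} H \<le> integral {a+T..a+T+h} (\<lambda>_. H (a + T + h))"
    using assms(1) by (intro integral_le int) (auto simp: mono_def)
  moreover have "integral {a..a+h} (\<lambda>_. H a) \<le> integral {a..a+h} H"
    using assms(1) by (intro integral_le int) (auto simp: mono_def)
  ultimately show ?thesis using assms(2) by (simp add: algebra_simps)
qed

lemma integral_square_wave_shift:
  assumes "\<rho> > 0" "T \<ge> 1 / \<rho>" "\<bar>\<eta>\<bar> \<le> 1"
  shows "integral {a..a+T} (\<lambda>u. \<bar>square_wave (\<rho> * u + \<eta>) - square_wave (\<rho> * u)\<bar>) \<le> 6 * \<bar>\<eta>\<bar> * T"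
proof -
  have T: "T \<ge> 0" "1 \<le> \<rho> * T" using assms by (auto simp: field_simps intro: order_trans[of 0 "1/\<rho>"])
  have tm: "tame (\<lambda>u. \<bar>square_wave (\<rho> * u + \<eta>) - square_wave (\<rho> * u)\<bar>)" for \<eta>
  proof (rule tame_I [where B = 2])
    fix u
    show "norm \<bar>square_wave (\<rho> * u + \<eta>) - square_wave (\<rho> * u)\<bar> \<le> 2"
      using square_wave_cases[of "\<rho> * u + \<eta>"] square_wave_cases[of "\<rho> * u"] by auto
  qed measurable
  have pos: "integral {a..a+T} (\<lambda>u. \<bar>square_wave (\<rho> * u + \<eta>) - square_wave (\<rho> * u)\<bar>) \<le> 6 * \<eta> * T"
    if \<eta>: "0 \<le> \<eta>" "\<eta> \<le> 1" for a \<eta>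
  proof -
    define h where "h = \<eta> / \<rho>"
    define H where "H u = real_of_int \<lfloor>\<rho> * u\<rfloor>" for u
    have H: "mono H" unfolding H_def using assms(1) by (intro monoI) (simp add: floor_mono)
    have h: "h \<ge> 0" "\<rho> * h = \<eta>" using \<eta> assms(1) by (auto simp: h_def)
    have int: "H integrable_on {x..y}" "(\<lambda>u. H (u + h)) integrable_on {x..y}" for x y
      using H by (auto intro!: integrable_on_mono_on simp: mono_on_def mono_def)
    have "integral {a..a+T} (\<lambda>u. \<bar>square_wave (\<rho> * u + \<eta>) - square_wave (\<rho> * u)\<bar>)
        \<le> integral {a..a+T} (\<lambda>u. 2 * (H (u + h) - H u))"
    proof (rule integral_le)
      show "(\<lambda>u. 2 * (H (u + h) - H u)) integrable_on {a..a+T}"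
        using int by (intro integrable_on_mult_right integrable_diff)
      fix u 
      have "\<rho> * (u + h) = \<rho> * u + \<eta>" using h by (simp add: algebra_simps)
      then show "\<bar>square_wave (\<rho> * u + \<eta>) - square_wave (\<rho> * u)\<bar> \<le> 2 * (H (u + h) - H u)"
        using square_wave_diff[of "\<rho> * u" "\<rho> * u + \<eta>"] \<eta> by (simp add: H_def)
    qed (rule tame_integrable[OF tm])
    also have "\<dots> = 2 * integral {a..a+T} (\<lambda>u. H (u + h) - H u)"
      by (rule integral_mult_right)
    also have "\<dots> \<le> 2 * (h * (H (a + T + h) - H a))"
      using integral_increment_mono[OF H h(1) T(1)] by simp
    \<comment> \<open>The window contains \<open>\<rho> * T \<ge> 1\<close> units, so the rounding
      and \<open>\<eta>\<close> cost at most two more multiples of it; hence the constant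
      \<open>6 = 2 * 3\<close>.\<close>
    also have "\<dots> \<le> 2 * (h * (3 * (\<rho> * T)))"
    proof (intro mult_left_mono)
      have "H (a + T + h) \<le> \<rho> * (a + T + h)" "H a \<ge> \<rho> * a - 1" unfolding H_def by linarith+
      then have "H (a + T + h) - H a \<le> \<rho> * T + \<eta> + 1" using h by (simp add: algebra_simps)
      with T \<eta> show "H (a + T + h) - H a \<le> 3 * (\<rho> * T)" by linarith
    qed (use h in auto)
    also have "\<dots> = 6 * \<eta> * T" unfolding h(2)[symmetric] by simp
    finally show ?thesis .
  qed
  show ?thesis
  proof (cases "\<eta> \<ge> 0")
    case True
    then show ?thesis using pos[of \<eta> a] assms by simp
  next
    case False
    define d where "d = - \<eta> / \<rho>"
    have d: "\<rho> * d = - \<eta>" using assms(1) by (simp add: d_def)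
    have "integral {a..a+T} (\<lambda>u. \<bar>square_wave (\<rho> * u + \<eta>) - square_wave (\<rho> * u)\<bar>)
       = integral {(a-d)+d..(a-d)+T+d} (\<lambda>u. \<bar>square_wave (\<rho> * u + \<eta>) - square_wave (\<rho> * u)\<bar>)"
      by (simp add: algebra_simps)
    also have "\<dots> = integral {a-d..a-d+T} (\<lambda>u. \<bar>square_wave (\<rho> * (u + d) + \<eta>) - square_wave (\<rho> * (u + d))\<bar>)"
      by (rule integral_shift [symmetric])
    also have "\<dots> = integral {a-d..a-d+T} (\<lambda>u. \<bar>square_wave (\<rho> * u + (- \<eta>)) - square_wave (\<rho> * u)\<bar>)"
      using d by (simp add: distrib_left abs_minus_commute)
    also have "\<dots> \<le> 6 * (- \<eta>) * T" using False assms by (intro pos) auto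
    finally show ?thesis using False by simp
  qed
qed

text \<open>The first \<open>q\<close> multiples of \<open>x\<close> are close, modulo \<open>1\<close>, to the multiples of \<open>1/q\<close> when \<open>q\<close> is the
  denominator of a good rational approximation of \<open>x\<close>.\<close>

lemma inhomogeneous_approximation:
  fixes x \<kappa> b :: real and N :: nat
  assumes "0 < x" "x < 1" "0 < \<kappa>" "N \<ge> 1"
    and bad: "\<And>q h :: int. q \<noteq> 0 \<or> h \<noteq> 0 \<Longrightarrow> \<kappa> / (\<bar>of_int q\<bar> + \<bar>of_int h\<bar>) \<le> \<bar>of_int q * x - of_int h\<bar>"
  shows "\<exists>(l::nat) (z::int). l < N \<and> \<bar>real l * x - b - of_int z\<bar> \<le> (1 + 3 / \<kappa>) / N"
proof -
  obtain h q where hq: "coprime h q" "0 < q" "q \<le> int N" "\<bar>of_int q * x - of_int h\<bar> < 1 / N"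
    using Dirichlet_approx_coprime[of N x] assms(4) by auto
  have q1: "(of_int q :: real) \<ge> 1" using hq(2) by linarith
  have N1: "1 / real N \<le> 1" using assms(4) by simp
  have "\<bar>of_int h :: real\<bar> \<le> of_int q * x + 1 / N"
  proof -
    have "of_int q * x > 0" using q1 assms by simp
    then show ?thesis using hq(4) by linarith
  qed
  also have "\<dots> \<le> of_int q * 1 + 1" using q1 assms N1 by (intro add_mono mult_left_mono) auto
  finally have h: "\<bar>of_int h :: real\<bar> \<le> of_int q + 1" by simp
  \<comment> \<open>Dirichlet bounds \<open>q\<close> only from above. Bad approximability makes it
    comparable with \<open>N\<close>, so the grid of multiples of \<open>1 / q\<close> is fine
    enough.\<close>
  have "\<kappa> / (3 * of_int q) \<le> \<kappa> / (\<bar>of_int q\<bar> + \<bar>of_int h\<bar>)"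
    using h q1 assms(3) by (intro divide_left_mono) auto
  also have "\<dots> \<le> \<bar>of_int q * x - of_int h\<bar>" using bad[of q h] hq by simp
  also have "\<dots> \<le> 1 / N" using hq by simp
  finally have qN: "1 / of_int q \<le> 3 / \<kappa> / N" using q1 assms by (simp add: field_simps)
  define J where "J = \<lfloor>b * of_int q\<rfloor>"
  obtain u v where uv: "u * h + v * q = 1"
    using bezout_int[of h q] hq(1) by (auto simp: coprime_iff_gcd_eq_1)
  \<comment> \<open>\<open>u\<close> inverts \<open>h\<close> modulo \<open>q\<close>, so
    \<open>l * h\<close> falls into the residue class of \<open>J\<close>, the grid point next to
    \<open>b\<close>.\<close>
  define l where "l = (u * J) mod q"
  have l: "0 \<le> l" "l < q" using hq(2) by (auto simp: l_def)
  have "l = u * J - q * ((u * J) div q)" unfolding l_def by (simp add: minus_mult_div_eq_mod)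
  then have "l * h = (u * J - q * ((u * J) div q)) * h" by simp
  also have "\<dots> = J * (u * h) - q * (((u * J) div q) * h)" by (simp only: algebra_simps)
  also have "u * h = 1 - v * q" using uv by simp
  finally have "l * h = J + q * (- J * v - ((u * J) div q) * h)" by (simp add: algebra_simps)
  then obtain z where z: "l * h = J + q * z" by blast
  have tri: "\<bar>a\<bar> \<le> d + e" if "a = b + c" "\<bar>b\<bar> \<le> d" "\<bar>c\<bar> \<le> e" for a b c d e :: real
    using that by linarith
  have "of_int l * x - b - of_int z = of_int l * (x - of_int h / of_int q) + (of_int J / of_int q - b)"
  proof -
    have "(of_int l * of_int h :: real) = of_int J + of_int q * of_int z"
      using z by (metis of_int_add of_int_mult)
    then have "of_int l * (of_int h / of_int q) = (of_int J / of_int q + of_int z :: real)"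
      using q1 by (simp add: field_simps)
    then show ?thesis by (simp add: algebra_simps)
  qed
  moreover have "\<bar>of_int l * (x - of_int h / of_int q)\<bar> \<le> 1 / N"
  proof -
    have "\<bar>of_int l * (x - of_int h / of_int q)\<bar> = of_int l / of_int q * \<bar>of_int q * x - of_int h\<bar>"
    proof -
      have "x - of_int h / of_int q = (of_int q * x - of_int h) / of_int q" using q1 by (simp add: field_simps)
      then show ?thesis using q1 l by (simp add: abs_mult abs_divide)
    qed
    also have "\<dots> \<le> 1 * (1 / N)" using l q1 hq by (intro mult_mono) auto
    finally show ?thesis by simp
  qed
  moreover have "\<bar>of_int J / of_int q - b\<bar> \<le> 1 / of_int q"
  proof -
    have "\<bar>of_int J - b * of_int q\<bar> \<le> 1" unfolding J_def by linarith
    moreover have "of_int J / of_int q - b = (of_int J - b * of_int q) / of_int q"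
      using q1 by (simp add: field_simps)
    ultimately show ?thesis using q1 by (simp add: abs_divide divide_right_mono)
  qed
  ultimately have "\<bar>of_int l * x - b - of_int z\<bar> \<le> 1 / N + 1 / of_int q" by (rule tri)
  with qN have "\<bar>of_int l * x - b - of_int z\<bar> \<le> 1 / N + 3 / \<kappa> / N" by linarith
  moreover have "nat l < N" "real (nat l) = of_int l" using l hq(3) by auto
  ultimately show ?thesis
    by (intro exI[of _ "nat l"] exI[of _ z]) (simp add: add_divide_distrib)
qed

text \<open>On each window of length \<open>\<tau>\<close> the function \<open>G\<close> can be
  frozen at its left end, where only the mean \<open>e\<close> of \<open>F\<close> is felt. Freezing
  costs the increment of \<open>H\<close> over the window, and these increments telescope, so it
  does not matter where \<open>G\<close> varies.\<close>

lemma integral_decouple: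
  fixes F H :: "real \<Rightarrow> real" and G :: "real \<Rightarrow> complex"
  assumes F: "tame F" "\<And>u. \<bar>F u\<bar> \<le> 1" and G: "tame G" "\<And>u. norm (G u) \<le> 1"
    and H: "\<And>u v. 0 \<le> v \<Longrightarrow> v \<le> u \<Longrightarrow> norm (G u - G v) \<le> H u - H v"
    and "\<tau> \<ge> 0" "\<bar>e\<bar> \<le> 1"
    and e: "\<And>a. a \<ge> 0 \<Longrightarrow> \<bar>integral {a..a+\<tau>} F - e * \<tau>\<bar> \<le> \<epsilon> * \<tau>"
  shows "norm (integral {0..real q * \<tau>} (\<lambda>u. of_real (F u) * G u) - of_real e * integral {0..real q * \<tau>} G)
     \<le> 2 * \<tau> * (H (real q * \<tau>) - H 0) + \<epsilon> * (real q * \<tau>)"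
proof (induction q)
  case 0
  then show ?case by simp
next
  case (Suc q)
  define a where "a = real q * \<tau>"
  have a: "a \<ge> 0" "real (Suc q) * \<tau> = a + \<tau>" using assms(6) by (auto simp: a_def algebra_simps)
  have FG: "tame (\<lambda>u. of_real (F u) * G u)" using F G by (intro tame_intros)
  have split: "integral {0..a+\<tau>} f = integral {0..a} f + integral {a..a+\<tau>} f" if "tame f" for f :: "real \<Rightarrow> complex"
    using that a assms(6) by (intro tame_integral_combine) auto
  define g where "g = (\<lambda>u. G u - G a)"
  have g: "tame g" unfolding g_def using G by (intro tame_intros)
  have gb: "norm (g u) \<le> H (a + \<tau>) - H a" if "u \<in> {a..a+\<tau>}" for u
  proof -
    have "norm (g u) \<le> H u - H a" unfolding g_def using that a by (intro H) auto
    moreover have "0 \<le> H (a + \<tau>) - H u"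
      using that a by (intro order_trans[OF norm_ge_zero H]) auto
    ultimately show ?thesis by linarith
  qed
  have FG_eq: "integral {a..a+\<tau>} (\<lambda>u. of_real (F u) * G u) 
      = integral {a..a+\<tau>} (\<lambda>u. of_real (F u) * g u) + of_real (integral {a..a+\<tau>} F) * G a"
  proof -
    have "integral {a..a+\<tau>} (\<lambda>u. of_real (F u) * G u) 
      = integral {a..a+\<tau>} (\<lambda>u. of_real (F u) * g u + of_real (F u) * G a)"
      by (intro integral_cong) (simp add: g_def algebra_simps)
    also have "\<dots> = integral {a..a+\<tau>} (\<lambda>u. of_real (F u) * g u) + integral {a..a+\<tau>} (\<lambda>u. of_real (F u) * G a)"
      using F g by (intro integral_add tame_integrable tame_intros)
    also have "integral {a..a+\<tau>} (\<lambda>u. of_real (F u) * G a) = integral {a..a+\<tau>} (\<lambda>u. complex_of_real (F u)) * G a"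
      by simp
    also have "integral {a..a+\<tau>} (\<lambda>u. complex_of_real (F u)) = of_real (integral {a..a+\<tau>} F)"
    proof -
      have "bounded_linear (of_real :: real \<Rightarrow> complex)" by (rule bounded_linear_of_real)
      from integral_linear[OF tame_integrable[OF F(1)] this, of a "a+\<tau>"] show ?thesis by (simp add: o_def)
    qed
    finally show ?thesis .
  qed
  have G_eq: "integral {a..a+\<tau>} G = integral {a..a+\<tau>} g + of_real \<tau> * G a"
  proof -
    have "integral {a..a+\<tau>} G = integral {a..a+\<tau>} (\<lambda>u. g u + G a)" by (simp add: g_def)
    also have "\<dots> = integral {a..a+\<tau>} g + integral {a..a+\<tau>} (\<lambda>u. G a)"
      using g by (intro integral_add tame_integrable tame_intros)
    finally show ?thesis using assms(6) by (simp add: scaleR_conv_of_real)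
  qed
  have b1: "norm (integral {a..a+\<tau>} (\<lambda>u. of_real (F u) * g u)) \<le> (H (a + \<tau>) - H a) * \<tau>"
  proof -
    have "norm (integral {a..a+\<tau>} (\<lambda>u. of_real (F u) * g u)) \<le> integral {a..a+\<tau>} (\<lambda>_. H (a + \<tau>) - H a)"
    proof (rule integral_norm_bound_integral)
      fix u assume "u \<in> {a..a+\<tau>}"
      with gb F(2) have "\<bar>F u\<bar> * norm (g u) \<le> 1 * (H (a + \<tau>) - H a)" by (intro mult_mono) auto
      then show "norm (of_real (F u) * g u) \<le> H (a + \<tau>) - H a" by (simp add: norm_mult)
    qed (use F g in \<open>auto intro!: tame_integrable tame_intros\<close>)
    also have "\<dots> = (H (a + \<tau>) - H a) * \<tau>" using assms(6) by simp
    finally show ?thesis .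
  qed
  have b2: "norm (integral {a..a+\<tau>} g) \<le> (H (a + \<tau>) - H a) * \<tau>"
  proof -
    have "norm (integral {a..a+\<tau>} g) \<le> integral {a..a+\<tau>} (\<lambda>_. H (a + \<tau>) - H a)"
      using gb g by (intro integral_norm_bound_integral tame_integrable tame_intros) auto
    also have "\<dots> = (H (a + \<tau>) - H a) * \<tau>" using assms(6) by simp
    finally show ?thesis .
  qed
  have H0: "(H (a + \<tau>) - H a) * \<tau> \<ge> 0" using b2 norm_ge_zero order_trans by blast
  have b3: "norm (of_real e * integral {a..a+\<tau>} g) \<le> (H (a + \<tau>) - H a) * \<tau>"
  proof -
    have "\<bar>e\<bar> * norm (integral {a..a+\<tau>} g) \<le> 1 * ((H (a + \<tau>) - H a) * \<tau>)"
      using b2 assms(7) H0 by (intro mult_mono) auto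
    then show ?thesis by (simp add: norm_mult)
  qed
  have b4: "norm (of_real (integral {a..a+\<tau>} F - e * \<tau>) * G a) \<le> \<epsilon> * \<tau>"
  proof -
    have "\<bar>integral {a..a+\<tau>} F - e * \<tau>\<bar> * norm (G a) \<le> (\<epsilon> * \<tau>) * 1"
      using e[OF a(1)] G(2)[of a] order_trans[OF abs_ge_zero e[OF a(1)]] by (intro mult_mono) auto
    then show ?thesis unfolding norm_mult norm_of_real by simp
  qed
  have "integral {0..a+\<tau>} (\<lambda>u. of_real (F u) * G u) - of_real e * integral {0..a+\<tau>} G
    = (integral {0..a} (\<lambda>u. of_real (F u) * G u) - of_real e * integral {0..a} G)
      + (integral {a..a+\<tau>} (\<lambda>u. of_real (F u) * g u) - of_real e * integral {a..a+\<tau>} g)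
      + of_real (integral {a..a+\<tau>} F - e * \<tau>) * G a"
    unfolding split[OF FG] split[OF G(1)] FG_eq G_eq by (simp add: algebra_simps)
  then have "norm (integral {0..a+\<tau>} (\<lambda>u. of_real (F u) * G u) - of_real e * integral {0..a+\<tau>} G)
    \<le> norm (integral {0..a} (\<lambda>u. of_real (F u) * G u) - of_real e * integral {0..a} G)
      + (norm (integral {a..a+\<tau>} (\<lambda>u. of_real (F u) * g u)) + norm (of_real e * integral {a..a+\<tau>} g))
      + norm (of_real (integral {a..a+\<tau>} F - e * \<tau>) * G a)"
    by (smt (verit, best) norm_triangle_ineq norm_triangle_ineq4)
  also have "\<dots> \<le> (2 * \<tau> * (H a - H 0) + \<epsilon> * a) + ((H (a + \<tau>) - H a) * \<tau> + (H (a + \<tau>) - H a) * \<tau>) + \<epsilon> * \<tau>"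
    using Suc b1 b3 b4 unfolding a_def[symmetric] by (intro add_mono) auto
  also have "\<dots> = 2 * \<tau> * (H (a + \<tau>) - H 0) + \<epsilon> * (a + \<tau>)" by (simp add: algebra_simps)
  finally show ?case unfolding a(2) .
qed

section \<open>Lacunary families of square waves\<close>

lemma tame_integral_add:
  "tame f \<Longrightarrow> tame g \<Longrightarrow> integral {a..b} (\<lambda>x. f x + g x) = integral {a..b} f + integral {a..b} g"
  by (intro integral_add tame_integrable)

lemma tame_integral_diff:
  "tame f \<Longrightarrow> tame g \<Longrightarrow> integral {a..b} (\<lambda>x. f x - g x) = integral {a..b} f - integral {a..b} g"
  by (intro Henstock_Kurzweil_Integration.integral_diff tame_integrable)

lemma tame_integral_sum:
  "(\<And>i. i \<in> I \<Longrightarrow> tame (f i)) \<Longrightarrow> integral {a..b} (\<lambda>x. \<Sum>i\<in>I. f i x) = (\<Sum>i\<in>I. integral {a..b} (f i))"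
  by (induction I rule: infinite_finite_induct) (auto simp: tame_integral_add tame_sum)

text \<open>A long interval splits into windows with nearly equal integrals, so its mean is close to
  that of any one of them. The incomplete last window accounts for
  \<open>2 * \<tau> / S\<close>.\<close>

lemma long_average_near_window:
  fixes F :: "real \<Rightarrow> real"
  assumes F: "tame F" "\<And>u. \<bar>F u\<bar> \<le> 1" and "0 < \<tau>" "\<tau> \<le> S" "0 \<le> a"
    and near: "\<And>a b. 0 \<le> a \<Longrightarrow> 0 \<le> b \<Longrightarrow> \<bar>integral {a..a+\<tau>} F - integral {b..b+\<tau>} F\<bar> \<le> \<epsilon> * \<tau>"
  shows "\<bar>integral {a..a+\<tau>} F - integral {0..S} F / S * \<tau>\<bar> \<le> (\<epsilon> + 2 * \<tau> / S) * \<tau>"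
proof -
  define I where "I = integral {a..a+\<tau>} F"
  define n where "n = nat \<lfloor>S / \<tau>\<rfloor>"
  define r where "r = S - real n * \<tau>"
  have S: "S > 0" using assms by simp
  have n: "real n \<le> S / \<tau>" "S / \<tau> < real n + 1" unfolding n_def using S assms(3) by auto
  have r: "0 \<le> r" "r \<le> \<tau>" unfolding r_def using n assms(3) by (auto simp: field_simps)
  have blocks: "\<bar>integral {0..real n * \<tau>} F - real n * I\<bar> \<le> real n * (\<epsilon> * \<tau>)" for n
  proof (induction n)
    case (Suc n)
    have *: "real (Suc n) * \<tau> = real n * \<tau> + \<tau>" by (simp add: algebra_simps)
    have "integral {0..real n * \<tau> + \<tau>} F = integral {0..real n * \<tau>} F + integral {real n * \<tau>..real n * \<tau> + \<tau>} F"
      using assms(3) by (intro tame_integral_combine F) auto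
    moreover have "\<bar>integral {real n * \<tau>..real n * \<tau> + \<tau>} F - I\<bar> \<le> \<epsilon> * \<tau>"
      unfolding I_def using assms(3,5) by (intro near) auto
    ultimately show ?case using Suc unfolding * by (simp add: algebra_simps)
  qed auto
  have "integral {0..S} F = integral {0..real n * \<tau>} F + integral {real n * \<tau>..real n * \<tau> + r} F"
    using r assms(3) tame_integral_combine[OF F(1), of 0 "real n * \<tau>" S] by (simp add: r_def)
  moreover have "\<bar>integral {real n * \<tau>..real n * \<tau> + r} F\<bar> \<le> r"
    using norm_integral_le[OF F(1), of 1 r "real n * \<tau>"] F(2) r by simp
  ultimately have d: "\<bar>integral {0..S} F - real n * I\<bar> \<le> real n * (\<epsilon> * \<tau>) + r"
    using blocks[of n] by linarith
  have I1: "\<bar>I\<bar> \<le> \<tau>" unfolding I_def using norm_integral_le[OF F(1), of 1 \<tau> a] F(2) assms(3) by simp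
  have \<epsilon>: "\<epsilon> * \<tau> \<ge> 0" using near[OF assms(5,5)] by simp
  have "I * S - integral {0..S} F * \<tau> = I * r - \<tau> * (integral {0..S} F - real n * I)"
    unfolding r_def by (simp add: algebra_simps)
  then have "\<bar>I * S - integral {0..S} F * \<tau>\<bar> \<le> \<bar>I * r\<bar> + \<bar>\<tau> * (integral {0..S} F - real n * I)\<bar>"
    by simp
  also have "\<dots> \<le> \<tau> * \<tau> + \<tau> * (real n * (\<epsilon> * \<tau>) + r)"
    unfolding abs_mult using I1 r assms(3) d by (intro add_mono mult_mono) auto
  also have "\<dots> \<le> \<tau> * \<tau> + \<tau> * (S / \<tau> * (\<epsilon> * \<tau>) + \<tau>)"
    using n r assms(3) \<epsilon> by (intro add_left_mono mult_left_mono add_mono mult_right_mono) auto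
  also have "\<dots> = (\<epsilon> + 2 * \<tau> / S) * \<tau> * S" using S assms(3) by (simp add: field_simps)
  finally have "\<bar>I * S - integral {0..S} F * \<tau>\<bar> \<le> (\<epsilon> + 2 * \<tau> / S) * \<tau> * S" .
  moreover have "I * S - integral {0..S} F * \<tau> = (I - integral {0..S} F / S * \<tau>) * S"
    using S by (simp add: algebra_simps)
  ultimately show ?thesis using S by (simp add: abs_mult I_def)
qed

text \<open>A larger index means a slower wave. \<open>w_bad\<close> is quantitative independence of
  consecutive frequencies, and \<open>w_rec\<close> makes all later ones integer combinations of two
  consecutive ones with controlled coefficients. The bound \<open>1 / \<kappa> \<le> D\<close> lets
  \<open>D ^ n\<close> also control how far \<open>n\<close> steps can lower the frequency.\<close>

locale lacunary_waves =
  fixes w :: "nat \<Rightarrow> real" and \<kappa> \<theta> D :: real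
  assumes w_pos: "\<And>k. w k > 0"
    and w_upper: "\<And>k. w (Suc k) \<le> \<theta> * w k" and \<theta>: "0 < \<theta>" "\<theta> < 1"
    and \<kappa>: "0 < \<kappa>" "\<kappa> \<le> 1"
    and w_bad: "\<And>k (a::int) (b::int). a \<noteq> 0 \<or> b \<noteq> 0 \<Longrightarrow>
          \<kappa> * w k / (\<bar>of_int a\<bar> + \<bar>of_int b\<bar>) \<le> \<bar>of_int a * w k + of_int b * w (Suc k)\<bar>"
    and w_rec: "\<And>k. \<exists>(a::int) (b::int). w (Suc (Suc k)) = of_int a * w k + of_int b * w (Suc k)
          \<and> \<bar>of_int a\<bar> + \<bar>of_int b\<bar> \<le> D"
    and D: "1 / \<kappa> \<le> D"
begin

lemma D_ge_1: "D \<ge> 1"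
proof -
  have "1 \<le> 1 / \<kappa>" using \<kappa> by simp
  with D show ?thesis by linarith
qed

lemma w_lower: "\<kappa> * w k \<le> w (Suc k)"
  using w_bad[of 0 1 k] w_pos[of "Suc k"] by simp

lemma w_decreasing: "w (Suc k) < w k"
proof -
  have "\<theta> * w k < 1 * w k" using \<theta> w_pos[of k] by (intro mult_strict_right_mono) auto
  with w_upper[of k] show ?thesis by simp
qed

lemma w_antimono: "k \<le> l \<Longrightarrow> w l \<le> w k"
  by (induction rule: dec_induct) (use w_decreasing in \<open>auto intro: less_imp_le order.trans\<close>)

lemma w_upper_power: "w (k + n) \<le> \<theta> ^ n * w k"
proof (induction n)
  case (Suc n)
  have "w (k + Suc n) \<le> \<theta> * w (k + n)" using w_upper[of "k + n"] by simp
  also have "\<dots> \<le> \<theta> * (\<theta> ^ n * w k)" using Suc \<theta> by (intro mult_left_mono) auto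
  finally show ?case by (simp add: mult_ac)
qed simp

lemma w_lower_power: "\<kappa> ^ n * w k \<le> w (k + n)"
proof (induction n)
  case (Suc n)
  have "\<kappa> ^ Suc n * w k = \<kappa> * (\<kappa> ^ n * w k)" by simp
  also have "\<dots> \<le> \<kappa> * w (k + n)" using Suc \<kappa> by (intro mult_left_mono) auto
  also have "\<dots> \<le> w (k + Suc n)" using w_lower[of "k + n"] by simp
  finally show ?case .
qed simp

lemma sum_w_le: "(\<Sum>j=k..<J. w j) \<le> w k / (1 - \<theta>)"
proof -
  have *: "(1 - \<theta>) * (\<Sum>j=k..<k+n. w j) \<le> w k - w (k + n)" for n
  proof (induction n)
    case (Suc n)
    then show ?case using w_upper[of "k + n"] by (simp add: algebra_simps)
  qed simp
  have "(1 - \<theta>) * (\<Sum>j=k..<J. w j) \<le> w k"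
  proof (cases "k \<le> J")
    case True
    then show ?thesis using *[of "J - k"] w_pos[of J] by simp
  next
    case False
    then show ?thesis using w_pos[of k] by simp
  qed
  then show ?thesis using \<theta> by (simp add: field_simps)
qed

text \<open>A shift adjusted to the phases of indices \<open>k\<close> and \<open>Suc k\<close>
  modulo 2 is therefore adjusted to those of index \<open>k + n\<close> too, with an error magnified
  by at most \<open>D ^ n\<close>.\<close>

lemma w_combination:
  "\<exists>(a::int) (b::int). w (k + n) = of_int a * w k + of_int b * w (Suc k) \<and> \<bar>of_int a\<bar> + \<bar>of_int b\<bar> \<le> D ^ n"
proof -
  have "(\<exists>(a::int) (b::int). w (k + n) = of_int a * w k + of_int b * w (Suc k) \<and> \<bar>of_int a\<bar> + \<bar>of_int b\<bar> \<le> D ^ n)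
     \<and> (\<exists>(a::int) (b::int). w (k + Suc n) = of_int a * w k + of_int b * w (Suc k) \<and> \<bar>of_int a\<bar> + \<bar>of_int b\<bar> \<le> D ^ Suc n)"
  proof (induction n)
    case 0
    have "w (k + 0) = of_int 1 * w k + of_int 0 * w (Suc k) \<and> \<bar>of_int 1\<bar> + \<bar>of_int 0\<bar> \<le> D ^ 0" by simp
    moreover have "w (k + Suc 0) = of_int 0 * w k + of_int 1 * w (Suc k) \<and> \<bar>of_int 0\<bar> + \<bar>of_int 1\<bar> \<le> D ^ Suc 0" 
      using D_ge_1 by simp
    ultimately show ?case by blast
  next
    case (Suc n)
    then obtain a b a' b' :: int where
      ab: "w (k + n) = of_int a * w k + of_int b * w (Suc k)" "\<bar>of_int a\<bar> + \<bar>of_int b\<bar> \<le> D ^ n" and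
      ab': "w (k + Suc n) = of_int a' * w k + of_int b' * w (Suc k)" "\<bar>of_int a'\<bar> + \<bar>of_int b'\<bar> \<le> D ^ Suc n"
      by blast
    obtain p q :: int where pq: "w (Suc (Suc (k + n))) = of_int p * w (k + n) + of_int q * w (Suc (k + n))"
       "\<bar>of_int p\<bar> + \<bar>of_int q\<bar> \<le> D"
      using w_rec[of "k + n"] by blast
    have "w (k + Suc (Suc n)) = of_int (p * a + q * a') * w k + of_int (p * b + q * b') * w (Suc k)"
      using pq(1) ab(1) ab'(1) by (simp add: algebra_simps)
    moreover have "\<bar>of_int (p * a + q * a')\<bar> + \<bar>of_int (p * b + q * b')\<bar> \<le> D ^ Suc (Suc n)"
    proof -
      have "\<bar>of_int (p * a + q * a')\<bar> + \<bar>of_int (p * b + q * b')\<bar> 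
        \<le> \<bar>of_int p\<bar> * (\<bar>of_int a\<bar> + \<bar>of_int b\<bar>) + \<bar>of_int q\<bar> * (\<bar>of_int a'\<bar> + \<bar>of_int b'\<bar> :: real)"
        using abs_triangle_ineq[of "of_int (p * a) :: real" "of_int (q * a')"]
          abs_triangle_ineq[of "of_int (p * b) :: real" "of_int (q * b')"]
        by (simp add: abs_mult algebra_simps)
      also have "\<dots> \<le> \<bar>of_int p\<bar> * D ^ Suc n + \<bar>of_int q\<bar> * D ^ Suc n"
      proof (intro add_mono mult_left_mono)
        have "D ^ n \<le> D ^ Suc n" using D_ge_1 by (intro power_increasing) auto
        with ab(2) show "\<bar>of_int a\<bar> + \<bar>of_int b\<bar> \<le> D ^ Suc n" by linarith
      qed (use ab' in auto)
      also have "\<dots> = (\<bar>of_int p\<bar> + \<bar>of_int q\<bar>) * D ^ Suc n" by (simp add: algebra_simps)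
      also have "\<dots> \<le> D * D ^ Suc n" using pq(2) D_ge_1 by (intro mult_right_mono) auto
      finally show ?thesis by simp
    qed
    ultimately show ?case using ab' by blast
  qed
  then show ?thesis by blast
qed

section \<open>Waves, phase alignment and averages over short windows\<close>

definition X :: "nat \<Rightarrow> real \<Rightarrow> real" where
  "X k u = square_wave (w k * u) * square_wave (w (Suc k) * u)"

definition jump :: "nat \<Rightarrow> real \<Rightarrow> real \<Rightarrow> real" where
  "jump k u v = \<bar>square_wave (w k * u) - square_wave (w k * v)\<bar>"

lemma X_cases: "X k u = 1 \<or> X k u = -1"
  using square_wave_cases[of "w k * u"] square_wave_cases[of "w (Suc k) * u"] by (auto simp: X_def)

lemma abs_X [simp]: "\<bar>X k u\<bar> = 1"
  using X_cases[of k u] by auto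

lemma X_squared [simp]: "X k u * X k u = 1"
  using X_cases[of k u] by auto

lemma tame_X: "tame (X k)"
  unfolding X_def [abs_def] by (intro tame_intros)

lemma X_diff: "\<bar>X k u - X k v\<bar> \<le> jump k u v + jump (Suc k) u v"
  using square_wave_cases[of "w k * u"] square_wave_cases[of "w (Suc k) * u"]
    square_wave_cases[of "w k * v"] square_wave_cases[of "w (Suc k) * v"]
  by (auto simp: X_def jump_def)

lemma X_mult_diff: "\<bar>X k u * X j u - X k v * X j v\<bar> \<le> \<bar>X k u - X k v\<bar> + \<bar>X j u - X j v\<bar>"
  using X_cases[of k u] X_cases[of k v] X_cases[of j u] X_cases[of j v] by auto

lemma tame_jump: "tame (\<lambda>u. jump k (u + d) u)"
proof (rule tame_I [where B = 2])
  fix u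
  show "norm (jump k (u + d) u) \<le> 2"
    using square_wave_cases[of "w k * (u + d)"] square_wave_cases[of "w k * u"] by (auto simp: jump_def)
qed (unfold jump_def, measurable)

text \<open>Only the phase modulo 2 matters. If the residue \<open>\<eta>\<close> exceeds 1 in
  modulus, the trivial bound 2 for a jump suffices.\<close>

lemma integral_jump:
  assumes "w k * d = 2 * of_int z + \<eta>" "T \<ge> 1 / w k"
  shows "integral {a..a+T} (\<lambda>u. jump k (u + d) u) \<le> 6 * \<bar>\<eta>\<bar> * T"
proof (cases "\<bar>\<eta>\<bar> \<le> 1")
  case True
  have "jump k (u + d) u = \<bar>square_wave (w k * u + \<eta>) - square_wave (w k * u)\<bar>" for u
  proof -
    have "w k * (u + d) = (w k * u + \<eta>) + 2 * of_int z" using assms(1) by (simp add: algebra_simps)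
    then show ?thesis unfolding jump_def by (simp only: square_wave_add_even)
  qed
  then show ?thesis using integral_square_wave_shift[OF w_pos assms(2) True] by simp
next
  case False
  have T: "T \<ge> 0" using assms(2) w_pos[of k] by (auto intro: order_trans[of 0 "1 / w k"])
  have "norm (jump k (u + d) u) \<le> 2" for u
    using square_wave_cases[of "w k * (u + d)"] square_wave_cases[of "w k * u"] by (auto simp: jump_def)
  then have "norm (integral {a..a+T} (\<lambda>u. jump k (u + d) u)) \<le> 2 * T"
    by (intro norm_integral_le tame_jump T) auto
  also have "\<dots> \<le> 6 * \<bar>\<eta>\<bar> * T" using False T by (intro mult_right_mono) auto
  finally show ?thesis by simp
qed

text \<open>Twice the constant of \<open>inhomogeneous_approximation\<close>, since the waves have
  period 2 instead of 1.\<close>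

definition C1 :: real where "C1 = 2 + 6 / \<kappa>"

lemma C1_pos: "C1 > 0"
  using \<kappa> by (simp add: C1_def add_pos_pos)

text \<open>The shift \<open>\<tau>0\<close> settles the phase of index \<open>k\<close>. Adding
  \<open>2 * l / w k\<close> preserves it and rotates the other phase by \<open>2 * l * x\<close>,
  where \<open>x = w (Suc k) / w k\<close> is badly approximable, so some \<open>l < N\<close>
  brings the second phase within \<open>C1 / N\<close>.\<close>

lemma phase_alignment:
  assumes "N \<ge> 1"
  shows "\<exists>\<tau> (y::int) (z::int) \<eta>. 0 \<le> \<tau> \<and> \<tau> \<le> 2 * (real N + 1) / w k \<and> w k * \<tau> = \<alpha> + 2 * of_int y \<and>
      w (Suc k) * \<tau> = \<beta> + 2 * of_int z + \<eta> \<and> \<bar>\<eta>\<bar> \<le> C1 / N"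
proof -
  define x where "x = w (Suc k) / w k"
  define \<tau>0 where "\<tau>0 = 2 * frac (\<alpha> / 2) / w k"
  define b where "b = (\<beta> - w (Suc k) * \<tau>0) / 2"
  have x: "0 < x" "x < 1" using w_pos w_decreasing[of k] by (auto simp: x_def)
  have bad: "\<kappa> / (\<bar>of_int q\<bar> + \<bar>of_int h\<bar>) \<le> \<bar>of_int q * x - of_int h\<bar>" if "q \<noteq> 0 \<or> h \<noteq> 0" for q h :: int
  proof -
    have "\<kappa> * w k / (\<bar>of_int q\<bar> + \<bar>of_int h\<bar>) \<le> \<bar>of_int (-h) * w k + of_int q * w (Suc k)\<bar>"
      using w_bad[of "-h" q k] that by (auto simp: add.commute)
    also have "of_int (-h) * w k + of_int q * w (Suc k) = w k * (of_int q * x - of_int h)"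
      using w_pos[of k] by (simp add: x_def field_simps)
    finally have "w k * (\<kappa> / (\<bar>of_int q\<bar> + \<bar>of_int h\<bar>)) \<le> w k * \<bar>of_int q * x - of_int h\<bar>"
      using w_pos[of k] by (simp add: abs_mult mult_ac)
    then show ?thesis using mult_le_cancel_left_pos[OF w_pos[of k]] by blast
  qed
  obtain l z where lz: "l < N" "\<bar>real l * x - b - of_int z\<bar> \<le> (1 + 3 / \<kappa>) / N"
    using inhomogeneous_approximation[OF x \<kappa>(1) assms bad] by blast
  define \<tau> where "\<tau> = \<tau>0 + 2 * real l / w k"
  have \<tau>0: "0 \<le> \<tau>0" "w k * \<tau>0 = 2 * frac (\<alpha> / 2)" using w_pos[of k] by (auto simp: \<tau>0_def)
  show ?thesis
  proof (rule exI[of _ \<tau>], rule exI[of _ "int l - \<lfloor>\<alpha> / 2\<rfloor>"], rule exI[of _ z],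
      rule exI[of _ "2 * (real l * x - b - of_int z)"], intro conjI)
    show "0 \<le> \<tau>" using \<tau>0 w_pos[of k] by (simp add: \<tau>_def)
    have "\<tau>0 \<le> 2 / w k" unfolding \<tau>0_def using w_pos[of k] frac_lt_1[of "\<alpha>/2"] by (intro divide_right_mono) auto
    moreover have "2 * real l / w k \<le> 2 * real N / w k" using lz w_pos[of k] by (intro divide_right_mono) auto
    ultimately have "\<tau> \<le> 2 / w k + 2 * real N / w k" unfolding \<tau>_def by (rule add_mono)
    then show "\<tau> \<le> 2 * (real N + 1) / w k" by (simp add: add_divide_distrib add.commute)
    have "w k * \<tau> = 2 * frac (\<alpha> / 2) + 2 * real l"
      unfolding \<tau>_def using \<tau>0 w_pos[of k] by (simp add: distrib_left)
    then show "w k * \<tau> = \<alpha> + 2 * of_int (int l - \<lfloor>\<alpha> / 2\<rfloor>)"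
      by (simp add: frac_def)
    have "w (Suc k) * \<tau> = w (Suc k) * \<tau>0 + 2 * real l * x"
      using w_pos[of k] by (simp add: \<tau>_def x_def field_simps)
    moreover have "2 * b = \<beta> - w (Suc k) * \<tau>0" by (simp add: b_def)
    ultimately show "w (Suc k) * \<tau> = \<beta> + 2 * of_int z + 2 * (real l * x - b - of_int z)"
      unfolding right_diff_distrib by linarith
    have "\<bar>2 * (real l * x - b - of_int z)\<bar> \<le> 2 * ((1 + 3 / \<kappa>) / N)"
      unfolding abs_mult abs_numeral using lz(2) by (rule mult_left_mono) simp
    also have "\<dots> = C1 / N" by (simp add: C1_def)
    finally show "\<bar>2 * (real l * x - b - of_int z)\<bar> \<le> C1 / N" .
  qed
qed

text \<open>A shift that flips the sign of the first factor and nearly preserves the second one shows that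
  \<open>X k\<close> has mean zero.\<close>

lemma integral_X_small:
  assumes "N \<ge> 1" "T \<ge> 1 / w (Suc k)"
  shows "\<bar>integral {a..a+T} (X k)\<bar> \<le> 2 * (real N + 1) / w k + 3 * C1 / N * T"
proof -
  obtain \<tau> y z \<eta> where \<tau>: "0 \<le> \<tau>" "\<tau> \<le> 2 * (real N + 1) / w k" "w k * \<tau> = 1 + 2 * of_int y"
      "w (Suc k) * \<tau> = 2 * of_int z + \<eta>" "\<bar>\<eta>\<bar> \<le> C1 / N"
    using phase_alignment[OF assms(1), of k 1 0] by auto
  have T: "T \<ge> 0" using assms(2) w_pos[of "Suc k"] by (auto intro: order_trans[of 0 "1 / w (Suc k)"])
  have flip: "square_wave (w k * (u + \<tau>)) = - square_wave (w k * u)" for u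
  proof -
    have "w k * (u + \<tau>) = (w k * u + 1) + 2 * of_int y" using \<tau>(3) by (simp add: algebra_simps)
    then have "square_wave (w k * (u + \<tau>)) = square_wave (w k * u + 1)" by (simp only: square_wave_add_even)
    also have "\<dots> = - square_wave (w k * u)" by (simp add: square_wave_def)
    finally show ?thesis .
  qed
  have sum_le: "\<bar>X k (u + \<tau>) + X k u\<bar> \<le> jump (Suc k) (u + \<tau>) u" for u
    using square_wave_cases[of "w k * u"] square_wave_cases[of "w (Suc k) * u"]
      square_wave_cases[of "w (Suc k) * (u + \<tau>)"] by (auto simp: X_def jump_def flip)
  have "integral {a+\<tau>..a+\<tau>+T} (X k) = integral {a..a+T} (\<lambda>u. X k (u + \<tau>))"
    unfolding integral_shift by (simp add: add_ac)
  then have "\<bar>integral {a+\<tau>..a+\<tau>+T} (X k) + integral {a..a+T} (X k)\<bar>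
       = norm (integral {a..a+T} (\<lambda>u. X k (u + \<tau>) + X k u))"
    using tame_integral_add[OF tame_shift[OF tame_X] tame_X] by simp
  also have "\<dots> \<le> integral {a..a+T} (\<lambda>u. jump (Suc k) (u + \<tau>) u)"
    using sum_le by (intro integral_norm_bound_integral tame_integrable tame_jump tame_intros tame_X) auto
  also have "\<dots> \<le> 6 * \<bar>\<eta>\<bar> * T" by (rule integral_jump[OF \<tau>(4) assms(2)])
  also have "\<dots> \<le> 6 * (C1 / N) * T" using \<tau>(5) T by (intro mult_right_mono mult_left_mono) auto
  finally have 1: "\<bar>integral {a+\<tau>..a+\<tau>+T} (X k) + integral {a..a+T} (X k)\<bar> \<le> 6 * (C1 / N) * T" .
  have 2: "\<bar>integral {a..a+T} (X k) - integral {a+\<tau>..a+\<tau>+T} (X k)\<bar> \<le> 2 * \<tau>"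
    by (rule integral_window_shift) (use tame_X \<tau>(1) T in auto)
  from 1 2 have "2 * \<bar>integral {a..a+T} (X k)\<bar> \<le> 2 * \<tau> + 6 * (C1 / N) * T" by linarith
  then show ?thesis using \<tau>(2) by simp
qed

text \<open>A shift that imitates the displacement \<open>b - a\<close> in the phases of
  \<open>k\<close> and \<open>Suc k\<close> imitates it for all indices up to \<open>Suc j\<close>,
  by \<open>w_combination\<close>. So short averages of the product hardly depend on the position of
  the window, whatever their value is.\<close>

lemma integral_XX_near:
  assumes "N \<ge> 1" "k < j" "Suc j = k + n" "T \<ge> 1 / w (Suc j)"
  shows "\<bar>integral {a..a+T} (\<lambda>u. X k u * X j u) - integral {b..b+T} (\<lambda>u. X k u * X j u)\<bar>
      \<le> 4 * (real N + 1) / w k + 24 * D ^ n * C1 / N * T"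
proof -
  define F where "F = (\<lambda>u. X k u * X j u)"
  have F: "tame F" "\<bar>F u\<bar> \<le> 1" for u
    unfolding F_def by (auto intro!: tame_intros tame_X simp: abs_mult)
  obtain \<tau> y z \<eta> where \<tau>: "0 \<le> \<tau>" "\<tau> \<le> 2 * (real N + 1) / w k" "w k * \<tau> = w k * (b - a) + 2 * of_int y"
      "w (Suc k) * \<tau> = w (Suc k) * (b - a) + 2 * of_int z + \<eta>" "\<bar>\<eta>\<bar> \<le> C1 / N"
    using phase_alignment[OF assms(1), of k "w k * (b - a)" "w (Suc k) * (b - a)"] by auto
  have T: "T \<ge> 0" using assms(4) w_pos[of "Suc j"] by (auto intro: order_trans[of 0 "1 / w (Suc j)"])
  define d where "d = \<tau> - (b - a)"
  have d: "w k * d = 2 * of_int y" "w (Suc k) * d = 2 * of_int z + \<eta>"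
    using \<tau>(3,4) by (simp_all add: d_def right_diff_distrib)
  have jumps: "integral {b..b+T} (\<lambda>u. jump i (u + d) u) \<le> 6 * D ^ n * (C1 / N) * T"
    if i: "k \<le> i" "i \<le> Suc j" for i
  proof -
    obtain p q :: int where pq: "w (k + (i - k)) = of_int p * w k + of_int q * w (Suc k)"
       "\<bar>of_int p\<bar> + \<bar>of_int q\<bar> \<le> D ^ (i - k)" using w_combination by blast
    have "w i * d = of_int p * (w k * d) + of_int q * (w (Suc k) * d)"
      using pq(1) i by (simp add: algebra_simps)
    also have "\<dots> = 2 * of_int (p * y + q * z) + of_int q * \<eta>"
      unfolding d by (simp add: algebra_simps)
    finally have "integral {b..b+T} (\<lambda>u. jump i (u + d) u) \<le> 6 * \<bar>of_int q * \<eta>\<bar> * T"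
    proof (rule integral_jump)
      have "1 / w i \<le> 1 / w (Suc j)" using w_antimono[OF i(2)] w_pos by (intro divide_left_mono) auto
      with assms(4) show "1 / w i \<le> T" by linarith
    qed
    also have "\<dots> \<le> 6 * (D ^ n * (C1 / N)) * T"
    proof (intro mult_right_mono mult_left_mono)
      have "D ^ (i - k) \<le> D ^ n" using D_ge_1 i assms by (intro power_increasing) auto
      with pq(2) have "\<bar>of_int q\<bar> \<le> D ^ n" by linarith
      then show "\<bar>of_int q * \<eta>\<bar> \<le> D ^ n * (C1 / N)"
        unfolding abs_mult using \<tau>(5) D_ge_1 by (intro mult_mono) auto
    qed (use T in auto)
    finally show ?thesis by (simp add: mult_ac)
  qed
  define E where "E = 6 * D ^ n * (C1 / N) * T"
  have sum_le: "\<bar>F (u + d) - F u\<bar> \<le> (jump k (u + d) u + jump (Suc k) (u + d) u) + (jump j (u + d) u + jump (Suc j) (u + d) u)" for u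
    unfolding F_def using X_mult_diff[of k "u+d" j u] X_diff[of k "u+d" u] X_diff[of j "u+d" u] by linarith
  have "integral {a+\<tau>..a+\<tau>+T} F = integral {b..b+T} (\<lambda>u. F (u + d))"
    unfolding integral_shift by (simp add: d_def algebra_simps)
  then have "\<bar>integral {a+\<tau>..a+\<tau>+T} F - integral {b..b+T} F\<bar>
       = norm (integral {b..b+T} (\<lambda>u. F (u + d) - F u))"
    using tame_integral_diff[OF tame_shift[OF F(1)] F(1)] by simp
  also have "\<dots> \<le> integral {b..b+T} (\<lambda>u. (jump k (u + d) u + jump (Suc k) (u + d) u) + (jump j (u + d) u + jump (Suc j) (u + d) u))"
    using sum_le by (intro integral_norm_bound_integral tame_integrable tame_jump tame_intros F) auto
  also have "\<dots> = (integral {b..b+T} (\<lambda>u. jump k (u + d) u) + integral {b..b+T} (\<lambda>u. jump (Suc k) (u + d) u))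
      + (integral {b..b+T} (\<lambda>u. jump j (u + d) u) + integral {b..b+T} (\<lambda>u. jump (Suc j) (u + d) u))"
    by (simp add: integral_add tame_integrable tame_jump tame_add)
  also have "\<dots> \<le> (E + E) + (E + E)"
    unfolding E_def using assms by (intro add_mono jumps) auto
  finally have 1: "\<bar>integral {a+\<tau>..a+\<tau>+T} F - integral {b..b+T} F\<bar> \<le> 4 * E" by linarith
  have 2: "\<bar>integral {a..a+T} F - integral {a+\<tau>..a+\<tau>+T} F\<bar> \<le> 2 * \<tau>"
    by (rule integral_window_shift) (use F \<tau>(1) T in auto)
  have 3: "4 * E = 24 * D ^ n * C1 / N * T" by (simp add: E_def)
  have 4: "4 * (real N + 1) / w k = 2 * (2 * (real N + 1) / w k)" by simp
  show ?thesis using 1 2 \<tau>(2) unfolding F_def 3[symmetric] 4 by linarith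
qed

end

section \<open>Decoupling a fast wave from slow functions\<close>

lemma exists_power_le:
  fixes \<theta> \<epsilon> :: real
  assumes "0 < \<theta>" "\<theta> < 1" "0 < \<epsilon>"
  shows "\<exists>n\<ge>1. \<theta> ^ n \<le> \<epsilon>"
proof -
  obtain n where "\<theta> ^ n < \<epsilon>" using real_arch_pow_inv[OF assms(3,2)] by blast
  moreover have "\<theta> ^ Suc n \<le> \<theta> ^ n" using assms by (intro power_decreasing) auto
  ultimately show ?thesis by (intro exI[of _ "Suc n"]) auto
qed

context lacunary_waves
begin

text \<open>Over \<open>g0 * h\<close> indices the frequency falls by at least
  \<open>32 ^ h = 16 ^ h * 2 ^ h\<close>. A window of about \<open>16 ^ h\<close> units of the fast
  phase is then still short, by a factor of order \<open>2 ^ h\<close>, for the slow one.\<close>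

definition g0 :: nat where "g0 = (SOME n. n \<ge> 1 \<and> \<theta> ^ n \<le> 1 / 32)"

lemma g0: "g0 \<ge> 1" "\<theta> ^ g0 \<le> 1 / 32"
proof -
  have "\<exists>n\<ge>1. \<theta> ^ n \<le> 1 / 32" using \<theta> by (intro exists_power_le) auto
  then show "g0 \<ge> 1" "\<theta> ^ g0 \<le> 1 / 32" unfolding g0_def by (metis (mono_tags, lifting) someI_ex)+
qed

lemma \<theta>_power_g0: "\<theta> ^ (g0 * h) \<le> 1 / 32 ^ h"
proof -
  have "\<theta> ^ (g0 * h) = (\<theta> ^ g0) ^ h" by (simp add: power_mult)
  also have "\<dots> \<le> (1 / 32) ^ h" using g0 \<theta> by (intro power_mono) auto
  finally show ?thesis by (simp add: power_one_over)
qed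

text \<open>The variation of \<open>G\<close> is charged to integer crossings of phases of index at
  least \<open>k\<close>. The constant 8 covers both \<open>coarse_E\<close> and
  \<open>coarse_X_E\<close>, and \<open>J\<close> keeps the sum finite.\<close>

definition coarse :: "nat \<Rightarrow> (real \<Rightarrow> complex) \<Rightarrow> bool" where
  "coarse k G \<longleftrightarrow> tame G \<and> (\<forall>u. norm (G u) \<le> 1) \<and>
     (\<exists>J. \<forall>u v. 0 \<le> v \<longrightarrow> v \<le> u \<longrightarrow>
        norm (G u - G v) \<le> 8 * (\<Sum>j=k..<J. of_int \<lfloor>w j * u\<rfloor> - of_int \<lfloor>w j * v\<rfloor>))"

lemma coarse_decouple:
  assumes G: "coarse k G" and F: "tame F" "\<And>u. \<bar>F u\<bar> \<le> 1" and "\<tau> \<ge> 0" "\<bar>e\<bar> \<le> 1"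
    and e: "\<And>a. a \<ge> 0 \<Longrightarrow> \<bar>integral {a..a+\<tau>} F - e * \<tau>\<bar> \<le> \<epsilon> * \<tau>" and T: "T = real q * \<tau>"
  shows "norm (integral {0..T} (\<lambda>u. of_real (F u) * G u) - of_real e * integral {0..T} G)
     \<le> (16 / (1 - \<theta>) * (\<tau> * w k) + \<epsilon>) * T"
proof -
  from G obtain J where J: "\<And>u v. 0 \<le> v \<Longrightarrow> v \<le> u \<Longrightarrow>
        norm (G u - G v) \<le> 8 * (\<Sum>j=k..<J. of_int \<lfloor>w j * u\<rfloor> - of_int \<lfloor>w j * v\<rfloor>)"
    by (auto simp: coarse_def)
  have G': "tame G" "norm (G u) \<le> 1" for u using G by (auto simp: coarse_def)
  define H where "H u = 8 * (\<Sum>j=k..<J. real_of_int \<lfloor>w j * u\<rfloor>)" for u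
  have T0: "T \<ge> 0" using assms by simp
  have "norm (integral {0..T} (\<lambda>u. of_real (F u) * G u) - of_real e * integral {0..T} G)
     \<le> 2 * \<tau> * (H T - H 0) + \<epsilon> * T"
    unfolding T
  proof (rule integral_decouple)
    fix u v :: real assume "0 \<le> v" "v \<le> u"
    from J[OF this] show "norm (G u - G v) \<le> H u - H v"
      by (simp add: H_def sum_subtractf right_diff_distrib)
  qed (use assms G' in auto)
  also have "H T - H 0 = 8 * (\<Sum>j=k..<J. real_of_int \<lfloor>w j * T\<rfloor>)" by (simp add: H_def)
  also have "\<dots> \<le> 8 * (\<Sum>j=k..<J. w j * T)" by (intro mult_left_mono sum_mono) auto
  also have "(\<Sum>j=k..<J. w j * T) = (\<Sum>j=k..<J. w j) * T" by (simp add: sum_distrib_right)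
  also have "\<dots> \<le> w k / (1 - \<theta>) * T" using T0 sum_w_le by (intro mult_right_mono) auto
  finally have "norm (integral {0..T} (\<lambda>u. of_real (F u) * G u) - of_real e * integral {0..T} G)
     \<le> 2 * \<tau> * (8 * (w k / (1 - \<theta>) * T)) + \<epsilon> * T" using assms(4) by (simp add: mult_left_mono)
  also have "\<dots> = (16 / (1 - \<theta>) * (\<tau> * w k) + \<epsilon>) * T" by (simp add: algebra_simps)
  finally show ?thesis .
qed

text \<open>The window must divide \<open>T\<close> exactly, so \<open>T * w k / 16 ^ h\<close> is
  rounded down, which lengthens the window by at most a factor 2. The condition on
  \<open>2 ^ h\<close> guarantees that \<open>T\<close> holds at least one window.\<close>

lemma window_choice:
  assumes "T * w (k + g0 * h) \<ge> \<kappa>\<^sup>2" "2 ^ h \<ge> 1 / \<kappa>\<^sup>2"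
  shows "\<exists>q \<tau>. T = real q * \<tau> \<and> 16 ^ h / w k \<le> \<tau> \<and> \<tau> \<le> T \<and> \<tau> * w (k + g0 * h) \<le> 2 / 2 ^ h"
proof -
  have \<kappa>2: "\<kappa>\<^sup>2 > 0" using \<kappa> by simp
  have T0: "T > 0" using assms(1) \<kappa>2 w_pos[of "k + g0 * h"]
    by (metis less_le_trans mult.commute zero_less_mult_pos)
  have wk: "w (k + g0 * h) \<le> w k / 32 ^ h"
  proof -
    have "w (k + g0 * h) \<le> \<theta> ^ (g0 * h) * w k" by (rule w_upper_power)
    also have "\<dots> \<le> 1 / 32 ^ h * w k" using \<theta>_power_g0 w_pos[of k] by (intro mult_right_mono) auto
    finally show ?thesis by simp
  qed
  have p: "(2::real) ^ h * 16 ^ h = 32 ^ h" by (simp flip: power_mult_distrib)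
  have big: "T * w k \<ge> 16 ^ h"
  proof -
    have "1 \<le> 2 ^ h * \<kappa>\<^sup>2" using assms(2) \<kappa>2 by (simp add: field_simps)
    also have "\<dots> \<le> 2 ^ h * (T * w (k + g0 * h))" using assms(1) by simp
    also have "\<dots> \<le> 2 ^ h * (T * (w k / 32 ^ h))" using wk T0 by (intro mult_left_mono) auto
    also have "\<dots> = T * w k / 16 ^ h" unfolding p[symmetric] by simp
    finally show ?thesis by (simp add: field_simps)
  qed
  define s where "s = T * w k / 16 ^ h"
  have s1: "s \<ge> 1" using big by (simp add: s_def)
  define q where "q = nat \<lfloor>s\<rfloor>"
  have q: "real q \<le> s" "s \<le> 2 * real q" "real q \<ge> 1"
  proof -
    have f: "\<lfloor>s\<rfloor> \<ge> 1" using s1 by simp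
    then have r: "real q = of_int \<lfloor>s\<rfloor>" by (simp add: q_def)
    show "real q \<le> s" unfolding r by simp
    show "real q \<ge> 1" unfolding r using f by linarith
    then show "s \<le> 2 * real q" unfolding r by linarith
  qed
  define \<tau> where "\<tau> = T / real q"
  have wpos: "w k > 0" by (rule w_pos)
  have sT: "T = s * (16 ^ h / w k)" using wpos by (simp add: s_def)
  have "16 ^ h / w k \<le> \<tau>"
  proof -
    have "real q * (16 ^ h / w k) \<le> s * (16 ^ h / w k)" using q wpos by (intro mult_right_mono) auto
    then show ?thesis unfolding \<tau>_def sT[symmetric] using q by (simp add: pos_le_divide_eq mult.commute)
  qed
  moreover have "\<tau> \<le> 2 * (16 ^ h / w k)"
  proof -
    have "s * (16 ^ h / w k) \<le> 2 * real q * (16 ^ h / w k)" using q wpos by (intro mult_right_mono) auto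
    then show ?thesis unfolding \<tau>_def sT[symmetric] using q by (simp add: pos_divide_le_eq mult_ac)
  qed
  then have "\<tau> * w (k + g0 * h) \<le> 2 * (16 ^ h / w k) * (w k / 32 ^ h)"
    using wk w_pos wpos by (intro mult_mono) (auto intro: less_imp_le)
  then have "\<tau> * w (k + g0 * h) \<le> 2 / 2 ^ h" unfolding p[symmetric] using wpos by simp
  moreover have "\<tau> \<le> T" using q T0 by (simp add: \<tau>_def field_simps)
  moreover have "T = real q * \<tau>" using q by (simp add: \<tau>_def)
  ultimately show ?thesis by blast
qed

text \<open>The first summand makes the decoupling estimates trivial when
  \<open>2 ^ h < 1 / \<kappa>\<^sup>2\<close>; the others collect their error terms.\<close>

definition C3 :: real where "C3 = 2 / \<kappa>\<^sup>2 + 14 + 24 * C1 + 32 / (1 - \<theta>)"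

lemma C3_pos: "C3 \<ge> 2 / \<kappa>\<^sup>2" "C3 \<ge> 4 + 3 * C1 + 32 / (1 - \<theta>)" "C3 \<ge> 14 + 24 * C1 + 32 / (1 - \<theta>)" "C3 > 0"
  unfolding C3_def using \<kappa> \<theta> C1_pos by (auto intro!: add_pos_pos add_nonneg_nonneg)

lemma integral_coarse_le:
  assumes "coarse k G" "\<And>u. \<bar>F u\<bar> \<le> 1" "tame F" "T \<ge> 0"
  shows "norm (integral {0..T} (\<lambda>u. of_real (F u) * G u)) \<le> T" "norm (integral {0..T} G) \<le> T"
proof -
  have G: "tame G" "\<And>u. norm (G u) \<le> 1" using assms(1) by (auto simp: coarse_def)
  have "norm (of_real (F u) * G u) \<le> 1" for u
    using mult_mono[OF assms(2)[of u] G(2)[of u]] by (simp add: norm_mult)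
  then show "norm (integral {0..T} (\<lambda>u. of_real (F u) * G u)) \<le> T"
    using norm_integral_le[of "\<lambda>u. of_real (F u) * G u" 1 T 0] tame_mult[OF tame_of_real[OF assms(3)] G(1)] assms
    by auto
  show "norm (integral {0..T} G) \<le> T"
    using norm_integral_le[of G 1 T 0] G assms by auto
qed

text \<open>Alignment is used with \<open>N = 4 ^ h\<close>: the shift is of order
  \<open>4 ^ h\<close> in a window of order \<open>16 ^ h\<close>, and the phase error is of order
  \<open>1 / 4 ^ h\<close>, so the mean of \<open>X k\<close> is of order \<open>1 / 4 ^ h\<close>.
  The variation of \<open>G\<close> over a window weakens this to \<open>1 / 2 ^ h\<close>.\<close>

lemma decouple_X:
  assumes G: "coarse (k + g0 * h) G" and T: "T * w (k + g0 * h) \<ge> \<kappa>\<^sup>2"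
  shows "norm (integral {0..T} (\<lambda>u. of_real (X k u) * G u)) \<le> C3 / 2 ^ h * T"
proof -
  have \<kappa>2: "\<kappa>\<^sup>2 > 0" using \<kappa> by simp
  have T0: "T > 0" using T \<kappa>2 w_pos[of "k + g0 * h"]
    by (metis less_le_trans mult.commute zero_less_mult_pos)
  have p16: "(16::real) ^ h = 4 ^ h * 4 ^ h" by (simp flip: power_mult_distrib)
  show ?thesis
  proof (cases "2 ^ h \<ge> 1 / \<kappa>\<^sup>2")
    case True
    obtain q \<tau> where q: "T = real q * \<tau>" "16 ^ h / w k \<le> \<tau>" "\<tau> \<le> T" "\<tau> * w (k + g0 * h) \<le> 2 / 2 ^ h"
      using window_choice[OF T True] by blast
    have \<tau>0: "\<tau> > 0" using q(2) w_pos[of k] by (meson divide_pos_pos less_le_trans zero_less_numeral zero_less_power)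
    define \<epsilon> where "\<epsilon> = (4 + 3 * C1) / 2 ^ h"
    have "norm (integral {0..T} (\<lambda>u. of_real (X k u) * G u) - of_real 0 * integral {0..T} G)
       \<le> (16 / (1 - \<theta>) * (\<tau> * w (k + g0 * h)) + \<epsilon>) * T"
    proof (rule coarse_decouple[OF G])
      fix a :: real
      have "1 / w (Suc k) \<le> 1 / (\<kappa> * w k)" using w_lower[of k] w_pos \<kappa> by (intro divide_left_mono) auto
      also have "\<dots> \<le> 16 ^ h / w k"
      proof -
        have "1 / \<kappa> \<le> 1 / \<kappa>\<^sup>2" using \<kappa> by (simp add: field_simps power2_eq_square)
        also have "\<dots> \<le> 16 ^ h" using True power_mono[of 2 "16::real" h] by linarith
        finally show ?thesis using w_pos[of k] \<kappa> by (simp add: field_simps)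
      qed
      finally have "1 / w (Suc k) \<le> \<tau>" using q(2) by linarith
      then have "\<bar>integral {a..a+\<tau>} (X k)\<bar> \<le> 2 * (real (4 ^ h) + 1) / w k + 3 * C1 / real (4 ^ h) * \<tau>"
        by (intro integral_X_small) auto
      also have "2 * (real (4 ^ h) + 1) / w k \<le> 4 / 4 ^ h * \<tau>"
      proof -
        have "2 * (real (4 ^ h) + 1) / w k \<le> 4 * 4 ^ h / w k" using w_pos[of k] by (intro divide_right_mono) auto
        also have "\<dots> = 4 / 4 ^ h * (16 ^ h / w k)" unfolding p16 by simp
        also have "\<dots> \<le> 4 / 4 ^ h * \<tau>" using q(2) by (intro mult_left_mono) auto
        finally show ?thesis .
      qed
      finally have "\<bar>integral {a..a+\<tau>} (X k)\<bar> \<le> (4 + 3 * C1) / 4 ^ h * \<tau>"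
        by (simp add: add_divide_distrib algebra_simps)
      also have "\<dots> \<le> \<epsilon> * \<tau>" unfolding \<epsilon>_def
        using C1_pos \<tau>0 by (intro mult_right_mono divide_left_mono power_mono) auto
      finally show "\<bar>integral {a..a+\<tau>} (X k) - 0 * \<tau>\<bar> \<le> \<epsilon> * \<tau>" by simp
    qed (use q \<tau>0 tame_X in auto)
    also have "\<dots> \<le> (16 / (1 - \<theta>) * (2 / 2 ^ h) + \<epsilon>) * T"
      using q(4) \<theta> T0 by (intro mult_right_mono add_right_mono mult_left_mono) auto
    also have "\<dots> = (4 + 3 * C1 + 32 / (1 - \<theta>)) / 2 ^ h * T"
      by (simp add: \<epsilon>_def add_divide_distrib)
    also have "\<dots> \<le> C3 / 2 ^ h * T" using C3_pos T0 by (intro mult_right_mono divide_right_mono) auto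
    finally show ?thesis by simp
  next
    case False
    moreover have "2 / \<kappa>\<^sup>2 = 2 * (1 / \<kappa>\<^sup>2)" "1 / \<kappa>\<^sup>2 > 0" using \<kappa>2 by auto
    ultimately have "1 * 2 ^ h \<le> C3" using C3_pos(1) by linarith
    then have "1 \<le> C3 / 2 ^ h" by (simp add: field_simps)
    then have "1 * T \<le> C3 / 2 ^ h * T" using T0 by (intro mult_right_mono) auto
    moreover have "norm (integral {0..T} (\<lambda>u. of_real (X k u) * G u)) \<le> T"
      using T0 by (intro integral_coarse_le[OF G] tame_X) auto
    ultimately show ?thesis by linarith
  qed
qed

text \<open>A mean over a long but finite time. Keeping \<open>S\<close> as a parameter avoids any
  question about limiting correlations; it is fixed later, depending on the number of waves.\<close>

definition corr :: "real \<Rightarrow> nat \<Rightarrow> nat \<Rightarrow> real" where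
  "corr S k j = integral {0..S} (\<lambda>u. X k u * X j u) / S"

lemma tame_XX: "tame (\<lambda>u. X k u * X j u)"
  by (intro tame_intros tame_X)

lemma abs_corr_le_1: "S > 0 \<Longrightarrow> \<bar>corr S k j\<bar> \<le> 1"
  using norm_integral_le[OF tame_XX, of k j 1 S 0] by (simp add: corr_def abs_mult abs_divide field_simps)

text \<open>The product of two waves need not have mean zero, so its long-time mean is split off.
  \<open>D ^ n \<le> 2 ^ h\<close> keeps the magnified alignment error \<open>D ^ n / 4 ^ h\<close>
  below \<open>1 / 2 ^ h\<close>, and the length of \<open>S\<close> absorbs its incomplete last
  window.\<close>

lemma decouple_XX:
  assumes G: "coarse (k + g0 * h) G" and T: "T * w (k + g0 * h) \<ge> \<kappa>\<^sup>2"
    and j: "k < j" "Suc j = k + n" "D ^ n \<le> 2 ^ h" and S: "2 ^ h * T \<le> S"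
  shows "norm (integral {0..T} (\<lambda>u. of_real (X k u * X j u) * G u) - of_real (corr S k j) * integral {0..T} G)
     \<le> C3 / 2 ^ h * T"
proof -
  have \<kappa>2: "\<kappa>\<^sup>2 > 0" using \<kappa> by simp
  have T0: "T > 0" using T \<kappa>2 w_pos[of "k + g0 * h"]
    by (metis less_le_trans mult.commute zero_less_mult_pos)
  have "1 * T \<le> 2 ^ h * T" using T0 by (intro mult_right_mono) auto
  with S T0 have S0: "S > 0" "T \<le> S" by linarith+
  have p16: "(16::real) ^ h = 4 ^ h * 4 ^ h" by (simp flip: power_mult_distrib)
  show ?thesis
  proof (cases "2 ^ h \<ge> 1 / \<kappa>\<^sup>2")
    case True
    obtain q \<tau> where q: "T = real q * \<tau>" "16 ^ h / w k \<le> \<tau>" "\<tau> \<le> T" "\<tau> * w (k + g0 * h) \<le> 2 / 2 ^ h"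
      using window_choice[OF T True] by blast
    have \<tau>0: "\<tau> > 0" using q(2) w_pos[of k] by (meson divide_pos_pos less_le_trans zero_less_numeral zero_less_power)
    define \<epsilon> where "\<epsilon> = (8 + 24 * C1) / 2 ^ h"
    have long: "1 / w (Suc j) \<le> \<tau>"
    proof -
      \<comment> \<open>Up to index \<open>Suc j\<close> the frequency drops by at most
        \<open>\<kappa> ^ n\<close>, and this inequality turns \<open>1 / \<kappa> ^ n\<close> into
        \<open>D ^ n\<close>.\<close>
      have Dk: "1 \<le> D * \<kappa>" using D \<kappa> by (simp add: field_simps)
      have "1 \<le> (D * \<kappa>) ^ n" using Dk by (intro one_le_power)
      also have "\<dots> = D ^ n * \<kappa> ^ n" by (rule power_mult_distrib)
      also have "\<dots> \<le> 16 ^ h * \<kappa> ^ n"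
      proof (intro mult_right_mono)
        show "D ^ n \<le> 16 ^ h" using j(3) power_mono[of 2 "16::real" h] by linarith
      qed (use \<kappa> in auto)
      finally have "1 / \<kappa> ^ n \<le> 16 ^ h" using \<kappa> by (simp add: field_simps)
      moreover have "1 / w (Suc j) \<le> 1 / (\<kappa> ^ n * w k)"
        using w_lower_power[of n k] w_pos \<kappa> j(2) by (intro divide_left_mono) auto
      moreover have "1 / (\<kappa> ^ n * w k) = 1 / \<kappa> ^ n / w k" by simp
      ultimately have "1 / w (Suc j) \<le> 16 ^ h / w k"
        using w_pos[of k] by (smt (verit) divide_right_mono)
      with q(2) show ?thesis by linarith
    qed
    have near: "\<bar>integral {a..a+\<tau>} (\<lambda>u. X k u * X j u) - integral {b..b+\<tau>} (\<lambda>u. X k u * X j u)\<bar> \<le> \<epsilon> * \<tau>" for a b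
    proof -
      have "\<bar>integral {a..a+\<tau>} (\<lambda>u. X k u * X j u) - integral {b..b+\<tau>} (\<lambda>u. X k u * X j u)\<bar> 
         \<le> 4 * (real (4 ^ h) + 1) / w k + 24 * D ^ n * C1 / real (4 ^ h) * \<tau>"
        using j long by (intro integral_XX_near) auto
      also have "4 * (real (4 ^ h) + 1) / w k \<le> 8 / 2 ^ h * \<tau>"
      proof -
        have "4 * (real (4 ^ h) + 1) / w k \<le> 8 * 4 ^ h / w k" using w_pos[of k] by (intro divide_right_mono) auto
        also have "\<dots> = 8 / 4 ^ h * (16 ^ h / w k)" unfolding p16 by simp
        also have "\<dots> \<le> 8 / 2 ^ h * \<tau>" using q(2) w_pos[of k] 
          by (intro mult_mono divide_left_mono power_mono) (auto intro: less_imp_le)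
        finally show ?thesis .
      qed
      also have "24 * D ^ n * C1 / real (4 ^ h) * \<tau> \<le> 24 * C1 / 2 ^ h * \<tau>"
      proof (intro mult_right_mono)
        have "24 * D ^ n * C1 / real (4 ^ h) = 24 * C1 * (D ^ n / 4 ^ h)" by simp
        also have "\<dots> \<le> 24 * C1 * (2 ^ h / 4 ^ h)"
          using j(3) C1_pos by (intro mult_left_mono divide_right_mono) auto
        also have "(2::real) ^ h / 4 ^ h = 1 / 2 ^ h"
          by (simp add: field_simps flip: power_mult_distrib)
        finally show "24 * D ^ n * C1 / real (4 ^ h) \<le> 24 * C1 / 2 ^ h" by simp
      qed (use \<tau>0 in auto)
      finally show ?thesis by (simp add: \<epsilon>_def add_divide_distrib algebra_simps)
    qed
    have "norm (integral {0..T} (\<lambda>u. of_real (X k u * X j u) * G u) - of_real (corr S k j) * integral {0..T} G)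
       \<le> (16 / (1 - \<theta>) * (\<tau> * w (k + g0 * h)) + (\<epsilon> + 2 * \<tau> / S)) * T"
    proof (rule coarse_decouple[OF G])
      fix a :: real assume "a \<ge> 0"
      then show "\<bar>integral {a..a+\<tau>} (\<lambda>u. X k u * X j u) - corr S k j * \<tau>\<bar> \<le> (\<epsilon> + 2 * \<tau> / S) * \<tau>"
        unfolding corr_def using order_trans[OF q(3) S0(2)] \<tau>0
        by (intro long_average_near_window near tame_XX) (auto simp: abs_mult)
    qed (use q \<tau>0 tame_XX S0 abs_corr_le_1 in \<open>auto simp: abs_mult\<close>)
    also have "\<dots> \<le> (16 / (1 - \<theta>) * (2 / 2 ^ h) + (\<epsilon> + 2 / 2 ^ h)) * T"
    proof (intro mult_right_mono add_mono mult_left_mono order_refl)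
      have "\<tau> * 2 ^ h \<le> T * 2 ^ h" using q(3) by (intro mult_right_mono) auto
      also have "\<dots> \<le> S" using S by (simp only: mult.commute)
      finally have "\<tau> * 2 ^ h \<le> S" .
      then show "2 * \<tau> / S \<le> 2 / 2 ^ h" using S0 by (simp add: field_simps)
    qed (use q(4) \<theta> T0 in auto)
    also have "\<dots> = (10 + 24 * C1 + 32 / (1 - \<theta>)) / 2 ^ h * T"
      by (simp add: \<epsilon>_def add_divide_distrib)
    also have "\<dots> \<le> C3 / 2 ^ h * T" using C3_pos(3) T0 by (intro mult_right_mono divide_right_mono) auto
    finally show ?thesis by simp
  next
    case False
    moreover have "2 / \<kappa>\<^sup>2 = 2 * (1 / \<kappa>\<^sup>2)" by simp
    ultimately have "2 * 2 ^ h \<le> C3" using C3_pos(1) by linarith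
    then have "2 \<le> C3 / 2 ^ h" by (simp add: field_simps)
    then have "2 * T \<le> C3 / 2 ^ h * T" using T0 by (intro mult_right_mono) auto
    moreover have "norm (integral {0..T} (\<lambda>u. of_real (X k u * X j u) * G u)) \<le> T"
      using T0 by (intro integral_coarse_le[OF G] tame_XX) (auto simp: abs_mult)
    moreover have "norm (of_real (corr S k j) * integral {0..T} G) \<le> 1 * T"
      unfolding norm_mult norm_of_real using T0 abs_corr_le_1[OF S0(1)]
      by (intro mult_mono integral_coarse_le[OF G _ tame_X]) auto
    ultimately show ?thesis using norm_triangle_ineq4 by (smt (verit))
  qed
qed

end

section \<open>The central limit theorem for signed sums of waves\<close>

lemma norm_cis_minus_1: "norm (cis x - 1) \<le> \<bar>x\<bar>"
  using iexp_approx1[of x 0] by (simp add: cis_conv_exp)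

lemma norm_cis_minus_linear: "norm (cis x - 1 - \<i> * of_real x) \<le> x\<^sup>2 / 2"
  using iexp_approx1[of x 1] by (simp add: cis_conv_exp power2_eq_square numeral_2_eq_2 algebra_simps)

lemma norm_cis_diff: "norm (cis x - cis y) \<le> \<bar>x - y\<bar>"
proof -
  have "cis x - cis y = cis y * (cis (x - y) - 1)" by (simp add: algebra_simps cis_mult)
  then have "norm (cis x - cis y) = norm (cis (x - y) - 1)" by (simp add: norm_mult)
  then show ?thesis using norm_cis_minus_1[of "x - y"] by simp
qed

lemma abs_cos_minus_quadratic: "\<bar>cos x - 1 + x\<^sup>2 / 2\<bar> \<le> x ^ 4 / 24" for x :: real
proof -
  have f: "fact 4 = (24 :: real)" "fact 3 = (6 :: complex)" "fact 2 = (2 :: complex)" by (simp_all add: fact_numeral)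
  have s: "{..3::nat} = {0, 1, 2, 3}" by auto
  have "norm (iexp x - (\<Sum>k\<le>3. (\<i> * of_real x) ^ k / fact k)) \<le> \<bar>x\<bar> ^ 4 / fact 4"
    using iexp_approx1[of x 3] by simp
  moreover have "Re (iexp x - (\<Sum>k\<le>3. (\<i> * of_real x) ^ k / fact k)) = cos x - 1 + x\<^sup>2 / 2"
    unfolding s by (simp add: Re_exp f power_mult_distrib power3_eq_cube power2_eq_square)
  ultimately have "\<bar>cos x - 1 + x\<^sup>2 / 2\<bar> \<le> \<bar>x\<bar> ^ 4 / fact 4"
    using abs_Re_le_cmod[of "iexp x - (\<Sum>k\<le>3. (\<i> * of_real x) ^ k / fact k)"] by linarith
  then show ?thesis by (simp add: f)
qed

lemma abs_sin_minus_linear: "\<bar>sin x - x\<bar> \<le> \<bar>x\<bar> ^ 3 / 6" for x :: real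
proof -
  have f: "fact 3 = (6 :: real)" "fact 2 = (2 :: complex)" by (simp_all add: fact_numeral)
  have s: "{..2::nat} = {0, 1, 2}" by auto
  have "norm (iexp x - (\<Sum>k\<le>2. (\<i> * of_real x) ^ k / fact k)) \<le> \<bar>x\<bar> ^ 3 / fact 3"
    using iexp_approx1[of x 2] by simp
  moreover have "Im (iexp x - (\<Sum>k\<le>2. (\<i> * of_real x) ^ k / fact k)) = sin x - x"
    unfolding s by (simp add: Im_exp f power2_eq_square)
  ultimately have "\<bar>sin x - x\<bar> \<le> \<bar>x\<bar> ^ 3 / fact 3"
    using abs_Im_le_cmod[of "iexp x - (\<Sum>k\<le>2. (\<i> * of_real x) ^ k / fact k)"] by linarith
  then show ?thesis by (simp add: f)
qed

lemma abs_exp_minus_linear: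
  fixes x :: real
  assumes "\<bar>x\<bar> \<le> 1"
  shows "\<bar>exp x - 1 - x\<bar> \<le> x\<^sup>2"
proof (cases "x \<ge> 0")
  case True
  then have "exp x \<le> 1 + x + x\<^sup>2" using assms by (intro exp_bound) auto
  then show ?thesis using exp_ge_add_one_self[of x] zero_le_power2[of x] by linarith
next
  case False
  define z where "z = - x"
  have z: "0 < z" "z \<le> 1" using False assms by (auto simp: z_def)
  have xz: "x = - z" by (simp add: z_def)
  have "exp x * (1 + z) \<le> exp x * exp z" by (intro mult_left_mono exp_ge_add_one_self) auto
  also have "\<dots> = 1" by (simp add: z_def flip: exp_add)
  also have "\<dots> \<le> (1 - z + z\<^sup>2) * (1 + z)"
    using z by (simp add: algebra_simps power2_eq_square)
  finally have "exp x \<le> 1 - z + z\<^sup>2" using z by simp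
  then have "exp x - 1 - x \<le> x\<^sup>2" by (simp add: xz)
  then show ?thesis using exp_ge_add_one_self[of x] zero_le_power2[of x] by linarith
qed

text \<open>Grouping the indices into blocks of length \<open>d\<close> gives \<open>d\<close>
  copies of a geometric series.\<close>

lemma sum_half_power_div:
  assumes "d \<ge> 1"
  shows "(\<Sum>i<n. (1/2::real) ^ (i div d)) \<le> 2 * d"
proof -
  have "(\<Sum>i<n. (1/2::real) ^ (i div d)) \<le> (\<Sum>i<n * d. (1/2) ^ (i div d))"
    using assms by (intro sum_mono2) auto
  also have "\<dots> = (\<Sum>m<n. \<Sum>i=m*d..<m*d+d. (1/2) ^ (i div d))"
    by (rule sum.nat_group [symmetric])
  also have "\<dots> = (\<Sum>m<n. \<Sum>i=m*d..<m*d+d. (1/2) ^ m)"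
    using assms by (intro sum.cong refl arg_cong[where f = "\<lambda>k. (1/2::real) ^ k"] div_nat_eqI) (auto simp: algebra_simps)
  also have "\<dots> = d * (\<Sum>m<n. (1/2) ^ m)" by (simp add: sum_distrib_left)
  also have "(\<Sum>m<n. (1/2::real) ^ m) \<le> 2" by (simp add: geometric_sum)
  finally show ?thesis using assms by (simp add: mult_ac)
qed

definition avg :: "real \<Rightarrow> (real \<Rightarrow> complex) \<Rightarrow> complex" where
  "avg T f = integral {0..T} f / of_real T"

lemma avg_add: "tame f \<Longrightarrow> tame g \<Longrightarrow> avg T (\<lambda>u. f u + g u) = avg T f + avg T g"
  by (simp add: avg_def tame_integral_add add_divide_distrib)

lemma avg_diff: "tame f \<Longrightarrow> tame g \<Longrightarrow> avg T (\<lambda>u. f u - g u) = avg T f - avg T g"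
  by (simp add: avg_def tame_integral_diff diff_divide_distrib)

lemma avg_cmult: "avg T (\<lambda>u. a * f u) = a * avg T f"
  by (simp add: avg_def)

lemma avg_sum: "(\<And>i. i \<in> I \<Longrightarrow> tame (f i)) \<Longrightarrow> avg T (\<lambda>u. \<Sum>i\<in>I. f i u) = (\<Sum>i\<in>I. avg T (f i))"
  by (simp add: avg_def tame_integral_sum sum_divide_distrib)

lemma norm_avg_le:
  assumes "tame f" "\<And>u. norm (f u) \<le> B" "T > 0"
  shows "norm (avg T f) \<le> B"
  using norm_integral_le[OF assms(1,2), of T 0] assms(3) by (simp add: avg_def norm_divide field_simps)

section \<open>Signed sums of waves and summable correlations\<close>

locale signed_waves = lacunary_waves +
  fixes c :: "nat \<Rightarrow> real"
  assumes abs_c [simp]: "\<And>k. \<bar>c k\<bar> = 1"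
begin

definition Z :: "nat \<Rightarrow> nat \<Rightarrow> real \<Rightarrow> real" where
  "Z k K u = (\<Sum>j=k..<K. c j * X j u)"

lemma tame_Z: "tame (Z k K)"
  unfolding Z_def [abs_def] by (intro tame_intros tame_X)

lemma abs_Z_le: "\<bar>Z k K u\<bar> \<le> real (K - k)"
proof -
  have "\<bar>Z k K u\<bar> \<le> (\<Sum>j=k..<K. \<bar>c j * X j u\<bar>)" unfolding Z_def by (rule sum_abs)
  then show ?thesis by (simp add: abs_mult)
qed

lemma Z_split: "k \<le> l \<Longrightarrow> l \<le> K \<Longrightarrow> Z k K u = Z k l u + Z l K u"
  unfolding Z_def by (simp add: sum.atLeastLessThan_concat)

definition E :: "real \<Rightarrow> nat \<Rightarrow> nat \<Rightarrow> real \<Rightarrow> complex" where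
  "E s k K u = cis (s * Z k K u)"

lemma tame_E: "tame (E s k K)"
  unfolding E_def [abs_def] by (intro tame_intros tame_Z)

lemma norm_E [simp]: "norm (E s k K u) = 1"
  by (simp add: E_def)

abbreviation ticks :: "nat \<Rightarrow> real \<Rightarrow> real \<Rightarrow> real" where
  "ticks j u v \<equiv> of_int \<lfloor>w j * u\<rfloor> - of_int \<lfloor>w j * v\<rfloor>"

lemma ticks_nonneg: "v \<le> u \<Longrightarrow> ticks j u v \<ge> 0"
  using w_pos[of j] by (simp add: floor_mono)

lemma X_diff_ticks:
  assumes "v \<le> u"
  shows "\<bar>X j u - X j v\<bar> \<le> 2 * (ticks j u v + ticks (Suc j) u v)"
proof -
  have "jump i u v \<le> 2 * ticks i u v" for i
    unfolding jump_def using assms w_pos[of i] by (intro square_wave_diff) simp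
  then show ?thesis using X_diff[of j u v] by (smt (verit))
qed

lemma E_diff_ticks:
  assumes "v \<le> u" "\<bar>s\<bar> \<le> 1"
  shows "norm (E s k K u - E s k K v) \<le> 4 * (\<Sum>j=k..<Suc K. ticks j u v)"
proof -
  have "norm (E s k K u - E s k K v) \<le> \<bar>s\<bar> * \<bar>Z k K u - Z k K v\<bar>"
    unfolding E_def using norm_cis_diff[of "s * Z k K u" "s * Z k K v"] by (simp add: abs_mult flip: right_diff_distrib)
  also have "\<dots> \<le> 1 * \<bar>Z k K u - Z k K v\<bar>" using assms(2) by (intro mult_right_mono) auto
  also have "Z k K u - Z k K v = (\<Sum>j=k..<K. c j * (X j u - X j v))"
    by (simp add: Z_def sum_subtractf right_diff_distrib)
  also have "1 * \<bar>\<dots>\<bar> \<le> (\<Sum>j=k..<K. \<bar>c j * (X j u - X j v)\<bar>)" by simp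
  also have "\<dots> \<le> (\<Sum>j=k..<K. 2 * (ticks j u v + ticks (Suc j) u v))"
    using X_diff_ticks[OF assms(1)] by (intro sum_mono) (simp add: abs_mult)
  also have "\<dots> = 2 * (\<Sum>j=k..<K. ticks j u v) + 2 * (\<Sum>j=k..<K. ticks (Suc j) u v)"
    by (simp only: sum.distrib sum_distrib_left distrib_left)
  also have "(\<Sum>j=k..<K. ticks j u v) \<le> (\<Sum>j=k..<Suc K. ticks j u v)"
    using ticks_nonneg[OF assms(1)] by (intro sum_mono2) auto
  also have "(\<Sum>j=k..<K. ticks (Suc j) u v) = (\<Sum>j=Suc k..<Suc K. ticks j u v)"
    by (rule sum.shift_bounds_Suc_ivl [symmetric])
  also have "\<dots> \<le> (\<Sum>j=k..<Suc K. ticks j u v)"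
    using ticks_nonneg[OF assms(1)] by (intro sum_mono2) auto
  finally show ?thesis by simp
qed

lemma coarse_E:
  assumes "\<bar>s\<bar> \<le> 1" "l \<le> k"
  shows "coarse l (E s k K)"
  unfolding coarse_def
proof (intro conjI allI exI[of _ "Suc K"] impI)
  fix u v :: real assume uv: "0 \<le> v" "v \<le> u"
  have "norm (E s k K u - E s k K v) \<le> 4 * (\<Sum>j=k..<Suc K. ticks j u v)"
    by (rule E_diff_ticks) (use uv assms in auto)
  also have "\<dots> \<le> 8 * (\<Sum>j=l..<Suc K. ticks j u v)"
    using ticks_nonneg[OF uv(2)] assms(2) by (intro mult_mono sum_mono2 sum_nonneg) auto
  finally show "norm (E s k K u - E s k K v) \<le> 8 * (\<Sum>j=l..<Suc K. ticks j u v)" .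
qed (auto simp: tame_E)

text \<open>Allowing one more slow wave in front of the exponential lets the product of
  \<open>X k\<close> with a distant \<open>X j\<close> be treated as a decoupling of
  \<open>X k\<close> alone.\<close>

lemma coarse_X_E:
  assumes "\<bar>s\<bar> \<le> 1" "l \<le> j" "j < k"
  shows "coarse l (\<lambda>u. of_real (X j u) * E s k K u)"
  unfolding coarse_def
proof (intro conjI allI exI[of _ "Suc K + Suc (Suc j)"] impI)
  show "tame (\<lambda>u. of_real (X j u) * E s k K u)" by (intro tame_intros tame_X tame_E)
  fix u v :: real 
  show "norm (of_real (X j u) * E s k K u) \<le> 1" by (simp add: norm_mult)
  assume uv: "0 \<le> v" "v \<le> u"
  define J where "J = Suc K + Suc (Suc j)"
  have "of_real (X j u) * E s k K u - of_real (X j v) * E s k K v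
      = of_real (X j u) * (E s k K u - E s k K v) + of_real (X j u - X j v) * E s k K v"
    by (simp add: algebra_simps)
  then have "norm (of_real (X j u) * E s k K u - of_real (X j v) * E s k K v)
      \<le> norm (of_real (X j u) * (E s k K u - E s k K v)) + norm (of_real (X j u - X j v) * E s k K v)"
    by (simp only: norm_triangle_ineq)
  also have "\<dots> = norm (E s k K u - E s k K v) + \<bar>X j u - X j v\<bar>"
    unfolding norm_mult norm_of_real by simp
  also have "\<dots> \<le> 4 * (\<Sum>j=k..<Suc K. ticks j u v) + 2 * (ticks j u v + ticks (Suc j) u v)"
    using uv assms by (intro add_mono E_diff_ticks X_diff_ticks) auto
  also have "(\<Sum>j=k..<Suc K. ticks j u v) \<le> (\<Sum>j=l..<J. ticks j u v)"
    using ticks_nonneg[OF uv(2)] assms by (intro sum_mono2) (auto simp: J_def)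
  also have "ticks j u v + ticks (Suc j) u v = (\<Sum>i\<in>{j, Suc j}. ticks i u v)" by simp
  also have "\<dots> \<le> (\<Sum>j=l..<J. ticks j u v)"
    using ticks_nonneg[OF uv(2)] assms by (intro sum_mono2) (auto simp: J_def)
  finally have "norm (of_real (X j u) * E s k K u - of_real (X j v) * E s k K v) \<le> 6 * (\<Sum>j=l..<J. ticks j u v)"
    by simp
  also have "\<dots> \<le> 8 * (\<Sum>j=l..<J. ticks j u v)"
    using ticks_nonneg[OF uv(2)] by (intro mult_right_mono sum_nonneg) auto
  finally show "norm (of_real (X j u) * E s k K u - of_real (X j v) * E s k K v) \<le> 8 * (\<Sum>j=l..<Suc K + Suc (Suc j). ticks j u v)"
    unfolding J_def .
qed

lemma T_pos:
  assumes "T * w K \<ge> \<kappa>\<^sup>2"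
  shows "T > 0"
proof -
  have "\<kappa>\<^sup>2 > 0" using \<kappa> by simp
  with assms have "T * w K > 0" by linarith
  then show ?thesis using w_pos[of K] by (simp add: zero_less_mult_iff)
qed

lemma T_earlier:
  assumes "T * w K \<ge> \<kappa>\<^sup>2" "k \<le> K"
  shows "T * w k \<ge> \<kappa>\<^sup>2"
proof -
  have "T * w K \<le> T * w k" using T_pos[OF assms(1)] w_antimono[OF assms(2)] by (intro mult_left_mono) auto
  with assms show ?thesis by linarith
qed

lemma avg_X_coarse:
  assumes G: "\<And>l. l \<le> j \<Longrightarrow> coarse l G" and "k \<le> j" "T * w j \<ge> \<kappa>\<^sup>2" "h \<le> (j - k) div g0"
  shows "norm (avg T (\<lambda>u. of_real (X k u) * G u)) \<le> C3 / 2 ^ h"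
proof -
  have "g0 * h \<le> j - k" using assms(4) g0(1) by (metis div_times_less_eq_dividend dual_order.trans mult.commute mult_le_mono1)
  then have le: "k + g0 * h \<le> j" using assms(2) by simp
  have "norm (integral {0..T} (\<lambda>u. of_real (X k u) * G u)) \<le> C3 / 2 ^ h * T"
    by (rule decouple_X) (use le assms G T_earlier in auto)
  then show ?thesis using T_pos[OF assms(3)] by (simp add: avg_def norm_divide field_simps)
qed

text \<open>The sum of \<open>C3 / 2 ^ h\<close> over all distances, where each \<open>h\<close>
  occurs for \<open>g0\<close> of them.\<close>

definition V :: real where "V = 2 * g0 * C3"

lemma V_nonneg: "V \<ge> 0"
  using C3_pos(4) by (simp add: V_def)

lemma corr_decay:
  assumes "k < j" "S * w j \<ge> \<kappa>\<^sup>2" "h \<le> (j - k) div g0"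
  shows "\<bar>corr S k j\<bar> \<le> C3 / 2 ^ h"
proof -
  \<comment> \<open>At \<open>s = 0\<close> the exponential is the constant 1; it only brings
    \<open>X j\<close> into the form of \<open>coarse_X_E\<close>.\<close>
  have "avg S (\<lambda>u. of_real (X k u) * (of_real (X j u) * E 0 (Suc j) 0 u)) = of_real (corr S k j)"
  proof -
    have "integral {0..S} (\<lambda>u. of_real (X k u * X j u) :: complex) = of_real (integral {0..S} (\<lambda>u. X k u * X j u))"
    proof -
      have "bounded_linear (of_real :: real \<Rightarrow> complex)" by (rule bounded_linear_of_real)
      from integral_linear[OF tame_integrable[OF tame_XX] this, of 0 S k j] show ?thesis by (simp add: o_def)
    qed
    then show ?thesis by (simp add: avg_def corr_def E_def)
  qed
  moreover have "norm (avg S (\<lambda>u. of_real (X k u) * (of_real (X j u) * E 0 (Suc j) 0 u))) \<le> C3 / 2 ^ h"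
    using assms by (intro avg_X_coarse coarse_X_E) auto
  ultimately show ?thesis by simp
qed

lemma sum_corr_le:
  assumes "S * w J \<ge> \<kappa>\<^sup>2"
  shows "(\<Sum>j=Suc k..<J. \<bar>corr S k j\<bar>) \<le> V"
proof -
  have "(\<Sum>j=Suc k..<J. \<bar>corr S k j\<bar>) \<le> (\<Sum>j=Suc k..<J. C3 * (1/2) ^ ((j - k) div g0))"
  proof (rule sum_mono)
    fix j assume "j \<in> {Suc k..<J}"
    then have "\<bar>corr S k j\<bar> \<le> C3 / 2 ^ ((j - k) div g0)"
      using T_earlier[OF assms, of j] by (intro corr_decay) auto
    moreover have "C3 / 2 ^ ((j - k) div g0) = C3 * (1/2) ^ ((j - k) div g0)" by (simp add: power_divide)
    ultimately show "\<bar>corr S k j\<bar> \<le> C3 * (1/2) ^ ((j - k) div g0)" by simp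
  qed
  also have "\<dots> = C3 * (\<Sum>j=Suc k..<J. (1/2) ^ ((j - k) div g0))" by (simp add: sum_distrib_left)
  also have "(\<Sum>j=Suc k..<J. (1/2::real) ^ ((j - k) div g0)) = (\<Sum>i\<in>(\<lambda>j. j - k) ` {Suc k..<J}. (1/2) ^ (i div g0))"
    by (subst sum.reindex) (auto simp: inj_on_def)
  also have "\<dots> \<le> (\<Sum>i<J. (1/2) ^ (i div g0))" by (rule sum_mono2) auto
  also have "\<dots> \<le> 2 * g0" by (rule sum_half_power_div[OF g0(1)])
  finally show ?thesis using C3_pos(4) by (simp add: V_def mult_ac)
qed

text \<open>Half of the variance charged to index \<open>k\<close>: a cross term counts twice in the
  square of the sum and is charged to its smaller index, because waves are removed in increasing
  order. Nothing forces a single value to be positive.\<close>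

definition v :: "real \<Rightarrow> nat \<Rightarrow> nat \<Rightarrow> real" where
  "v S J k = 1 / 2 + c k * (\<Sum>j=Suc k..<J. c j * corr S k j)"

lemma abs_sum_corr_le:
  assumes "S * w J \<ge> \<kappa>\<^sup>2"
  shows "\<bar>\<Sum>j=Suc k..<J. c j * corr S k j\<bar> \<le> V"
proof -
  have "\<bar>\<Sum>j=Suc k..<J. c j * corr S k j\<bar> \<le> (\<Sum>j=Suc k..<J. \<bar>c j * corr S k j\<bar>)" by (rule sum_abs)
  also have "\<dots> = (\<Sum>j=Suc k..<J. \<bar>corr S k j\<bar>)" by (simp add: abs_mult)
  also have "\<dots> \<le> V" by (rule sum_corr_le[OF assms])
  finally show ?thesis .
qed

lemma abs_v_le:
  assumes "S * w J \<ge> \<kappa>\<^sup>2"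
  shows "\<bar>v S J k\<bar> \<le> 1 / 2 + V"
proof -
  have "\<bar>c k * (\<Sum>j=Suc k..<J. c j * corr S k j)\<bar> \<le> V"
    using abs_sum_corr_le[OF assms] by (simp add: abs_mult)
  then show ?thesis unfolding v_def by linarith
qed

end

lemma norm_sum4:
  fixes a b c d :: "'a::real_normed_vector"
  assumes "x = a + (b + (c - d))"
  shows "norm x \<le> norm a + (norm b + (norm c + norm d))"
  unfolding assms using norm_triangle_ineq[of a "b + (c - d)"] norm_triangle_ineq[of b "c - d"]
    norm_triangle_ineq4[of c d] by linarith

section \<open>Removing one wave from the characteristic function\<close>

context signed_waves
begin

definition \<phi> :: "real \<Rightarrow> real \<Rightarrow> nat \<Rightarrow> nat \<Rightarrow> complex" where
  "\<phi> T s K k = avg T (E s k K)"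

lemma E_split: "k \<le> l \<Longrightarrow> l \<le> K \<Longrightarrow> E s k K u = cis (s * Z k l u) * E s l K u"
  by (simp add: E_def Z_split[of k l K] cis_mult distrib_left)

lemma \<phi>_diff_le:
  assumes "k \<le> l" "l \<le> K" "T > 0"
  shows "norm (\<phi> T s K k - \<phi> T s K l) \<le> \<bar>s\<bar> * real (l - k)"
proof -
  have "\<phi> T s K k - \<phi> T s K l = avg T (\<lambda>u. E s k K u - E s l K u)"
    unfolding \<phi>_def by (rule avg_diff [symmetric]) (rule tame_E)+
  also have "norm \<dots> \<le> \<bar>s\<bar> * real (l - k)"
  proof (rule norm_avg_le)
    fix u
    have "norm (E s k K u - E s l K u) = norm ((cis (s * Z k l u) - 1) * E s l K u)"
      using E_split[OF assms(1,2)] by (simp add: algebra_simps)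
    also have "\<dots> \<le> \<bar>s * Z k l u\<bar>" unfolding norm_mult using norm_cis_minus_1 by simp
    also have "\<dots> \<le> \<bar>s\<bar> * real (l - k)" unfolding abs_mult using abs_Z_le by (intro mult_left_mono) auto
    finally show "norm (E s k K u - E s l K u) \<le> \<bar>s\<bar> * real (l - k)" .
  qed (auto intro!: tame_E tame_intros assms)
  finally show ?thesis .
qed

lemma \<phi>_self: "T > 0 \<Longrightarrow> \<phi> T s K K = 1"
proof -
  assume "T > 0"
  moreover have "E s K K = (\<lambda>_. 1)" by (auto simp: E_def Z_def)
  ultimately show ?thesis by (simp add: \<phi>_def avg_def scaleR_conv_of_real)
qed

text \<open>Expand the waves between \<open>k\<close> and \<open>k + g\<close> to first order in \<open>s\<close>; the remaining exponential
  \<open>E s (k + g) K\<close> decouples from \<open>X k\<close> and from the products \<open>X k * X j\<close>.\<close>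

lemma avg_X_E:
  fixes l d :: nat
  assumes T: "T * w K \<ge> \<kappa>\<^sup>2" and k: "k + g \<le> K" and s: "\<bar>s\<bar> \<le> 1"
    and L: "L = g0 * l" "h = d * L" "g = g0 * h" "d \<ge> 1" "l \<ge> 1" "D \<le> 2 ^ d"
    and S: "2 ^ h * T \<le> S"
  shows "norm (avg T (\<lambda>u. of_real (X k u) * E s (Suc k) K u)
            - \<i> * of_real s * of_real (\<Sum>j=Suc k..<k + L. c j * corr S k j) * \<phi> T s K (Suc k))
     \<le> C3 * (1 + \<bar>s\<bar> * g) / 2 ^ l + (s * g)\<^sup>2 / 2 + V * (s\<^sup>2 * g)"
proof -
  have T0: "T > 0" by (rule T_pos[OF T])
  have g01: "g0 \<ge> 1" by (rule g0)
  have L1: "1 \<le> L" unfolding L(1) using g01 L(5) by simp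
  have Lh: "L \<le> h" unfolding L(2) using L(4) by simp
  have lL: "l \<le> L" unfolding L(1) using g01 by simp
  have hg: "h \<le> g" unfolding L(3) using g01 by simp
  have g1: "1 \<le> g" using L1 Lh hg by linarith
  have Sw: "S * w K \<ge> \<kappa>\<^sup>2"
  proof -
    have "1 * T \<le> 2 ^ h * T" using T0 by (intro mult_right_mono) auto
    with S have "T \<le> S" by linarith
    then have "T * w K \<le> S * w K" using w_pos[of K] by (intro mult_right_mono) auto
    with T show ?thesis by linarith
  qed
  \<comment> \<open>Three scales: correlations are kept up to distance \<open>L\<close>;
    \<open>h = d * L\<close> makes \<open>2 ^ h\<close> dominate \<open>D ^ n\<close> for
    \<open>n \<le> L\<close>; and \<open>g = g0 * h\<close> is the gap that decouples with error of
    order \<open>1 / 2 ^ h\<close>.\<close>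
  define G where "G = E s (k + g) K"
  define W where "W = Z (Suc k) (k + g)"
  define R where "R u = cis (s * W u) - 1 - \<i> * of_real (s * W u)" for u
  have G: "tame G" "norm (G u) = 1" for u unfolding G_def by (auto simp: tame_E)
  have W: "tame W" "\<bar>W u\<bar> \<le> g" for u
    unfolding W_def using abs_Z_le[of "Suc k" "k+g" u] by (auto simp: tame_Z)
  have R: "tame R" "norm (R u) \<le> (s * g)\<^sup>2 / 2" for u
  proof -
    show "tame R" unfolding R_def [abs_def] using W by (intro tame_intros)
    have "norm (R u) \<le> (s * W u)\<^sup>2 / 2" unfolding R_def by (rule norm_cis_minus_linear)
    also have "\<dots> \<le> (s * g)\<^sup>2 / 2"
    proof (intro divide_right_mono)
      have "\<bar>s * W u\<bar> \<le> \<bar>s * g\<bar>" unfolding abs_mult using W(2)[of u] by (intro mult_left_mono) auto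
      then show "(s * W u)\<^sup>2 \<le> (s * g)\<^sup>2" by (rule abs_le_square_iff[THEN iffD1])
    qed auto
    finally show "norm (R u) \<le> (s * g)\<^sup>2 / 2" .
  qed
  define a where "a j = avg T (\<lambda>u. of_real (X k u * X j u) * G u)" for j
  have expand: "of_real (X k u) * E s (Suc k) K u = of_real (X k u) * G u
      + (\<i> * of_real s * (\<Sum>j=Suc k..<k + g. of_real (c j) * (of_real (X k u * X j u) * G u))
      + of_real (X k u) * (R u * G u))" for u
  proof -
    have 1: "E s (Suc k) K u = cis (s * W u) * G u"
      unfolding W_def G_def using k g1 by (intro E_split) auto
    have 2: "cis (s * W u) = 1 + \<i> * of_real s * of_real (W u) + R u" by (simp add: R_def)
    have 3: "(\<Sum>j=Suc k..<k + g. of_real (c j) * (of_real (X k u * X j u) * G u)) 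
       = of_real (X k u) * (of_real (W u) * G u)"
      unfolding W_def Z_def of_real_sum sum_distrib_left sum_distrib_right
      by (intro sum.cong) (simp_all add: mult_ac)
    show ?thesis unfolding 1 2 3 by (simp add: algebra_simps)
  qed
  have tm: "tame (\<lambda>u. of_real (X k u * X j u) * G u)" for j
    using G by (intro tame_intros tame_X)
  have "avg T (\<lambda>u. of_real (X k u) * E s (Suc k) K u)
     = avg T (\<lambda>u. of_real (X k u) * G u) + (\<i> * of_real s * (\<Sum>j=Suc k..<k + g. of_real (c j) * a j)
       + avg T (\<lambda>u. of_real (X k u) * (R u * G u)))"
    unfolding expand using G R tm
    by (simp add: avg_add avg_cmult avg_sum a_def tame_add tame_mult tame_const tame_sum tame_of_real tame_X)
  moreover have b1: "norm (avg T (\<lambda>u. of_real (X k u) * G u)) \<le> C3 / 2 ^ l"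
  proof (rule avg_X_coarse[where j = "k + g"])
    show "l \<le> (k + g - k) div g0" using lL Lh g01 by (simp add: L(3))
  qed (use s T T_earlier[OF T] k in \<open>auto simp: G_def intro: coarse_E\<close>)
  moreover have b2: "norm (avg T (\<lambda>u. of_real (X k u) * (R u * G u))) \<le> (s * g)\<^sup>2 / 2"
  proof (rule norm_avg_le[OF _ _ T0])
    show "tame (\<lambda>u. of_real (X k u) * (R u * G u))" using G R by (intro tame_intros tame_X)
    fix u show "norm (of_real (X k u) * (R u * G u)) \<le> (s * g)\<^sup>2 / 2"
      using R(2)[of u] G(2)[of u] by (simp add: norm_mult)
  qed
  moreover have b3: "norm ((\<Sum>j=Suc k..<k + g. of_real (c j) * a j)
      - of_real (\<Sum>j=Suc k..<k + L. c j * corr S k j) * \<phi> T s K (k + g)) \<le> g * (C3 / 2 ^ l)"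
  proof -
    \<comment> \<open>Below distance \<open>L\<close> the average is compared with the correlation
      times \<open>\<phi>\<close>. Beyond it \<open>X j\<close> joins the slow side, the average is
      itself negligible, and the comparison value is 0.\<close>
    define b where "b j = (if j < k + L then of_real (corr S k j) * \<phi> T s K (k + g) else 0)" for j
    have bb: "norm (a j - b j) \<le> C3 / 2 ^ l" if j: "j \<in> {Suc k..<k + g}" for j
    proof (cases "j < k + L")
      case True
      define n where "n = Suc j - k"
      have n: "Suc j = k + n" "n \<le> L" using j True by (auto simp: n_def)
      have "D ^ n \<le> (2 ^ d) ^ n" using D_ge_1 L(6) by (intro power_mono) auto
      also have "\<dots> = 2 ^ (d * n)" by (simp add: power_mult)
      also have "\<dots> \<le> 2 ^ h" using n by (intro power_increasing) (auto simp: L(2))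
      finally have Dn: "D ^ n \<le> 2 ^ h" .
      have "norm (integral {0..T} (\<lambda>u. of_real (X k u * X j u) * G u) - of_real (corr S k j) * integral {0..T} G)
         \<le> C3 / 2 ^ h * T"
        using T_earlier[OF T, of "k + g"] k n Dn S j s
        by (intro decouple_XX[where n = n]) (auto simp: G_def L(3) intro!: coarse_E)
      then have "norm (integral {0..T} (\<lambda>u. of_real (X k u * X j u) * G u) - of_real (corr S k j) * integral {0..T} G) / T
         \<le> C3 / 2 ^ h" using T0 by (simp only: pos_divide_le_eq)
      moreover have "a j - b j = (integral {0..T} (\<lambda>u. of_real (X k u * X j u) * G u) - of_real (corr S k j) * integral {0..T} G) / of_real T"
        using True by (simp add: a_def b_def avg_def \<phi>_def G_def diff_divide_distrib)
      ultimately have "norm (a j - b j) \<le> C3 / 2 ^ h"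
        using T0 by (simp only: norm_divide norm_of_real abs_of_pos)
      also have "\<dots> \<le> C3 / 2 ^ l" using C3_pos(4) lL Lh
        by (intro divide_left_mono power_increasing) auto
      finally show ?thesis .
    next
      case False
      have "norm (avg T (\<lambda>u. of_real (X k u) * (of_real (X j u) * G u))) \<le> C3 / 2 ^ l"
      proof (rule avg_X_coarse[where j = j])
        have "g0 * l \<le> j - k" using False L(1) by simp
        then show "l \<le> (j - k) div g0" using g01 by (metis div_le_mono nonzero_mult_div_cancel_left not_one_le_zero)
        show "\<kappa>\<^sup>2 \<le> T * w j" using j k by (intro T_earlier[OF T]) auto
        fix l' assume "l' \<le> j"
        then show "coarse l' (\<lambda>u. of_real (X j u) * G u)" unfolding G_def using s j by (intro coarse_X_E) auto
      qed (use j in auto)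
      then show ?thesis using False by (simp add: a_def b_def mult.assoc)
    qed
    have "of_real (\<Sum>j=Suc k..<k + L. c j * corr S k j) * \<phi> T s K (k + g) = (\<Sum>j=Suc k..<k + g. of_real (c j) * b j)"
    proof -
      have "(\<Sum>j=Suc k..<k + g. of_real (c j) * b j) = (\<Sum>j=Suc k..<k + L. of_real (c j) * b j)"
        using Lh hg by (intro sum.mono_neutral_right) (auto simp: b_def)
      also have "\<dots> = (\<Sum>j=Suc k..<k + L. of_real (c j * corr S k j) * \<phi> T s K (k + g))"
        by (intro sum.cong) (auto simp: b_def)
      finally show ?thesis by (simp add: sum_distrib_right)
    qed
    then have "(\<Sum>j=Suc k..<k + g. of_real (c j) * a j) - of_real (\<Sum>j=Suc k..<k + L. c j * corr S k j) * \<phi> T s K (k + g)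
        = (\<Sum>j=Suc k..<k + g. of_real (c j) * (a j - b j))"
      by (simp only: sum_subtractf right_diff_distrib)
    also have "norm \<dots> \<le> (\<Sum>j=Suc k..<k + g. norm (of_real (c j) * (a j - b j)))" by (rule norm_sum)
    also have "\<dots> \<le> (\<Sum>j=Suc k..<k + g. C3 / 2 ^ l)"
      using bb by (intro sum_mono) (simp add: norm_mult)
    also have "\<dots> \<le> g * (C3 / 2 ^ l)" using C3_pos(4) by (simp add: divide_right_mono mult_right_mono)
    finally show ?thesis .
  qed
  define q where "q = (\<Sum>j=Suc k..<k + L. c j * corr S k j)"
  have q: "\<bar>q\<bar> \<le> V" unfolding q_def
  proof (rule abs_sum_corr_le)
    show "\<kappa>\<^sup>2 \<le> S * w (k + L)" using k Lh hg by (intro T_earlier[OF Sw]) auto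
  qed
  \<comment> \<open>Replacing \<open>\<phi>\<close> at \<open>k + g\<close> by \<open>\<phi>\<close>
    at \<open>Suc k\<close> closes the recursion, at the price of a factor
    \<open>\<bar>s\<bar> * g\<close>.\<close>
  have b4: "norm (\<phi> T s K (Suc k) - \<phi> T s K (k + g)) \<le> \<bar>s\<bar> * g"
  proof -
    have "norm (\<phi> T s K (Suc k) - \<phi> T s K (k + g)) \<le> \<bar>s\<bar> * real (k + g - Suc k)"
      using k g1 T0 by (intro \<phi>_diff_le) auto
    also have "\<dots> \<le> \<bar>s\<bar> * g" by (intro mult_left_mono) auto
    finally show ?thesis .
  qed
  ultimately have "avg T (\<lambda>u. of_real (X k u) * E s (Suc k) K u) - \<i> * of_real s * of_real q * \<phi> T s K (Suc k)
     = avg T (\<lambda>u. of_real (X k u) * G u) 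
       + (\<i> * of_real s * ((\<Sum>j=Suc k..<k + g. of_real (c j) * a j) - of_real q * \<phi> T s K (k + g))
       + (avg T (\<lambda>u. of_real (X k u) * (R u * G u)) 
       - \<i> * of_real s * of_real q * (\<phi> T s K (Suc k) - \<phi> T s K (k + g))))" (is "?lhs = ?a + (?b + (?c - ?d))")
    by (simp add: algebra_simps)
  then have "norm ?lhs \<le> norm ?a + (norm ?b + (norm ?c + norm ?d))"
    by (rule norm_sum4)
  also have "\<dots> \<le> C3 / 2 ^ l + (\<bar>s\<bar> * (g * (C3 / 2 ^ l)) + ((s * g)\<^sup>2 / 2 + \<bar>s\<bar> * V * (\<bar>s\<bar> * g)))"
  proof (intro add_mono b1 b2)
    show "norm ?b \<le> \<bar>s\<bar> * (g * (C3 / 2 ^ l))"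
      using mult_left_mono[OF b3 abs_ge_zero[of s]] unfolding q_def[symmetric] norm_mult norm_ii norm_of_real by simp
    have "norm ?d = \<bar>s\<bar> * \<bar>q\<bar> * norm (\<phi> T s K (Suc k) - \<phi> T s K (k + g))"
      unfolding norm_mult norm_ii norm_of_real by simp
    also have "\<dots> \<le> \<bar>s\<bar> * V * (\<bar>s\<bar> * g)"
      using q b4 by (intro mult_mono) auto
    finally show "norm ?d \<le> \<bar>s\<bar> * V * (\<bar>s\<bar> * g)" .
  qed
  also have "\<dots> = C3 * (1 + \<bar>s\<bar> * g) / 2 ^ l + (s * g)\<^sup>2 / 2 + V * (s\<^sup>2 * g)"
    by (simp add: power2_eq_square add_divide_distrib algebra_simps flip: abs_mult)
  finally show ?thesis unfolding q_def .
qed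

text \<open>The trigonometric expression is the factor produced by removing one wave. Up to fourth
  order it is \<open>1 - s\<^sup>2 * (1 / 2 + q)\<close>, and so is the exponential.\<close>

lemma quartic_error:
  assumes "\<bar>s\<bar> \<le> 1" "\<bar>q\<bar> \<le> V" "s\<^sup>2 * (1 / 2 + V) \<le> 1"
  shows "\<bar>cos s - s * sin s * q - exp (- (s\<^sup>2 * (1 / 2 + q)))\<bar> \<le> (1 + V)\<^sup>2 * s ^ 4"
proof -
  have V: "V \<ge> 0" by (rule V_nonneg)
  define x where "x = - (s\<^sup>2 * (1 / 2 + q))"
  have q2: "\<bar>1 / 2 + q\<bar> \<le> 1 / 2 + V" using assms(2) by linarith
  have x1: "\<bar>x\<bar> \<le> s\<^sup>2 * (1 / 2 + V)" unfolding x_def using q2 by (simp add: abs_mult mult_left_mono)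
  have "\<bar>exp x - 1 - x\<bar> \<le> x\<^sup>2" using x1 assms(3) by (intro abs_exp_minus_linear) simp
  also have "x\<^sup>2 \<le> (s\<^sup>2 * (1 / 2 + V))\<^sup>2" using x1 V by (intro abs_le_square_iff[THEN iffD1]) simp
  also have "\<dots> = (1 / 2 + V)\<^sup>2 * s ^ 4" by (simp add: power_mult_distrib mult.commute flip: power_mult)
  finally have e1: "\<bar>exp x - 1 - x\<bar> \<le> (1 / 2 + V)\<^sup>2 * s ^ 4" .
  have e2: "\<bar>cos s - 1 + s\<^sup>2 / 2\<bar> \<le> s ^ 4 / 24" by (rule abs_cos_minus_quadratic)
  have e3: "\<bar>s * q * (sin s - s)\<bar> \<le> V * s ^ 4 / 6"
  proof -
    have "\<bar>s * q * (sin s - s)\<bar> \<le> (\<bar>s\<bar> * V) * (\<bar>s\<bar> ^ 3 / 6)"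
      unfolding abs_mult using assms(2) V by (intro mult_mono abs_sin_minus_linear) auto
    also have "\<dots> = V * \<bar>s\<bar> ^ 4 / 6" by (simp add: eval_nat_numeral)
    finally show ?thesis by simp
  qed
  have e1': "\<bar>- (exp x - 1 - x)\<bar> \<le> (1 / 2 + V)\<^sup>2 * s ^ 4" using e1 by (simp only: abs_minus_cancel)
  have tri: "\<bar>p - q + r\<bar> \<le> a + b + c'" if "\<bar>p\<bar> \<le> a" "\<bar>q\<bar> \<le> b" "\<bar>r\<bar> \<le> c'" for p q r a b c' :: real
    using that by linarith
  have "cos s - s * sin s * q - exp x = (cos s - 1 + s\<^sup>2 / 2) - s * q * (sin s - s) + - (exp x - 1 - x)"
    by (simp add: x_def algebra_simps power2_eq_square)
  then have "\<bar>cos s - s * sin s * q - exp x\<bar> \<le> s ^ 4 / 24 + V * s ^ 4 / 6 + (1 / 2 + V)\<^sup>2 * s ^ 4"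
    using tri[OF e2 e3 e1'] by (simp only:)
  also have "\<dots> = (1 / 24 + V / 6 + (1 / 2 + V)\<^sup>2) * s ^ 4" by (simp add: algebra_simps)
  also have "\<dots> \<le> (1 + V)\<^sup>2 * s ^ 4"
    using V by (intro mult_right_mono) (auto simp: power2_eq_square algebra_simps)
  finally show ?thesis by (simp add: x_def)
qed

text \<open>A signed wave takes only the values 1 and -1, so its exponential is linear in it and the
  wave splits off exactly, as \<open>cos s\<close> plus \<open>\<i> * sin s\<close> times an
  average. Only that average is approximated, and the factor \<open>sin s\<close> gains another
  power of \<open>s\<close> in its error.\<close>

lemma \<phi>_step:
  fixes l d :: nat
  assumes T: "T * w K \<ge> \<kappa>\<^sup>2" and k: "k + g \<le> K" and s: "\<bar>s\<bar> \<le> 1" "s\<^sup>2 * (1 / 2 + V) \<le> 1"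
    and L: "L = g0 * l" "h = d * L" "g = g0 * h" "d \<ge> 1" "l \<ge> 1" "D \<le> 2 ^ d"
    and S: "2 ^ h * T \<le> S"
  shows "norm (\<phi> T s K k - of_real (exp (- (s\<^sup>2 * v S (k + L) k))) * \<phi> T s K (Suc k))
     \<le> \<bar>s\<bar> * (C3 * (1 + \<bar>s\<bar> * g) / 2 ^ l + (s * g)\<^sup>2 / 2 + V * (s\<^sup>2 * g)) + (1 + V)\<^sup>2 * s ^ 4"
proof -
  have T0: "T > 0" by (rule T_pos[OF T])
  have g1: "1 \<le> g" unfolding L using g0(1) L(4,5) by simp
  define q where "q = (\<Sum>j=Suc k..<k + L. c j * corr S k j)"
  have q: "\<bar>c k * q\<bar> \<le> V"
  proof -
    have LK: "k + L \<le> K"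
    proof -
      have "L \<le> g" unfolding L(2,3) using g0(1) L(4) by simp
      with k show ?thesis by simp
    qed
    have "1 * T \<le> 2 ^ h * T" using T0 by (intro mult_right_mono) auto
    with S have "T \<le> S" by linarith
    then have "T * w (k + L) \<le> S * w (k + L)" using w_pos by (intro mult_right_mono) (auto intro: less_imp_le)
    with T_earlier[OF T LK] have "\<kappa>\<^sup>2 \<le> S * w (k + L)" by linarith
    then show ?thesis unfolding q_def using abs_sum_corr_le by (simp add: abs_mult)
  qed
  have e: "E s k K u = of_real (cos s) * E s (Suc k) K u + \<i> * of_real (sin s * c k) * (of_real (X k u) * E s (Suc k) K u)" for u
  proof -
    have "E s k K u = cis (s * Z k (Suc k) u) * E s (Suc k) K u" using k g1 by (intro E_split) auto
    moreover have "Z k (Suc k) u = c k * X k u" by (simp add: Z_def)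
    moreover have "c k = 1 \<or> c k = -1" using abs_c[of k] by linarith
    then have "cis (s * (c k * X k u)) = of_real (cos s) + \<i> * of_real (sin s * c k) * of_real (X k u)"
      using X_cases[of k u] by (auto simp: complex_eq_iff)
    ultimately show ?thesis by (simp add: algebra_simps)
  qed
  define a where "a = avg T (\<lambda>u. of_real (X k u) * E s (Suc k) K u)"
  have \<phi>k: "\<phi> T s K k = of_real (cos s) * \<phi> T s K (Suc k) + \<i> * of_real (sin s * c k) * a"
    unfolding \<phi>_def e a_def
    by (subst avg_add) (auto intro!: tame_intros tame_X tame_E simp: avg_cmult)
  have b1: "norm (a - \<i> * of_real s * of_real q * \<phi> T s K (Suc k)) 
     \<le> C3 * (1 + \<bar>s\<bar> * g) / 2 ^ l + (s * g)\<^sup>2 / 2 + V * (s\<^sup>2 * g)"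
    unfolding a_def q_def by (rule avg_X_E[OF T k s(1) L S])
  have "v S (k + L) k = 1 / 2 + c k * q" by (simp add: v_def q_def)
  define x where "x = exp (- (s\<^sup>2 * v S (k + L) k))"
  have b2: "\<bar>cos s - s * sin s * (c k * q) - x\<bar> \<le> (1 + V)\<^sup>2 * s ^ 4"
    unfolding x_def \<open>v S (k + L) k = _\<close> by (rule quartic_error[OF s(1) q s(2)])
  have b3: "norm (\<phi> T s K (Suc k)) \<le> 1"
    unfolding \<phi>_def using T0 by (intro norm_avg_le tame_E) auto
  have "\<phi> T s K k - of_real x * \<phi> T s K (Suc k) 
     = \<i> * of_real (sin s * c k) * (a - \<i> * of_real s * of_real q * \<phi> T s K (Suc k))
       + of_real (cos s - s * sin s * (c k * q) - x) * \<phi> T s K (Suc k)"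
    unfolding \<phi>k by (simp add: algebra_simps)
  also have "norm \<dots> \<le> norm (\<i> * of_real (sin s * c k) * (a - \<i> * of_real s * of_real q * \<phi> T s K (Suc k)))
       + norm (of_real (cos s - s * sin s * (c k * q) - x) * \<phi> T s K (Suc k))" by (rule norm_triangle_ineq)
  also have "\<dots> = \<bar>sin s\<bar> * norm (a - \<i> * of_real s * of_real q * \<phi> T s K (Suc k))
       + \<bar>cos s - s * sin s * (c k * q) - x\<bar> * norm (\<phi> T s K (Suc k))"
    unfolding norm_mult norm_of_real norm_ii by (simp add: abs_mult)
  also have "\<dots> \<le> \<bar>s\<bar> * (C3 * (1 + \<bar>s\<bar> * g) / 2 ^ l + (s * g)\<^sup>2 / 2 + V * (s\<^sup>2 * g))
       + ((1 + V)\<^sup>2 * s ^ 4) * 1"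
    using b1 b2 b3 by (intro add_mono mult_mono abs_sin_x_le_abs_x) auto
  finally show ?thesis by (simp add: x_def)
qed

text \<open>The exponents are bounded in modulus only, since single variance increments have no
  definite sign. The resulting growth \<open>exp (n * b)\<close> stays bounded when \<open>b\<close>
  is of order \<open>1 / n\<close>.\<close>

lemma product_recursion:
  fixes f :: "nat \<Rightarrow> complex" and x :: "nat \<Rightarrow> real"
  assumes "\<And>k. k < n \<Longrightarrow> norm (f k - of_real (exp (x k)) * f (Suc k)) \<le> e"
    and "\<And>k. k < n \<Longrightarrow> \<bar>x k\<bar> \<le> b" "b \<ge> 0" "e \<ge> 0"
  shows "norm (f 0 - of_real (exp (\<Sum>k<n. x k)) * f n) \<le> n * e * exp (n * b)"
proof -
  have *: "norm (f 0 - of_real (exp (\<Sum>k<m. x k)) * f m) \<le> m * e * exp (n * b)" if "m \<le> n" for m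
    using that
  proof (induction m)
    case (Suc m)
    have "(\<Sum>k<m. x k) \<le> (\<Sum>k<m. b)" 
    proof (rule sum_mono)
      fix k assume "k \<in> {..<m}"
      with Suc.prems have "k < n" by simp
      from assms(2)[OF this] show "x k \<le> b" by linarith
    qed
    also have "\<dots> \<le> n * b" using Suc.prems assms(3) by (simp add: mult_right_mono)
    finally have p: "exp (\<Sum>k<m. x k) \<le> exp (n * b)" by simp
    have "f 0 - of_real (exp (\<Sum>k<Suc m. x k)) * f (Suc m) = (f 0 - of_real (exp (\<Sum>k<m. x k)) * f m)
       + of_real (exp (\<Sum>k<m. x k)) * (f m - of_real (exp (x m)) * f (Suc m))"
      by (simp add: exp_add algebra_simps)
    also have "norm \<dots> \<le> norm (f 0 - of_real (exp (\<Sum>k<m. x k)) * f m)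
       + norm (of_real (exp (\<Sum>k<m. x k)) * (f m - of_real (exp (x m)) * f (Suc m)))" by (rule norm_triangle_ineq)
    also have "\<dots> \<le> m * e * exp (n * b) + exp (n * b) * e"
    proof (rule add_mono)
      show "norm (f 0 - of_real (exp (\<Sum>k<m. x k)) * f m) \<le> m * e * exp (n * b)" using Suc by simp
      show "norm (of_real (exp (\<Sum>k<m. x k)) * (f m - of_real (exp (x m)) * f (Suc m))) \<le> exp (n * b) * e"
        unfolding norm_mult norm_of_real using p assms(1)[of m] Suc.prems by (intro mult_mono) auto
    qed
    finally show ?case by (simp add: algebra_simps)
  qed simp
  show ?thesis using *[of n] by simp
qed

end

section \<open>From single steps to the Gaussian limit\<close>

lemma abs_exp_diff_le:
  assumes "p \<le> M" "q \<le> M"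
  shows "\<bar>exp p - exp q\<bar> \<le> exp M * \<bar>p - q :: real\<bar>"
proof -
  have *: "exp p - exp q \<le> exp M * \<bar>p - q\<bar>" if "p \<le> M" "q \<le> M" for p q :: real
  proof -
    have "exp p - exp q = exp p * (1 - exp (q - p))" by (simp add: algebra_simps flip: exp_add)
    also have "\<dots> \<le> exp p * (p - q)"
    proof (intro mult_left_mono)
      show "1 - exp (q - p) \<le> p - q" using exp_ge_add_one_self[of "q - p"] by linarith
    qed auto
    also have "\<dots> \<le> exp p * \<bar>p - q\<bar>" by (intro mult_left_mono) auto
    also have "\<dots> \<le> exp M * \<bar>p - q\<bar>" using that by (intro mult_right_mono) auto
    finally show ?thesis .
  qed
  from *[OF assms] *[OF assms(2,1)] show ?thesis by (simp add: abs_le_iff abs_minus_commute)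
qed

context signed_waves
begin

definition Bsq :: "real \<Rightarrow> nat \<Rightarrow> real" where
  "Bsq S K = integral {0..S} (\<lambda>u. (Z 0 K u)\<^sup>2) / S"

lemma Bsq_eq:
  assumes "S > 0"
  shows "Bsq S K = 2 * (\<Sum>k<K. v S K k)"
proof (induction K)
  case 0
  then show ?case by (simp add: Bsq_def Z_def)
next
  case (Suc K)
  have cc: "c k * c k = 1" for k using abs_c[of k] by (metis abs_mult_self_eq mult_1)
  have sq: "(Z 0 (Suc K) u)\<^sup>2 = ((Z 0 K u)\<^sup>2 + (\<Sum>k<K. 2 * c k * c K * (X k u * X K u))) + 1" for u
  proof -
    have "Z 0 (Suc K) u = Z 0 K u + c K * X K u" by (simp add: Z_def)
    then have "(Z 0 (Suc K) u)\<^sup>2 = (Z 0 K u)\<^sup>2 + 2 * c K * X K u * Z 0 K u + (c K * c K) * (X K u * X K u)"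
      by (simp add: power2_eq_square algebra_simps)
    also have "2 * c K * X K u * Z 0 K u = (\<Sum>k<K. 2 * c k * c K * (X k u * X K u))"
      unfolding Z_def sum_distrib_left by (intro sum.cong) (auto simp: lessThan_atLeast0)
    finally show ?thesis by (simp add: cc)
  qed
  have t: "tame (\<lambda>u. (Z 0 K u)\<^sup>2)" "tame (\<lambda>u. \<Sum>k<K. 2 * c k * c K * (X k u * X K u))"
    "\<And>k. tame (\<lambda>u. 2 * c k * c K * (X k u * X K u))"
    by (intro tame_intros tame_Z tame_X)+
  have "integral {0..S} (\<lambda>u. (Z 0 (Suc K) u)\<^sup>2) 
     = (integral {0..S} (\<lambda>u. (Z 0 K u)\<^sup>2) + (\<Sum>k<K. 2 * c k * c K * integral {0..S} (\<lambda>u. X k u * X K u))) + S"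
    unfolding sq using assms t
    by (simp add: tame_integral_add tame_add tame_const tame_integral_sum mult.assoc)
  then have "Bsq S (Suc K) = Bsq S K + (\<Sum>k<K. 2 * c k * c K * corr S k K) + 1"
    using assms by (simp add: Bsq_def corr_def add_divide_distrib sum_divide_distrib)
  moreover have "v S (Suc K) k = v S K k + c k * c K * corr S k K" if "k < K" for k
    using that by (simp add: v_def algebra_simps)
  moreover have "v S (Suc K) K = 1 / 2" by (simp add: v_def)
  ultimately show ?case using Suc by (simp add: sum.distrib sum_distrib_left algebra_simps)
qed

lemma clt_bound:
  fixes l d :: nat
  assumes T: "T * w K \<ge> \<kappa>\<^sup>2" and g: "g \<le> K" and s: "\<bar>s\<bar> \<le> 1" "s\<^sup>2 * (1 / 2 + V) \<le> 1"
    and L: "L = g0 * l" "h = d * L" "g = g0 * h" "d \<ge> 1" "l \<ge> 1" "D \<le> 2 ^ d"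
    and S: "2 ^ h * T \<le> S"
  shows "norm (\<phi> T s K 0 - of_real (exp (- (s\<^sup>2 * Bsq S K / 2))))
     \<le> exp (K * (s\<^sup>2 * (1 / 2 + V))) *
         (K * (\<bar>s\<bar> * (C3 * (1 + \<bar>s\<bar> * g) / 2 ^ l + (s * g)\<^sup>2 / 2 + V * (s\<^sup>2 * g)) + (1 + V)\<^sup>2 * s ^ 4)
          + \<bar>s\<bar> * g + s\<^sup>2 * (K * (K * (C3 / 2 ^ l)) + g * (1 / 2 + V)))"
proof -
  have T0: "T > 0" by (rule T_pos[OF T])
  have "1 * T \<le> 2 ^ h * T" using T0 by (intro mult_right_mono) auto
  with S T0 have TS: "T \<le> S" "S > 0" by linarith+
  have Sw: "S * w K \<ge> \<kappa>\<^sup>2"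
  proof -
    have "T * w K \<le> S * w K" using w_pos[of K] TS by (intro mult_right_mono) auto
    with T show ?thesis by linarith
  qed
  have V0: "V \<ge> 0" by (rule V_nonneg)
  have Lg: "L \<le> g" unfolding L(2,3) using g0(1) L(4) by simp
  have L1: "1 \<le> L" unfolding L(1) using g0(1) L(5) by simp
  \<comment> \<open>Each removal needs \<open>g\<close> waves from the current one on, so the
    recursion stops at \<open>K - g\<close>; what is left differs from 1 by at most
    \<open>\<bar>s\<bar> * g\<close>.\<close>
  define n where "n = K - g"
  define e where "e = \<bar>s\<bar> * (C3 * (1 + \<bar>s\<bar> * g) / 2 ^ l + (s * g)\<^sup>2 / 2 + V * (s\<^sup>2 * g)) + (1 + V)\<^sup>2 * s ^ 4"
  define x where "x k = - (s\<^sup>2 * v S (k + L) k)" for k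
  define b where "b = s\<^sup>2 * (1 / 2 + V)"
  define M where "M = K * b"
  have e0: "e \<ge> 0" unfolding e_def using C3_pos(4) V0 by (intro add_nonneg_nonneg mult_nonneg_nonneg) auto
  have b0: "b \<ge> 0" unfolding b_def using V0 by simp
  have nK: "n \<le> K" "n + g = K" using g by (auto simp: n_def)
  have xb: "\<bar>x k\<bar> \<le> b" if "k < n" for k
  proof -
    have "S * w (k + L) \<ge> \<kappa>\<^sup>2" using that Lg nK by (intro T_earlier[OF Sw]) auto
    then have "\<bar>v S (k + L) k\<bar> \<le> 1 / 2 + V" by (rule abs_v_le)
    then show ?thesis unfolding x_def b_def by (simp add: abs_mult mult_left_mono)
  qed
  have p1: "norm (\<phi> T s K 0 - of_real (exp (\<Sum>k<n. x k)) * \<phi> T s K n) \<le> n * e * exp (n * b)"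
  proof (rule product_recursion)
    fix k assume "k < n"
    then have "k + g \<le> K" using nK by simp
    from \<phi>_step[OF T this s L S] show "norm (\<phi> T s K k - of_real (exp (x k)) * \<phi> T s K (Suc k)) \<le> e"
      unfolding x_def e_def .
  qed (use xb b0 e0 in auto)
  have "n * b \<le> M" unfolding M_def using nK b0 by (simp add: mult_right_mono)
  then have "n * e * exp (n * b) \<le> K * e * exp M"
    using nK e0 by (intro mult_mono) auto
  with p1 have p1': "norm (\<phi> T s K 0 - of_real (exp (\<Sum>k<n. x k)) * \<phi> T s K n) \<le> exp M * (K * e)"
    by (simp add: mult_ac)
  have xM: "(\<Sum>k<n. x k) \<le> M"
  proof -
    have "(\<Sum>k<n. x k) \<le> (\<Sum>k<n. b)"
    proof (rule sum_mono)
      fix k assume "k \<in> {..<n}"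
      with xb[of k] show "x k \<le> b" by simp
    qed
    with \<open>n * b \<le> M\<close> show ?thesis by simp
  qed
  have p2: "norm (of_real (exp (\<Sum>k<n. x k)) * \<phi> T s K n - of_real (exp (\<Sum>k<n. x k))) \<le> exp M * (\<bar>s\<bar> * g)"
  proof -
    have "of_real (exp (\<Sum>k<n. x k)) * \<phi> T s K n - of_real (exp (\<Sum>k<n. x k))
       = of_real (exp (\<Sum>k<n. x k)) * (\<phi> T s K n - \<phi> T s K K)"
      using \<phi>_self[OF T0] by (simp add: algebra_simps)
    also have "norm \<dots> = exp (\<Sum>k<n. x k) * norm (\<phi> T s K n - \<phi> T s K K)" by (simp add: norm_mult)
    also have "\<dots> \<le> exp M * (\<bar>s\<bar> * real (K - n))"
      using xM \<phi>_diff_le[OF nK(1) order_refl T0, of s] by (intro mult_mono) auto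
    also have "K - n = g" using nK by simp
    finally show ?thesis .
  qed
  have p3: "\<bar>exp (\<Sum>k<n. x k) - exp (- (s\<^sup>2 * Bsq S K / 2))\<bar> \<le> exp M * (s\<^sup>2 * (K * (K * (C3 / 2 ^ l)) + g * (1 / 2 + V)))"
  proof -
    have vb: "\<bar>v S K k\<bar> \<le> 1 / 2 + V" for k by (rule abs_v_le[OF Sw])
    have B: "Bsq S K / 2 = (\<Sum>k<K. v S K k)" using Bsq_eq[OF TS(2)] by simp
    have eq: "s\<^sup>2 * Bsq S K / 2 = s\<^sup>2 * (\<Sum>k<K. v S K k)" unfolding B[symmetric] by simp
    have "- (s\<^sup>2 * Bsq S K / 2) = s\<^sup>2 * (\<Sum>k<K. - v S K k)" unfolding eq by (simp add: sum_negf)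
    also have "\<dots> \<le> s\<^sup>2 * (\<Sum>k<K. 1 / 2 + V)"
    proof (intro mult_left_mono sum_mono)
      fix k show "- v S K k \<le> 1 / 2 + V" using vb[of k] by linarith
    qed auto
    also have "\<dots> = M" by (simp add: M_def b_def)
    finally have BM: "- (s\<^sup>2 * Bsq S K / 2) \<le> M" .
    \<comment> \<open>The recursion yields increments with correlations truncated at distance
      \<open>L\<close>. Completing them costs \<open>C3 / 2 ^ l\<close> for each missing
      term.\<close>
    have s1: "(\<Sum>k<n. \<bar>v S K k - v S (k + L) k\<bar>) \<le> K * (K * (C3 / 2 ^ l))"
    proof -
      have "(\<Sum>k<n. \<bar>v S K k - v S (k + L) k\<bar>) \<le> (\<Sum>k<n. K * (C3 / 2 ^ l))"
      proof (rule sum_mono)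
        fix k assume "k \<in> {..<n}"
        then have k: "Suc k \<le> k + L" "k + L \<le> K" using nK Lg L1 by auto
        have "(\<Sum>j=Suc k..<K. c j * corr S k j) = (\<Sum>j=Suc k..<k+L. c j * corr S k j) + (\<Sum>j=k+L..<K. c j * corr S k j)"
          using k by (rule sum.atLeastLessThan_concat [symmetric])
        then have "v S K k - v S (k + L) k = c k * (\<Sum>j=k+L..<K. c j * corr S k j)"
          by (simp add: v_def algebra_simps)
        then have "\<bar>v S K k - v S (k + L) k\<bar> = \<bar>\<Sum>j=k+L..<K. c j * corr S k j\<bar>"
          by (simp add: abs_mult)
        also have "\<dots> \<le> (\<Sum>j=k+L..<K. \<bar>c j * corr S k j\<bar>)" by (rule sum_abs)
        also have "\<dots> \<le> (\<Sum>j=k+L..<K. C3 / 2 ^ l)"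
        proof (rule sum_mono)
          fix j assume j: "j \<in> {k+L..<K}"
          then have "g0 * l \<le> j - k" unfolding L(1)[symmetric] by auto
          then have "l \<le> (j - k) div g0" using g0(1) by (simp add: less_eq_div_iff_mult_less_eq mult.commute)
          moreover have "k < j" "\<kappa>\<^sup>2 \<le> S * w j" using j L1 T_earlier[OF Sw, of j] by auto
          ultimately have "\<bar>corr S k j\<bar> \<le> C3 / 2 ^ l" by (intro corr_decay)
          then show "\<bar>c j * corr S k j\<bar> \<le> C3 / 2 ^ l" by (simp add: abs_mult)
        qed
        also have "\<dots> = real (K - (k + L)) * (C3 / 2 ^ l)" by simp
        also have "\<dots> \<le> K * (C3 / 2 ^ l)" using C3_pos(4) by (intro mult_right_mono) auto
        finally show "\<bar>v S K k - v S (k + L) k\<bar> \<le> K * (C3 / 2 ^ l)" .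
      qed
      also have "\<dots> = n * (K * (C3 / 2 ^ l))" by simp
      also have "\<dots> \<le> K * (K * (C3 / 2 ^ l))"
        using nK C3_pos(4) by (intro mult_right_mono) auto
      finally show ?thesis .
    qed
    have s2: "(\<Sum>k=n..<K. \<bar>v S K k\<bar>) \<le> g * (1 / 2 + V)"
    proof -
      have "(\<Sum>k=n..<K. \<bar>v S K k\<bar>) \<le> (\<Sum>k=n..<K. 1 / 2 + V)" by (intro sum_mono vb)
      also have "\<dots> = real (K - n) * (1 / 2 + V)" by simp
      also have "K - n = g" using nK by simp
      finally show ?thesis .
    qed
    have "(\<Sum>k<K. v S K k) = (\<Sum>k<n. v S K k) + (\<Sum>k=n..<K. v S K k)"
      using nK by (simp add: lessThan_atLeast0 sum.atLeastLessThan_concat)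
    then have "(\<Sum>k<K. v S K k) - (\<Sum>k<n. v S (k + L) k)
       = (\<Sum>k<n. v S K k - v S (k + L) k) + (\<Sum>k=n..<K. v S K k)" by (simp add: sum_subtractf)
    then have "\<bar>(\<Sum>k<K. v S K k) - (\<Sum>k<n. v S (k + L) k)\<bar>
       \<le> (\<Sum>k<n. \<bar>v S K k - v S (k + L) k\<bar>) + (\<Sum>k=n..<K. \<bar>v S K k\<bar>)"
      using sum_abs[of "\<lambda>k. v S K k - v S (k + L) k" "{..<n}"] sum_abs[of "v S K" "{n..<K}"] by linarith
    with s1 s2 have s3: "\<bar>(\<Sum>k<K. v S K k) - (\<Sum>k<n. v S (k + L) k)\<bar> \<le> K * (K * (C3 / 2 ^ l)) + g * (1 / 2 + V)"
      by linarith
    have "(\<Sum>k<n. x k) - - (s\<^sup>2 * Bsq S K / 2) = s\<^sup>2 * ((\<Sum>k<K. v S K k) - (\<Sum>k<n. v S (k + L) k))"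
      unfolding eq x_def by (simp add: sum_negf right_diff_distrib flip: sum_distrib_left)
    then have "\<bar>(\<Sum>k<n. x k) - - (s\<^sup>2 * Bsq S K / 2)\<bar> = s\<^sup>2 * \<bar>(\<Sum>k<K. v S K k) - (\<Sum>k<n. v S (k + L) k)\<bar>"
      by (simp only: abs_mult abs_power2)
    also have "\<dots> \<le> s\<^sup>2 * (K * (K * (C3 / 2 ^ l)) + g * (1 / 2 + V))"
      using s3 by (rule mult_left_mono) simp
    finally have dif: "\<bar>(\<Sum>k<n. x k) - - (s\<^sup>2 * Bsq S K / 2)\<bar> \<le> s\<^sup>2 * (K * (K * (C3 / 2 ^ l)) + g * (1 / 2 + V))" .
    have "\<bar>exp (\<Sum>k<n. x k) - exp (- (s\<^sup>2 * Bsq S K / 2))\<bar> \<le> exp M * \<bar>(\<Sum>k<n. x k) - - (s\<^sup>2 * Bsq S K / 2)\<bar>"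
      by (rule abs_exp_diff_le[OF xM BM])
    also have "\<dots> \<le> exp M * (s\<^sup>2 * (K * (K * (C3 / 2 ^ l)) + g * (1 / 2 + V)))"
      using dif by (intro mult_left_mono) auto
    finally show ?thesis .
  qed
  have tri: "norm (p - r) \<le> \<epsilon>1 + \<epsilon>2 + \<epsilon>3" if "norm (p - q) \<le> \<epsilon>1" "norm (q - q') \<le> \<epsilon>2" "norm (q' - r) \<le> \<epsilon>3"
    for p q q' r :: complex and \<epsilon>1 \<epsilon>2 \<epsilon>3
    using that dist_triangle[of p r q] dist_triangle[of q r q'] unfolding dist_norm by linarith
  have p3': "norm (of_real (exp (\<Sum>k<n. x k)) - of_real (exp (- (s\<^sup>2 * Bsq S K / 2))) :: complex)
     \<le> exp M * (s\<^sup>2 * (K * (K * (C3 / 2 ^ l)) + g * (1 / 2 + V)))"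
    using p3 unfolding of_real_diff[symmetric] norm_of_real .
  from tri[OF p1' p2 p3'] show ?thesis unfolding M_def b_def e_def distrib_left[of "exp _"] .
qed

end

text \<open>Here \<open>r = sqrt K\<close>, \<open>q = 1 / 2 ^ l\<close>, and
  \<open>\<sigma> / r\<close> bounds \<open>\<bar>s\<bar>\<close>. The critical terms are cubic in
  \<open>s\<close>: \<open>K\<close> steps with error of order
  \<open>\<bar>s\<bar> ^ 3 * g\<^sup>2\<close> leave \<open>g\<^sup>2 / sqrt K\<close>. All other
  terms are brought to the same shape.\<close>

lemma clt_error_estimate:
  fixes r \<sigma> s g C V q :: real
  assumes r: "r \<ge> 1" and s: "\<bar>s\<bar> \<le> \<sigma> / r" "\<bar>s\<bar> \<le> 1" and q: "0 \<le> q" "q \<le> 1 / r ^ 4"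
    and g: "g \<ge> 0" and C: "C \<ge> 0" and V: "V \<ge> 0"
  shows "r\<^sup>2 * (\<bar>s\<bar> * (C * (1 + \<bar>s\<bar> * g) * q + (s * g)\<^sup>2 / 2 + V * (s\<^sup>2 * g)) + (1 + V)\<^sup>2 * s ^ 4)
           + \<bar>s\<bar> * g + s\<^sup>2 * (r\<^sup>2 * (r\<^sup>2 * (C * q)) + g * (1 / 2 + V))
       \<le> (\<sigma> * C + \<sigma> ^ 3 * (1 + V) + \<sigma> ^ 4 * (1 + V)\<^sup>2 + \<sigma> + \<sigma>\<^sup>2 * (C + 1 + V)) * ((1 + g)\<^sup>2 / r)"
proof -
  define a where "a = \<bar>s\<bar>"
  define G where "G = (1 + g)\<^sup>2"
  have a: "0 \<le> a" "a \<le> \<sigma> / r" "a \<le> 1" using s by (auto simp: a_def)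
  have s2: "s\<^sup>2 = a\<^sup>2" "s ^ 4 = a ^ 4" by (simp_all add: a_def power_even_abs)
  have \<sigma>: "\<sigma> \<ge> 0"
  proof -
    have "0 \<le> \<sigma> / r" using a by linarith
    then show ?thesis using r by (simp add: zero_le_divide_iff)
  qed
  have G: "1 \<le> G" "1 + g \<le> G" "g \<le> G" "g\<^sup>2 \<le> G" 
    unfolding G_def using g by (auto simp: power2_eq_square algebra_simps)
  have r2: "r\<^sup>2 * q \<le> 1" "r\<^sup>2 * (r\<^sup>2 * q) \<le> 1"
  proof -
    have "r ^ 4 * q \<le> 1" using q r by (simp add: field_simps)
    moreover have "r ^ 4 = r\<^sup>2 * r\<^sup>2" by (simp flip: power_add)
    ultimately show 1: "r\<^sup>2 * (r\<^sup>2 * q) \<le> 1" by (simp only: mult.assoc)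
    have "1 * (r\<^sup>2 * q) \<le> r\<^sup>2 * (r\<^sup>2 * q)" using r q by (intro mult_right_mono) (auto simp: one_le_power)
    with 1 show "r\<^sup>2 * q \<le> 1" by simp
  qed
  have rr: "1 / r\<^sup>2 \<le> 1 / r" using r by (simp add: field_simps power2_eq_square)
  have a2: "a\<^sup>2 \<le> \<sigma>\<^sup>2 / r"
  proof -
    have "a\<^sup>2 \<le> (\<sigma> / r)\<^sup>2" using a by (intro power_mono) auto
    also have "\<dots> = \<sigma>\<^sup>2 * (1 / r\<^sup>2)" by (simp add: power_divide)
    also have "\<dots> \<le> \<sigma>\<^sup>2 * (1 / r)" using rr by (intro mult_left_mono) auto
    finally show ?thesis by simp
  qed
  have a3: "r\<^sup>2 * a ^ 3 \<le> \<sigma> ^ 3 / r"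
  proof -
    have "r\<^sup>2 * a ^ 3 \<le> r\<^sup>2 * (\<sigma> / r) ^ 3" using a by (intro mult_left_mono power_mono) auto
    also have "\<dots> = \<sigma> ^ 3 / r" using r by (simp add: power_divide power2_eq_square power3_eq_cube)
    finally show ?thesis .
  qed
  have a4: "r\<^sup>2 * a ^ 4 \<le> \<sigma> ^ 4 / r"
  proof -
    have "r\<^sup>2 * a ^ 4 \<le> r\<^sup>2 * (\<sigma> / r) ^ 4" using a by (intro mult_left_mono power_mono) auto
    also have "\<dots> = \<sigma> ^ 4 * (1 / r\<^sup>2)" using r by (simp add: power_divide eval_nat_numeral)
    also have "\<dots> \<le> \<sigma> ^ 4 * (1 / r)" using rr by (intro mult_left_mono) auto
    finally show ?thesis by simp
  qed
  have t1: "(r\<^sup>2 * q) * (a * (C * (1 + a * g))) \<le> 1 * (\<sigma> / r * (C * G))"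
  proof (intro mult_mono r2 a)
    have "a * g \<le> 1 * g" using a g by (intro mult_right_mono) auto
    then show "1 + a * g \<le> G" using G by linarith
  qed (use r \<sigma> C a g q in auto)
  have t2: "(r\<^sup>2 * a ^ 3) * (g\<^sup>2 / 2 + V * g) \<le> (\<sigma> ^ 3 / r) * ((1 + V) * G)"
  proof (intro mult_mono a3)
    have "g\<^sup>2 / 2 \<le> G" using G zero_le_power2[of g] by linarith
    moreover have "V * g \<le> V * G" using V G by (intro mult_left_mono) auto
    ultimately show "g\<^sup>2 / 2 + V * g \<le> (1 + V) * G" by (simp add: algebra_simps)
  qed (use r \<sigma> V g in auto)
  have t3: "(r\<^sup>2 * a ^ 4) * ((1 + V)\<^sup>2 * 1) \<le> (\<sigma> ^ 4 / r) * ((1 + V)\<^sup>2 * G)"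
    using a4 G r \<sigma> a by (intro mult_mono) auto
  have t4: "a * g \<le> \<sigma> / r * G" using a G g \<sigma> r by (intro mult_mono) auto
  have t5: "a\<^sup>2 * ((r\<^sup>2 * (r\<^sup>2 * q)) * C + g * (1 / 2 + V)) \<le> \<sigma>\<^sup>2 / r * ((C + 1 + V) * G)"
  proof (intro mult_mono a2)
    have "(r\<^sup>2 * (r\<^sup>2 * q)) * C \<le> 1 * C" using r2 C by (intro mult_right_mono) auto
    moreover have "C * 1 \<le> C * G" using C G by (intro mult_left_mono) auto
    moreover have "g * (1 / 2 + V) \<le> G * (1 + V)" using G V g by (intro mult_mono) auto
    ultimately show "(r\<^sup>2 * (r\<^sup>2 * q)) * C + g * (1 / 2 + V) \<le> (C + 1 + V) * G" by (simp add: algebra_simps)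
  qed (use r \<sigma> C V g q in auto)
  have "r\<^sup>2 * (\<bar>s\<bar> * (C * (1 + \<bar>s\<bar> * g) * q + (s * g)\<^sup>2 / 2 + V * (s\<^sup>2 * g)) + (1 + V)\<^sup>2 * s ^ 4)
           + \<bar>s\<bar> * g + s\<^sup>2 * (r\<^sup>2 * (r\<^sup>2 * (C * q)) + g * (1 / 2 + V))
     = (r\<^sup>2 * q) * (a * (C * (1 + a * g))) + (r\<^sup>2 * a ^ 3) * (g\<^sup>2 / 2 + V * g) + (r\<^sup>2 * a ^ 4) * ((1 + V)\<^sup>2 * 1)
       + a * g + a\<^sup>2 * ((r\<^sup>2 * (r\<^sup>2 * q)) * C + g * (1 / 2 + V))"
    unfolding a_def[symmetric] power_mult_distrib s2 by (simp add: algebra_simps power2_eq_square power3_eq_cube)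
  also have "\<dots> \<le> 1 * (\<sigma> / r * (C * G)) + (\<sigma> ^ 3 / r) * ((1 + V) * G) + (\<sigma> ^ 4 / r) * ((1 + V)\<^sup>2 * G)
     + \<sigma> / r * G + \<sigma>\<^sup>2 / r * ((C + 1 + V) * G)"
    by (intro add_mono t1 t2 t3 t4 t5)
  also have "\<dots> = (\<sigma> * C + \<sigma> ^ 3 * (1 + V) + \<sigma> ^ 4 * (1 + V)\<^sup>2 + \<sigma> + \<sigma>\<^sup>2 * (C + 1 + V)) * (G / r)"
    using r by (simp add: field_simps)
  finally show ?thesis unfolding G_def .
qed

context signed_waves
begin

text \<open>The scales depend on \<open>K\<close>: \<open>lev K\<close> exceeds
  \<open>2 * log 2 K\<close>, so that \<open>1 / 2 ^ lev K\<close> is at most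
  \<open>1 / K\<^sup>2\<close>, and \<open>g K\<close> is then logarithmic. \<open>S K\<close> is
  long enough for the variance bound and for every \<open>T\<close> with
  \<open>T * w K \<le> 1\<close>; hence the convergence is uniform in \<open>T\<close>.\<close>

lemma wave_clt:
  assumes \<gamma>: "\<gamma> > 0" and var: "\<And>K. K \<ge> 1 \<Longrightarrow> \<forall>\<^sub>F S in at_top. \<gamma> * K \<le> Bsq S K"
  shows "\<exists>B :: nat \<Rightarrow> real. (\<forall>K\<ge>1. B K > 0 \<and> \<gamma> * K \<le> (B K)\<^sup>2 \<and> (B K)\<^sup>2 \<le> (1 + 2 * V) * K) \<and>
     (\<forall>t. \<forall>\<epsilon>>0. \<exists>N. \<forall>K\<ge>N. \<forall>T. \<kappa>\<^sup>2 \<le> T * w K \<longrightarrow> T * w K \<le> 1 \<longrightarrow>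
        norm (avg T (\<lambda>u. cis (t / B K * Z 0 K u)) - of_real (exp (- (t\<^sup>2 / 2)))) < \<epsilon>)"
proof -
  obtain d where "D < 2 ^ d" using real_arch_pow[of 2 D] by auto
  then have d: "D \<le> 2 ^ Suc d" using D_ge_1 by simp
  define lev where "lev K = Suc (nat \<lceil>2 * log 2 (real K)\<rceil>)" for K :: nat
  define h where "h K = Suc d * (g0 * lev K)" for K
  define g where "g K = g0 * h K" for K
  have "\<exists>S. \<gamma> * K \<le> Bsq S K \<and> 2 ^ h K / w K \<le> S" if K: "K \<ge> 1" for K
  proof -
    obtain S0 where "\<And>S. S \<ge> S0 \<Longrightarrow> \<gamma> * K \<le> Bsq S K"
      using var[OF K] unfolding eventually_at_top_linorder by blast
    then show ?thesis by (intro exI[of _ "max S0 (2 ^ h K / w K)"]) auto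
  qed
  then obtain S where S: "\<And>K. K \<ge> 1 \<Longrightarrow> \<gamma> * K \<le> Bsq (S K) K" "\<And>K. K \<ge> 1 \<Longrightarrow> 2 ^ h K / w K \<le> S K"
    by metis
  have S0: "S K > 0" if "K \<ge> 1" for K
    using S(2)[OF that] w_pos[of K] by (meson divide_pos_pos less_le_trans zero_less_numeral zero_less_power)
  define B where "B K = sqrt (Bsq (S K) K)" for K
  have Bpos: "Bsq (S K) K > 0" if "K \<ge> 1" for K
  proof -
    have "\<gamma> * K > 0" using \<gamma> that by simp
    with S(1)[OF that] show ?thesis by linarith
  qed
  have B2: "(B K)\<^sup>2 = Bsq (S K) K" if "K \<ge> 1" for K
    using Bpos[OF that] by (simp add: B_def)
  have Sw: "\<kappa>\<^sup>2 \<le> S K * w K" if "K \<ge> 1" for K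
  proof -
    have "\<kappa>\<^sup>2 \<le> 1" using \<kappa> by (simp add: power_le_one)
    also have "(1::real) \<le> 2 ^ h K" by simp
    also have "\<dots> \<le> S K * w K" using S(2)[OF that] w_pos[of K] by (simp add: field_simps)
    finally show ?thesis .
  qed
  have upper: "Bsq (S K) K \<le> (1 + 2 * V) * K" if K: "K \<ge> 1" for K
  proof -
    have "(\<Sum>k<K. v (S K) K k) \<le> (\<Sum>k<K. 1 / 2 + V)"
    proof (rule sum_mono)
      fix k show "v (S K) K k \<le> 1 / 2 + V" using abs_v_le[OF Sw[OF K], of k] by linarith
    qed
    then show ?thesis using Bsq_eq[OF S0[OF K], of K] by (simp add: algebra_simps)
  qed
  have conv: "\<exists>N. \<forall>K\<ge>N. \<forall>T. \<kappa>\<^sup>2 \<le> T * w K \<longrightarrow> T * w K \<le> 1 \<longrightarrow>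
        norm (avg T (\<lambda>u. cis (t / B K * Z 0 K u)) - of_real (exp (- (t\<^sup>2 / 2)))) < \<epsilon>" if \<epsilon>: "\<epsilon> > 0" for t \<epsilon>
  proof -
    define \<sigma> where "\<sigma> = \<bar>t\<bar> / sqrt \<gamma>"
    define A where "A = exp (\<sigma>\<^sup>2 * (1 / 2 + V))"
    define M where "M = A * (\<sigma> * C3 + \<sigma> ^ 3 * (1 + V) + \<sigma> ^ 4 * (1 + V)\<^sup>2 + \<sigma> + \<sigma>\<^sup>2 * (C3 + 1 + V))"
    have \<sigma>0: "\<sigma> \<ge> 0" by (simp add: \<sigma>_def \<gamma> less_imp_le)
    have V0: "V \<ge> 0" by (rule V_nonneg)
    define f where "f K = (1 + real (g K))\<^sup>2 / sqrt (real K)" for K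
    have f0: "f \<longlonglongrightarrow> 0"
    proof -
      define b where "b = real (g0 * Suc d * g0)"
      have "g0 * Suc d * g0 > 0" using g0(1) by simp
      then have "b > 0" unfolding b_def of_nat_0_less_iff .
      then have "((\<lambda>x::real. (1 + b * (2 * log 2 x + 2))\<^sup>2 / sqrt x) \<longlongrightarrow> 0) at_top"
        by real_asymp
      then have lim: "(\<lambda>K::nat. (1 + b * (2 * log 2 (real K) + 2))\<^sup>2 / sqrt (real K)) \<longlonglongrightarrow> 0"
        by (rule filterlim_compose[OF _ filterlim_real_sequentially])
      have le: "\<forall>\<^sub>F K in sequentially. f K \<le> (1 + b * (2 * log 2 (real K) + 2))\<^sup>2 / sqrt (real K)"
        using eventually_ge_at_top[of 1]
      proof eventually_elim
        case (elim K)
        have "log 2 (real K) \<ge> 0" using elim by simp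
        then have "real (lev K) \<le> 2 * log 2 (real K) + 2" unfolding lev_def by linarith
        then have "real (g K) \<le> b * (2 * log 2 (real K) + 2)"
        proof -
          have "real (g K) = b * real (lev K)" unfolding g_def h_def b_def of_nat_mult by (simp only: mult_ac)
          then show ?thesis using \<open>real (lev K) \<le> _\<close> \<open>b > 0\<close> by (simp only: mult_left_mono less_imp_le)
        qed
        then show ?case unfolding f_def by (intro divide_right_mono power_mono add_left_mono) auto
      qed
      have "\<forall>\<^sub>F K in sequentially. 0 \<le> f K" by (simp add: f_def)
      from tendsto_sandwich[OF this le tendsto_const lim] show ?thesis .
    qed
    have "\<forall>\<^sub>F K in sequentially. M * f K < \<epsilon>"
      by (rule order_tendstoD(2)[OF tendsto_mult_right_zero[OF f0] \<epsilon>])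
    moreover have "\<forall>\<^sub>F K in sequentially. f K < 1" using f0 by (rule order_tendstoD(2)) simp
    moreover have "(\<lambda>K. \<sigma> / sqrt (real K)) \<longlonglongrightarrow> 0"
      by (intro tendsto_divide_0[OF tendsto_const] filterlim_at_top_imp_at_infinity
          filterlim_compose[OF sqrt_at_top filterlim_real_sequentially])
    then have "\<forall>\<^sub>F K in sequentially. \<sigma> / sqrt (real K) < 1 / (1 + V)"
      by (rule order_tendstoD(2)) (use V0 in simp)
    ultimately have "\<forall>\<^sub>F K in sequentially. M * f K < \<epsilon> \<and> f K < 1 \<and> \<sigma> / sqrt (real K) < 1 / (1 + V) \<and> K \<ge> 1"
      using eventually_ge_at_top[of 1] by eventually_elim auto
    then obtain N where N: "\<And>K. K \<ge> N \<Longrightarrow> M * f K < \<epsilon> \<and> f K < 1 \<and> \<sigma> / sqrt (real K) < 1 / (1 + V) \<and> K \<ge> 1"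
      unfolding eventually_sequentially by blast
    show ?thesis
    proof (intro exI[of _ N] allI impI)
      fix K T assume "K \<ge> N" and T: "\<kappa>\<^sup>2 \<le> T * w K" "T * w K \<le> 1"
      with N have K: "M * f K < \<epsilon>" "f K < 1" "\<sigma> / sqrt (real K) < 1 / (1 + V)" "K \<ge> 1" by auto
      define r where "r = sqrt (real K)"
      define s where "s = t / B K"
      have r: "r \<ge> 1" "r\<^sup>2 = real K" using K(4) by (auto simp: r_def)
      have BK: "B K > 0" "sqrt \<gamma> * r \<le> B K"
        unfolding B_def r_def using Bpos[OF K(4)] S(1)[OF K(4)] by (auto simp flip: real_sqrt_mult)
      have s\<sigma>: "\<bar>s\<bar> \<le> \<sigma> / r"
      proof -
        have "\<bar>s\<bar> = \<bar>t\<bar> / B K" using BK by (simp add: s_def abs_divide)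
        also have "\<dots> \<le> \<bar>t\<bar> / (sqrt \<gamma> * r)" using BK \<gamma> r by (intro divide_left_mono) auto
        finally show ?thesis by (simp add: \<sigma>_def)
      qed
      have "1 / (1 + V) \<le> 1" using V0 by simp
      then have s1: "\<bar>s\<bar> < 1 / (1 + V)" "\<bar>s\<bar> \<le> 1" using s\<sigma> K(3) unfolding r_def by linarith+
      have s2: "s\<^sup>2 * (1 / 2 + V) \<le> 1"
      proof -
        have "s\<^sup>2 = \<bar>s\<bar> * \<bar>s\<bar>" by (simp add: power2_eq_square flip: abs_mult)
        also have "\<dots> \<le> 1 / (1 + V) * 1" using s1 V0 by (intro mult_mono) auto
        finally have "s\<^sup>2 * (1 / 2 + V) \<le> 1 / (1 + V) * (1 + V)" using V0 by (intro mult_mono) auto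
        then show ?thesis using V0 by simp
      qed
      have gK: "g K \<le> K"
      proof -
        have "(1 + real (g K))\<^sup>2 < r" using K(2) r unfolding f_def r_def[symmetric] by simp
        moreover have "r \<le> r\<^sup>2" using r(1) by (simp add: power2_eq_square)
        moreover have "1 + real (g K) \<le> (1 + real (g K))\<^sup>2" by (simp add: power2_eq_square)
        ultimately have "real (g K) \<le> real K" using r(2) by linarith
        then show ?thesis by simp
      qed
      have T0: "T > 0" by (rule T_pos[OF T(1)])
      have TS: "2 ^ h K * T \<le> S K"
      proof -
        have "T \<le> 1 / w K" using T(2) w_pos[of K] by (simp add: field_simps)
        then have "2 ^ h K * T \<le> 2 ^ h K * (1 / w K)" by (intro mult_left_mono) auto
        then show ?thesis using S(2)[OF K(4)] by simp
      qed
      have lev: "1 / 2 ^ lev K \<le> 1 / r ^ 4"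
      proof -
        have "2 * log 2 (real K) \<le> lev K" unfolding lev_def by linarith
        then have "2 powr (2 * log 2 (real K)) \<le> 2 powr real (lev K)" by simp
        also have "2 powr (2 * log 2 (real K)) = (2 powr log 2 (real K))\<^sup>2"
          by (simp only: power2_eq_square powr_add[symmetric] mult_2)
        also have "2 powr log 2 (real K) = r\<^sup>2" using K(4) r(2) by simp
        also have "2 powr real (lev K) = 2 ^ lev K" by (rule powr_realpow) simp
        finally have "r ^ 4 \<le> 2 ^ lev K" by (simp flip: power_mult)
        then show ?thesis using r by (intro divide_left_mono) auto
      qed
      have sB: "s\<^sup>2 * Bsq (S K) K / 2 = t\<^sup>2 / 2"
      proof -
        have "s\<^sup>2 * (B K)\<^sup>2 = t\<^sup>2" using BK(1) by (simp add: s_def power_divide)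
        then show ?thesis unfolding B2[OF K(4)] by simp
      qed
      have "norm (\<phi> T s K 0 - of_real (exp (- (s\<^sup>2 * Bsq (S K) K / 2))))
         \<le> exp (K * (s\<^sup>2 * (1 / 2 + V))) *
         (K * (\<bar>s\<bar> * (C3 * (1 + \<bar>s\<bar> * g K) / 2 ^ lev K + (s * g K)\<^sup>2 / 2 + V * (s\<^sup>2 * g K)) + (1 + V)\<^sup>2 * s ^ 4)
          + \<bar>s\<bar> * g K + s\<^sup>2 * (K * (K * (C3 / 2 ^ lev K)) + g K * (1 / 2 + V)))"
        by (rule clt_bound[OF T(1) gK s1(2) s2 refl h_def g_def _ _ d TS]) (auto simp: lev_def)
      also have "\<dots> \<le> A * ((\<sigma> * C3 + \<sigma> ^ 3 * (1 + V) + \<sigma> ^ 4 * (1 + V)\<^sup>2 + \<sigma> + \<sigma>\<^sup>2 * (C3 + 1 + V)) * ((1 + real (g K))\<^sup>2 / r))"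
      proof (intro mult_mono)
        have "s\<^sup>2 \<le> (\<sigma> / r)\<^sup>2" using s\<sigma> \<sigma>0 r by (intro abs_le_square_iff[THEN iffD1]) simp
        then have "K * s\<^sup>2 \<le> \<sigma>\<^sup>2" using r K(4) by (simp add: power_divide field_simps)
        then have "K * s\<^sup>2 * (1 / 2 + V) \<le> \<sigma>\<^sup>2 * (1 / 2 + V)" using V0 by (intro mult_right_mono) auto
        then show "exp (K * (s\<^sup>2 * (1 / 2 + V))) \<le> A" unfolding A_def by (simp add: mult.assoc)
        show "K * (\<bar>s\<bar> * (C3 * (1 + \<bar>s\<bar> * g K) / 2 ^ lev K + (s * g K)\<^sup>2 / 2 + V * (s\<^sup>2 * g K)) + (1 + V)\<^sup>2 * s ^ 4)
          + \<bar>s\<bar> * g K + s\<^sup>2 * (K * (K * (C3 / 2 ^ lev K)) + g K * (1 / 2 + V)) 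
          \<le> (\<sigma> * C3 + \<sigma> ^ 3 * (1 + V) + \<sigma> ^ 4 * (1 + V)\<^sup>2 + \<sigma> + \<sigma>\<^sup>2 * (C3 + 1 + V)) * ((1 + real (g K))\<^sup>2 / r)"
          using clt_error_estimate[OF r(1) s\<sigma> s1(2) _ lev, of "real (g K)" C3 V] C3_pos(4) V0
          unfolding r(2) by simp
      qed (use C3_pos(4) V0 in \<open>auto simp: A_def intro!: add_nonneg_nonneg mult_nonneg_nonneg\<close>)
      also have "\<dots> = M * f K" by (simp add: M_def f_def r_def)
      finally have "norm (\<phi> T s K 0 - of_real (exp (- (t\<^sup>2 / 2)))) \<le> M * f K" unfolding sB .
      then show "norm (avg T (\<lambda>u. cis (t / B K * Z 0 K u)) - of_real (exp (- (t\<^sup>2 / 2)))) < \<epsilon>"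
        using K(1) unfolding \<phi>_def E_def s_def by simp
    qed
  qed
  have "\<forall>K\<ge>1. B K > 0 \<and> \<gamma> * K \<le> (B K)\<^sup>2 \<and> (B K)\<^sup>2 \<le> (1 + 2 * V) * K"
    using B2 S(1) upper Bpos by (auto simp: B_def)
  then show ?thesis
    by (intro exI[of _ B] conjI) (assumption, intro allI impI, rule conv)
qed

end

section \<open>Fourier coefficients of waves\<close>

lemma Re_avg:
  assumes "tame f"
  shows "Re (avg T f) = integral {0..T} (\<lambda>u. Re (f u)) / T"
  using integral_linear[OF tame_integrable[OF assms] bounded_linear_Re, of 0 T]
  by (simp add: avg_def o_def)

lemma tame_cis_linear: "tame (\<lambda>u. cis (z * u))"
proof (rule tame_I [where B = 1])
  show "(\<lambda>u. cis (z * u)) \<in> borel_measurable borel" unfolding cis_conv_exp by measurable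
qed auto

lemma tame_cis_linear_neg: "tame (\<lambda>u. cis (- (z * u)))"
  using tame_cis_linear[of "- z"] by simp

text \<open>Shifting by the period multiplies the integrand by
  \<open>cis (\<zeta> * p) \<noteq> 1\<close> but changes the integral by end pieces only, so the
  integral stays bounded.\<close>

lemma avg_periodic_nonresonant:
  assumes f: "tame f" "\<And>u. f (u + p) = f u" and "p > 0" "cis (\<zeta> * p) \<noteq> 1"
  shows "((\<lambda>T. avg T (\<lambda>u. f u * cis (\<zeta> * u))) \<longlongrightarrow> 0) at_top"
proof -
  obtain B where B: "\<And>u. norm (f u) \<le> B" using f(1) by (auto simp: tame_def bounded_iff)
  define g where "g u = f u * cis (\<zeta> * u)" for u
  have g: "tame g" "norm (g u) \<le> B" for u
    unfolding g_def [abs_def] using B[of u] f by (auto intro!: tame_mult tame_cis_linear simp: norm_mult)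
  have gp: "g (u + p) = cis (\<zeta> * p) * g u" for u
    using f(2)[of u] by (simp add: g_def distrib_left cis_mult[symmetric] mult_ac)
  define \<delta> where "\<delta> = norm (cis (\<zeta> * p) - 1)"
  have \<delta>: "\<delta> > 0" using assms(4) by (simp add: \<delta>_def)
  have bound: "norm (avg T g) \<le> (2 * B * p / \<delta>) / T" if T: "T > 0" for T
  proof -
    have "(cis (\<zeta> * p) - 1) * integral {0..T} g = integral {0..T} (\<lambda>u. g (u + p)) - integral {0..T} g"
      by (simp add: gp left_diff_distrib)
    also have "integral {0..T} (\<lambda>u. g (u + p)) = integral {0+p..T+p} g" by (rule integral_shift)
    also have "\<dots> - integral {0..T} g = integral {T..T+p} g - integral {0..0+p} g"
      using tame_integral_combine[OF g(1), of 0 p "T+p"] tame_integral_combine[OF g(1), of 0 T "T+p"] T assms(3)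
      by (simp add: algebra_simps)
    finally have "\<delta> * norm (integral {0..T} g) = norm (integral {T..T+p} g - integral {0..0+p} g)"
      unfolding \<delta>_def norm_mult[symmetric] by simp
    also have "\<dots> \<le> B * p + B * p"
      using norm_triangle_ineq4 norm_integral_le[OF g, of p T] norm_integral_le[OF g, of p 0] assms(3)
      by (smt (verit))
    finally have "norm (integral {0..T} g) \<le> 2 * B * p / \<delta>" using \<delta> by (simp add: field_simps)
    then have "norm (integral {0..T} g) / T \<le> 2 * B * p / \<delta> / T" using T by (intro divide_right_mono) auto
    then show ?thesis using T by (simp add: avg_def norm_divide)
  qed
  have "((\<lambda>T. avg T g) \<longlongrightarrow> 0) at_top"
  proof (rule Lim_null_comparison)
    show "\<forall>\<^sub>F T in at_top. norm (avg T g) \<le> (2 * B * p / \<delta>) / T"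
      using eventually_gt_at_top[of 0] by eventually_elim (rule bound)
    show "((\<lambda>T. (2 * B * p / \<delta>) / T) \<longlongrightarrow> 0) at_top"
      by (intro tendsto_divide_0[OF tendsto_const] filterlim_at_top_imp_at_infinity filterlim_ident)
  qed
  then show ?thesis unfolding g_def .
qed

lemma avg_cis_nonzero:
  assumes "\<zeta> \<noteq> 0"
  shows "((\<lambda>T. avg T (\<lambda>u. cis (\<zeta> * u))) \<longlongrightarrow> 0) at_top"
proof -
  have "\<zeta> * (pi / \<bar>\<zeta>\<bar>) = pi \<or> \<zeta> * (pi / \<bar>\<zeta>\<bar>) = - pi" using assms by (auto simp: abs_if)
  then have "cis (\<zeta> * (pi / \<bar>\<zeta>\<bar>)) \<noteq> 1" by (auto simp: complex_eq_iff)
  then show ?thesis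
    using avg_periodic_nonresonant[of "\<lambda>_. 1" "pi / \<bar>\<zeta>\<bar>" \<zeta>] assms by (simp add: tame_const)
qed

lemma avg_const: "T > 0 \<Longrightarrow> avg T (\<lambda>_. a) = a"
  by (simp add: avg_def scaleR_conv_of_real)

lemma avg_periodic:
  assumes f: "tame f" "\<And>u. f (u + p) = f u" and p: "p > 0"
  shows "((\<lambda>T. avg T f) \<longlongrightarrow> integral {0..p} f / of_real p) at_top"
proof -
  obtain B where B: "\<And>u. norm (f u) \<le> B" using f(1) by (auto simp: tame_def bounded_iff)
  have B0: "B \<ge> 0" using order_trans[OF norm_ge_zero B] .
  define I where "I = integral {0..p} f"
  have shift: "f (u + real n * p) = f u" for u n
  proof (induction n)
    case (Suc n)
    have "f (u + real (Suc n) * p) = f ((u + real n * p) + p)" by (simp add: algebra_simps)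
    with Suc f(2) show ?case by simp
  qed simp
  have blocks: "integral {0..real n * p} f = of_nat n * I" for n
  proof (induction n)
    case (Suc n)
    have "integral {0..real (Suc n) * p} f = integral {0..real n * p} f + integral {real n * p..real (Suc n) * p} f"
      using p by (intro tame_integral_combine f) auto
    also have "integral {real n * p..real (Suc n) * p} f = integral {0..p} (\<lambda>u. f (u + real n * p))"
      unfolding integral_shift by (simp add: algebra_simps)
    also have "\<dots> = I" by (simp add: shift I_def)
    finally show ?case using Suc by (simp add: algebra_simps)
  qed simp
  have I: "norm I \<le> B * p" unfolding I_def using norm_integral_le[OF f(1) B, of p 0] p by simp
  have bound: "norm (avg T f - I / of_real p) \<le> (2 * B * p) / T" if T: "T > 0" for T
  proof -
    define n where "n = nat \<lfloor>T / p\<rfloor>"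
    define r where "r = T - real n * p"
    have n: "real n \<le> T / p" "T / p < real n + 1" unfolding n_def using T p by auto
    have r: "0 \<le> r" "r \<le> p" unfolding r_def using n p by (auto simp: field_simps)
    define J where "J = integral {real n * p..real n * p + r} f"
    have "integral {0..T} f = integral {0..real n * p} f + J"
      unfolding J_def using r p tame_integral_combine[OF f(1), of 0 "real n * p" T] by (simp add: r_def)
    then have "integral {0..T} f = of_nat n * I + J" unfolding blocks .
    moreover have "of_real T * (I / of_real p) = of_nat n * I + of_real r * (I / of_real p)"
      using p by (simp add: r_def field_simps)
    ultimately have "integral {0..T} f - of_real T * (I / of_real p) = J - of_real r * (I / of_real p)"
      by simp
    also have "norm \<dots> \<le> norm J + norm (of_real r * (I / of_real p))"
      by (rule norm_triangle_ineq4)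
    also have "\<dots> \<le> B * p + p * B"
    proof (rule add_mono)
      have "norm J \<le> B * r" unfolding J_def by (rule norm_integral_le[OF f(1) B r(1)])
      also have "\<dots> \<le> B * p" using r B0 by (intro mult_left_mono)
      finally show "norm J \<le> B * p" .
      have "norm (of_real r * (I / of_real p)) = r * (norm I / p)" using r p by (simp add: norm_mult norm_divide)
      also have "\<dots> \<le> p * B" using r I p B0 by (intro mult_mono) (auto simp: field_simps)
      finally show "norm (of_real r * (I / of_real p)) \<le> p * B" .
    qed
    finally have "norm (integral {0..T} f - of_real T * (I / of_real p)) \<le> 2 * B * p" by simp
    moreover have "avg T f - I / of_real p = (integral {0..T} f - of_real T * (I / of_real p)) / of_real T"
      using T by (simp add: avg_def diff_divide_distrib)
    ultimately show ?thesis using T by (simp add: norm_divide divide_right_mono)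
  qed
  have "((\<lambda>T. avg T f - I / of_real p) \<longlongrightarrow> 0) at_top"
  proof (rule Lim_null_comparison)
    show "\<forall>\<^sub>F T in at_top. norm (avg T f - I / of_real p) \<le> (2 * B * p) / T"
      using eventually_gt_at_top[of 0] by eventually_elim (rule bound)
    show "((\<lambda>T. (2 * B * p) / T) \<longlongrightarrow> 0) at_top"
      by (intro tendsto_divide_0[OF tendsto_const] filterlim_at_top_imp_at_infinity filterlim_ident)
  qed
  then show ?thesis unfolding I_def by (rule LIM_zero_cancel)
qed

section \<open>Resonant coefficients and Bessel's identity\<close>

lemma cis_pi_odd:
  assumes "odd (b :: int)"
  shows "cis (- (pi * of_int b)) = -1"
proof -
  obtain k where "b = 2 * k + 1" using assms by (rule oddE)
  then have "- (pi * of_int b) = - pi + of_int (- k) * (2 * pi)" by (simp add: algebra_simps)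
  then have "cis (- (pi * of_int b)) = cis (- pi) * cis (of_int (-k) * (2 * pi))" by (simp only: cis_mult)
  also have "cis (of_int (-k) * (2 * pi)) = 1" 
    using cis_multiple_2pi[of "of_int (-k)"] by (simp add: mult.commute)
  finally show ?thesis by (simp add: complex_eq_iff)
qed

text \<open>The Fourier coefficient of the 2-periodic square wave at frequency \<open>pi * n\<close>
  for odd \<open>n\<close>. The true coefficient at even \<open>n\<close> is 0, so the formula is
  meant for odd indices.\<close>

definition wave_coeff :: "int \<Rightarrow> complex" where
  "wave_coeff n = 2 / (\<i> * of_real (pi * of_int n))"

lemma integral_cis:
  assumes "\<zeta> \<noteq> 0" "0 \<le> p"
  shows "integral {0..p} (\<lambda>u. cis (\<zeta> * u)) = (cis (\<zeta> * p) - 1) / (\<i> * of_real \<zeta>)"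
proof -
  have "((\<lambda>u. cis (\<zeta> * u)) has_integral (cis (\<zeta> * p) / (\<i> * of_real \<zeta>) - cis (\<zeta> * 0) / (\<i> * of_real \<zeta>))) {0..p}"
  proof (rule fundamental_theorem_of_calculus[OF assms(2)])
    fix u :: real
    have "((\<lambda>z. exp (\<i> * of_real \<zeta> * z) / (\<i> * of_real \<zeta>)) has_field_derivative exp (\<i> * of_real \<zeta> * of_real u)) (at (of_real u))"
      using assms(1) by (auto intro!: derivative_eq_intros)
    from has_vector_derivative_real_field[OF this, of "{0..p}"]
    show "((\<lambda>u. cis (\<zeta> * u) / (\<i> * of_real \<zeta>)) has_vector_derivative cis (\<zeta> * u)) (at u within {0..p})"
      by (simp add: cis_conv_exp mult.assoc)
  qed
  then show ?thesis by (simp add: integral_unique diff_divide_distrib)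
qed

lemma avg_wave_resonant:
  assumes "\<omega> > 0" "odd n"
  shows "((\<lambda>T. avg T (\<lambda>u. of_real (square_wave (\<omega> * u)) * cis (- (pi * of_int n * \<omega>) * u))) \<longlongrightarrow> wave_coeff n) at_top"
proof -
  define f where "f u = of_real (square_wave (\<omega> * u)) * cis (- (pi * of_int n * \<omega>) * u)" for u
  define p where "p = 1 / \<omega>"
  define \<zeta> where "\<zeta> = - (pi * of_int n * \<omega>)"
  have n0: "n \<noteq> 0" using assms(2) by auto
  have p: "p > 0" "\<omega> * p = 1" using assms by (auto simp: p_def)
  have \<zeta>p: "\<zeta> * p = - (pi * of_int n)" using assms by (simp add: \<zeta>_def p_def)
  have f: "tame f" unfolding f_def [abs_def] by (intro tame_mult tame_of_real tame_square_wave tame_cis_linear)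
  \<comment> \<open>Half a period of the wave is already a period of the product: both factors
    change sign, the exponential because \<open>n\<close> is odd.\<close>
  have per: "f (u + p) = f u" for u
  proof -
    have "square_wave (\<omega> * (u + p)) = - square_wave (\<omega> * u)"
      using p by (simp add: distrib_left square_wave_def)
    moreover have "cis (\<zeta> * (u + p)) = cis (\<zeta> * u) * cis (- (pi * of_int n))"
      by (simp add: distrib_left \<zeta>p cis_mult)
    ultimately show ?thesis unfolding f_def \<zeta>_def[symmetric] by (simp add: cis_pi_odd[OF assms(2)])
  qed
  have "integral {0..p} f = integral {0..p} (\<lambda>u. cis (\<zeta> * u))"
  proof (rule integral_spike[of "{p}"])
    fix u assume "u \<in> {0..p} - {p}"
    then have "0 \<le> \<omega> * u" "\<omega> * u < 1" using p assms by (auto simp: p_def field_simps)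
    then have "\<lfloor>\<omega> * u\<rfloor> = 0" by (simp add: floor_eq_iff)
    then show "cis (\<zeta> * u) = f u" by (simp add: f_def \<zeta>_def square_wave_def)
  qed auto
  also have "\<dots> = (cis (\<zeta> * p) - 1) / (\<i> * of_real \<zeta>)"
    using n0 assms p by (intro integral_cis) (auto simp: \<zeta>_def)
  also have "cis (\<zeta> * p) = -1" unfolding \<zeta>p by (rule cis_pi_odd[OF assms(2)])
  also have "(- 1 - 1) / (\<i> * of_real \<zeta>) = of_real p * wave_coeff n"
    using n0 assms by (simp add: \<zeta>_def p_def wave_coeff_def)
  finally have "integral {0..p} f / of_real p = wave_coeff n" using p by simp
  then show ?thesis using avg_periodic[OF f per p(1)] unfolding f_def by simp
qed

text \<open>Distinct frequencies are orthogonal in the mean, so with \<open>s\<close> the sum of the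
  squared coefficients the polynomial contributes \<open>s\<close> and the cross terms
  \<open>- 2 * s\<close>. Stating a limit for the difference of two mean squares presupposes no
  limit of the mean square of \<open>f\<close>.\<close>

lemma bessel_mean:
  fixes f :: "real \<Rightarrow> complex" and \<xi> :: "'i \<Rightarrow> real" and c :: "'i \<Rightarrow> complex"
  assumes f: "tame f" and I: "finite I" "inj_on \<xi> I"
    and c: "\<And>i. i \<in> I \<Longrightarrow> ((\<lambda>T. avg T (\<lambda>u. f u * cis (- \<xi> i * u))) \<longlongrightarrow> c i) at_top"
  shows "((\<lambda>T. integral {0..T} (\<lambda>u. (cmod (f u - (\<Sum>i\<in>I. c i * cis (\<xi> i * u))))\<^sup>2) / T
            - integral {0..T} (\<lambda>u. (cmod (f u))\<^sup>2) / T) \<longlongrightarrow> - (\<Sum>i\<in>I. (cmod (c i))\<^sup>2)) at_top"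
proof -
  define p where "p u = (\<Sum>i\<in>I. c i * cis (\<xi> i * u))" for u
  define q where "q u = (\<Sum>i\<in>I. cnj (c i) * cis (- \<xi> i * u))" for u
  define s where "s = (\<Sum>i\<in>I. (cmod (c i))\<^sup>2)"
  have pq: "cnj (p u) = q u" for u by (simp add: p_def q_def cis_cnj)
  have tp: "tame p" "tame q" unfolding p_def [abs_def] q_def [abs_def]
    by (intro tame_sum tame_mult tame_const tame_cis_linear)+
  have fq: "((\<lambda>T. avg T (\<lambda>u. f u * q u)) \<longlongrightarrow> of_real s) at_top"
  proof -
    have "avg T (\<lambda>u. f u * q u) = (\<Sum>i\<in>I. cnj (c i) * avg T (\<lambda>u. f u * cis (- \<xi> i * u)))" for T
    proof -
      have "(\<lambda>u. f u * q u) = (\<lambda>u. \<Sum>i\<in>I. cnj (c i) * (f u * cis (- \<xi> i * u)))"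
        by (simp add: q_def sum_distrib_left mult_ac)
      then show ?thesis
        by (simp only:) (subst avg_sum; auto intro!: tame_mult tame_const tame_cis_linear_neg f simp: avg_cmult)
    qed
    moreover have "((\<lambda>T. \<Sum>i\<in>I. cnj (c i) * avg T (\<lambda>u. f u * cis (- \<xi> i * u))) \<longlongrightarrow> (\<Sum>i\<in>I. cnj (c i) * c i)) at_top"
      by (intro tendsto_intros c)
    moreover have "(\<Sum>i\<in>I. cnj (c i) * c i) = of_real s"
      unfolding s_def of_real_sum by (intro sum.cong) (simp_all add: complex_norm_square[symmetric] mult.commute)
    ultimately show ?thesis by simp
  qed
  have ppq: "((\<lambda>T. avg T (\<lambda>u. p u * q u)) \<longlongrightarrow> of_real s) at_top"
  proof -
    have "avg T (\<lambda>u. p u * q u) = (\<Sum>i\<in>I. \<Sum>j\<in>I. c i * cnj (c j) * avg T (\<lambda>u. cis ((\<xi> i - \<xi> j) * u)))" for T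
    proof -
      have cc: "cis ((\<xi> i - \<xi> j) * u) = cis (\<xi> i * u) * cis (- \<xi> j * u)" for i j u
        by (simp add: cis_mult left_diff_distrib)
      have "p u * q u = (\<Sum>i\<in>I. \<Sum>j\<in>I. c i * cnj (c j) * cis ((\<xi> i - \<xi> j) * u))" for u
        unfolding p_def q_def sum_product cc by (intro sum.cong refl) (simp only: mult_ac)
      then show ?thesis
        by (simp add: avg_sum avg_cmult tame_sum tame_mult tame_const tame_cis_linear)
    qed
    moreover have "((\<lambda>T. \<Sum>i\<in>I. \<Sum>j\<in>I. c i * cnj (c j) * avg T (\<lambda>u. cis ((\<xi> i - \<xi> j) * u))) 
        \<longlongrightarrow> (\<Sum>i\<in>I. \<Sum>j\<in>I. c i * cnj (c j) * (if i = j then 1 else 0))) at_top"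
    proof (intro tendsto_sum tendsto_mult tendsto_const)
      fix i j assume ij: "i \<in> I" "j \<in> I"
      show "((\<lambda>T. avg T (\<lambda>u. cis ((\<xi> i - \<xi> j) * u))) \<longlongrightarrow> (if i = j then 1 else 0)) at_top"
      proof (cases "i = j")
        case True
        have "((\<lambda>T. avg T (\<lambda>_. 1)) \<longlongrightarrow> 1) at_top"
          by (rule tendsto_eventually) (use eventually_gt_at_top[of 0] in eventually_elim, simp add: avg_const)
        with True show ?thesis by simp
      next
        case False
        then have "\<xi> i - \<xi> j \<noteq> 0" using I(2) ij by (auto simp: inj_on_def)
        then show ?thesis using False avg_cis_nonzero by simp
      qed
    qed
    moreover have "(\<Sum>i\<in>I. \<Sum>j\<in>I. c i * cnj (c j) * (if i = j then 1 else 0)) = of_real s"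
      unfolding s_def of_real_sum
    proof (rule sum.cong)
      fix i assume "i \<in> I"
      then show "(\<Sum>j\<in>I. c i * cnj (c j) * (if i = j then 1 else 0)) = of_real ((cmod (c i))\<^sup>2)"
        using I(1) by (simp add: if_distrib complex_norm_square[symmetric] cong: if_cong)
    qed simp
    ultimately show ?thesis by simp
  qed
  have eq: "integral {0..T} (\<lambda>u. (cmod (f u - p u))\<^sup>2) / T - integral {0..T} (\<lambda>u. (cmod (f u))\<^sup>2) / T
      = Re (avg T (\<lambda>u. p u * q u)) - 2 * Re (avg T (\<lambda>u. f u * q u))" for T
  proof -
    have pt: "(cmod (f u - p u))\<^sup>2 = ((cmod (f u))\<^sup>2 + Re (p u * q u)) - 2 * Re (f u * q u)" for u
    proof -
      have "of_real ((cmod (f u - p u))\<^sup>2) = (f u - p u) * cnj (f u - p u)" by (rule complex_norm_square)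
      also have "\<dots> = f u * cnj (f u) + p u * q u - (f u * q u + cnj (f u * q u))"
        by (simp add: pq algebra_simps) (simp add: pq[symmetric])
      also have "f u * cnj (f u) = of_real ((cmod (f u))\<^sup>2)" by (rule complex_norm_square[symmetric])
      finally have "Re (of_real ((cmod (f u - p u))\<^sup>2)) = Re (of_real ((cmod (f u))\<^sup>2) + p u * q u - (f u * q u + cnj (f u * q u)))"
        by (rule arg_cong)
      then show ?thesis by simp
    qed
    have t: "tame (\<lambda>u. (cmod (f u))\<^sup>2)" "tame (\<lambda>u. Re (p u * q u))" "tame (\<lambda>u. Re (f u * q u))"
    proof -
      have Re: "tame (\<lambda>u. Re (g u))" if "tame g" for g
        using that by (auto simp: tame_def bounded_iff intro: order_trans[OF abs_Re_le_cmod])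
      show "tame (\<lambda>u. (cmod (f u))\<^sup>2)" by (intro tame_power2 tame_norm f)
      show "tame (\<lambda>u. Re (p u * q u))" "tame (\<lambda>u. Re (f u * q u))" by (intro Re tame_mult tp f)+
    qed
    have "integral {0..T} (\<lambda>u. (cmod (f u - p u))\<^sup>2) = integral {0..T} (\<lambda>u. (cmod (f u))\<^sup>2) 
       + integral {0..T} (\<lambda>u. Re (p u * q u)) - 2 * integral {0..T} (\<lambda>u. Re (f u * q u))"
    proof -
      define a1 a2 a3 where "a1 u = (cmod (f u))\<^sup>2" and "a2 u = Re (p u * q u)" and "a3 u = Re (f u * q u)" for u
      have "tame a1" "tame a2" "tame a3" using t unfolding a1_def [abs_def] a2_def [abs_def] a3_def [abs_def] .
      then have "integral {0..T} (\<lambda>u. (a1 u + a2 u) - 2 * a3 u)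
         = integral {0..T} a1 + integral {0..T} a2 - 2 * integral {0..T} a3"
        by (simp add: tame_integral_diff tame_integral_add tame_add tame_mult tame_const)
      then show ?thesis unfolding pt a1_def a2_def a3_def .
    qed
    then show ?thesis
      by (simp add: Re_avg tame_mult tp f add_divide_distrib diff_divide_distrib)
  qed
  have "((\<lambda>T. Re (avg T (\<lambda>u. p u * q u)) - 2 * Re (avg T (\<lambda>u. f u * q u))) \<longlongrightarrow> Re (of_real s) - 2 * Re (of_real s)) at_top"
    by (intro tendsto_intros fq ppq)
  then show ?thesis unfolding p_def[symmetric] eq s_def by simp
qed

section \<open>Completeness of the odd harmonics and products of two waves\<close>

lemma odd_squares_sums: "(\<lambda>m. \<Sum>n<m. 1 / (2 * real n + 1)\<^sup>2) \<longlonglongrightarrow> pi\<^sup>2 / 8"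
proof -
  define S where "S m = (\<Sum>n<m. 1 / (real n + 1)\<^sup>2)" for m
  have S: "S \<longlonglongrightarrow> pi\<^sup>2 / 6"
    using inverse_squares_sums unfolding sums_def S_def by (simp add: add.commute)
  have split: "S (2 * m) = (\<Sum>n<m. 1 / (2 * real n + 1)\<^sup>2) + S m / 4" for m
  proof (induction m)
    case (Suc m)
    have "1 / (real (2 * m + 1) + 1)\<^sup>2 = (1 / (real m + 1)\<^sup>2) / 4"
    proof -
      have "real (2 * m + 1) + 1 = 2 * (real m + 1)" by simp
      then show ?thesis by (simp only: power_mult_distrib) simp
    qed
    moreover have "S (2 * Suc m) = S (2 * m) + 1 / (2 * real m + 1)\<^sup>2 + 1 / (real (2 * m + 1) + 1)\<^sup>2"
      by (simp add: S_def)
    moreover have "S (Suc m) = S m + 1 / (real m + 1)\<^sup>2" by (simp add: S_def)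
    ultimately show ?case using Suc by simp
  qed (simp add: S_def)
  have "(\<lambda>m. S (2 * m)) \<longlonglongrightarrow> pi\<^sup>2 / 6"
    by (rule LIMSEQ_subseq_LIMSEQ[OF S, unfolded o_def]) (auto simp: strict_mono_def)
  then have "(\<lambda>m. S (2 * m) - S m / 4) \<longlonglongrightarrow> pi\<^sup>2 / 6 - pi\<^sup>2 / 6 / 4"
    by (intro tendsto_intros S) auto
  moreover have "S (2 * m) - S m / 4 = (\<Sum>n<m. 1 / (2 * real n + 1)\<^sup>2)" for m using split[of m] by simp
  ultimately show ?thesis by (simp add: field_simps)
qed

definition odd_freqs :: "nat \<Rightarrow> int set" where
  "odd_freqs m = (\<lambda>n. 2 * int n + 1) ` {..<m} \<union> (\<lambda>n. - (2 * int n + 1)) ` {..<m}"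

lemma odd_freqs: "finite (odd_freqs m)" "n \<in> odd_freqs m \<Longrightarrow> odd n"
  by (auto simp: odd_freqs_def)

lemma mem_odd_freqs:
  assumes "odd n"
  shows "\<exists>m0. \<forall>m\<ge>m0. n \<in> odd_freqs m"
proof -
  obtain k where k: "n = 2 * k + 1" using assms by (rule oddE)
  have "n \<in> odd_freqs m" if "m \<ge> nat \<bar>n\<bar> + 1" for m
  proof (cases "k \<ge> 0")
    case True
    then have "n = 2 * int (nat k) + 1" "nat k < m" using k that by auto
    then show ?thesis unfolding odd_freqs_def by blast
  next
    case False
    then have "n = - (2 * int (nat (- k - 1)) + 1)" "nat (- k - 1) < m" using k that by auto
    then show ?thesis unfolding odd_freqs_def by blast
  qed
  then show ?thesis by blast
qed

lemma cmod_wave_coeff: "(cmod (wave_coeff n))\<^sup>2 = 4 / pi\<^sup>2 * (1 / (of_int n)\<^sup>2)"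
  by (simp add: wave_coeff_def norm_divide norm_mult power_divide power_mult_distrib)

text \<open>The squares exhaust the mean square 1 of the wave, so by \<open>bessel_mean\<close> the
  partial Fourier sums approximate it in quadratic mean.\<close>

lemma wave_coeff_parseval: "(\<lambda>m. \<Sum>n\<in>odd_freqs m. (cmod (wave_coeff n))\<^sup>2) \<longlonglongrightarrow> 1"
proof -
  have "(\<Sum>n\<in>odd_freqs m. (cmod (wave_coeff n))\<^sup>2) = 8 / pi\<^sup>2 * (\<Sum>n<m. 1 / (2 * real n + 1)\<^sup>2)" for m
  proof -
    have "(\<Sum>n\<in>odd_freqs m. (cmod (wave_coeff n))\<^sup>2) 
       = (\<Sum>n\<in>(\<lambda>n. 2 * int n + 1) ` {..<m}. (cmod (wave_coeff n))\<^sup>2) + (\<Sum>n\<in>(\<lambda>n. - (2 * int n + 1)) ` {..<m}. (cmod (wave_coeff n))\<^sup>2)"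
      unfolding odd_freqs_def by (rule sum.union_disjoint) auto
    also have "(\<Sum>n\<in>(\<lambda>n. 2 * int n + 1) ` {..<m}. (cmod (wave_coeff n))\<^sup>2) = (\<Sum>n<m. 4 / pi\<^sup>2 * (1 / (2 * real n + 1)\<^sup>2))"
      by (subst sum.reindex) (auto simp: inj_on_def cmod_wave_coeff)
    also have "(\<Sum>n\<in>(\<lambda>n. - (2 * int n + 1)) ` {..<m}. (cmod (wave_coeff n))\<^sup>2) = (\<Sum>n<m. 4 / pi\<^sup>2 * (1 / (2 * real n + 1)\<^sup>2))"
    proof (subst sum.reindex)
      show "inj_on (\<lambda>n. - (2 * int n + 1)) {..<m}" by (auto simp: inj_on_def)
      have "(of_int (- (2 * int n + 1)) :: real)\<^sup>2 = (2 * real n + 1)\<^sup>2" for n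
        by (simp add: power2_eq_square algebra_simps)
      then show "sum ((\<lambda>n. (cmod (wave_coeff n))\<^sup>2) \<circ> (\<lambda>n. - (2 * int n + 1))) {..<m} = (\<Sum>n<m. 4 / pi\<^sup>2 * (1 / (2 * real n + 1)\<^sup>2))"
        unfolding o_def cmod_wave_coeff by (simp only:)
    qed
    finally show ?thesis unfolding sum_distrib_left[symmetric] by simp
  qed
  moreover have "(\<lambda>m. 8 / pi\<^sup>2 * (\<Sum>n<m. 1 / (2 * real n + 1)\<^sup>2)) \<longlonglongrightarrow> 8 / pi\<^sup>2 * (pi\<^sup>2 / 8)"
    by (intro tendsto_intros odd_squares_sums)
  ultimately show ?thesis by simp
qed

text \<open>Cauchy-Schwarz replaced by
  \<open>2 * \<delta> * x \<le> \<delta>\<^sup>2 + x\<^sup>2\<close>, with \<open>\<delta>\<close>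
  free for the accuracy wanted.\<close>

lemma norm_avg_le_square:
  assumes F: "tame F" and "\<delta> > 0" "T > 0"
  shows "norm (avg T F) \<le> \<delta> / 2 + integral {0..T} (\<lambda>u. (cmod (F u))\<^sup>2) / T / (2 * \<delta>)"
proof -
  have t: "tame (\<lambda>u. (cmod (F u))\<^sup>2)" using F by (intro tame_power2 tame_norm)
  have "norm (integral {0..T} F) \<le> integral {0..T} (\<lambda>u. \<delta> / 2 + 1 / (2 * \<delta>) * (cmod (F u))\<^sup>2)"
  proof (rule integral_norm_bound_integral)
    show "F integrable_on {0..T}" by (rule tame_integrable[OF F])
    show "(\<lambda>u. \<delta> / 2 + 1 / (2 * \<delta>) * (cmod (F u))\<^sup>2) integrable_on {0..T}"
      by (intro tame_integrable tame_add tame_const tame_mult t)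
    fix u
    have "0 \<le> (\<delta> - cmod (F u))\<^sup>2" by simp
    then have "2 * \<delta> * cmod (F u) \<le> \<delta>\<^sup>2 + (cmod (F u))\<^sup>2" by (simp add: power2_diff)
    then show "cmod (F u) \<le> \<delta> / 2 + 1 / (2 * \<delta>) * (cmod (F u))\<^sup>2"
      using assms(2) by (simp add: field_simps power2_eq_square)
  qed
  also have "\<dots> = integral {0..T} (\<lambda>u. \<delta> / 2) + integral {0..T} (\<lambda>u. 1 / (2 * \<delta>) * (cmod (F u))\<^sup>2)"
    by (intro tame_integral_add tame_const tame_mult t)
  also have "\<dots> = \<delta> / 2 * T + 1 / (2 * \<delta>) * integral {0..T} (\<lambda>u. (cmod (F u))\<^sup>2)"
    using assms(3) by (simp only: integral_mult_right) simp
  finally have "norm (integral {0..T} F) / T \<le> (\<delta> / 2 * T + 1 / (2 * \<delta>) * integral {0..T} (\<lambda>u. (cmod (F u))\<^sup>2)) / T"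
    using assms(3) by (intro divide_right_mono) auto
  also have "\<dots> = \<delta> / 2 + integral {0..T} (\<lambda>u. (cmod (F u))\<^sup>2) / T / (2 * \<delta>)"
    using assms(3) by (simp add: add_divide_distrib)
  finally show ?thesis using assms(3) by (simp add: avg_def norm_divide)
qed

text \<open>The first wave is replaced by a trigonometric polynomial, close to it in quadratic mean; all
  but one of the resulting terms are non-resonant.\<close>

lemma avg_two_waves:
  assumes \<omega>: "\<omega> > 0" "\<omega>' > 0" and ab: "odd a" "odd b"
    and indep: "\<And>p q :: int. p \<noteq> 0 \<or> q \<noteq> 0 \<Longrightarrow> of_int p * \<omega> + of_int q * \<omega>' \<noteq> 0"
  shows "((\<lambda>T. avg T (\<lambda>u. of_real (square_wave (\<omega> * u) * square_wave (\<omega>' * u))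
             * cis (- (pi * (of_int a * \<omega> + of_int b * \<omega>')) * u))) \<longlongrightarrow> wave_coeff a * wave_coeff b) at_top"
proof (rule tendstoI)
  fix \<epsilon> :: real assume \<epsilon>: "\<epsilon> > 0"
  define \<delta> where "\<delta> = \<epsilon> / 2"
  have \<delta>: "\<delta> > 0" using \<epsilon> by (simp add: \<delta>_def)
  have "\<forall>\<^sub>F m in sequentially. (\<Sum>n\<in>odd_freqs m. (cmod (wave_coeff n))\<^sup>2) > 1 - \<delta>\<^sup>2"
    using wave_coeff_parseval by (rule order_tendstoD(1)) (use \<delta> in simp)
  moreover obtain m0 where "\<forall>m\<ge>m0. a \<in> odd_freqs m" using mem_odd_freqs[OF ab(1)] by blast
  then have "\<forall>\<^sub>F m in sequentially. a \<in> odd_freqs m" by (auto simp: eventually_sequentially)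
  ultimately have "\<forall>\<^sub>F m in sequentially. (\<Sum>n\<in>odd_freqs m. (cmod (wave_coeff n))\<^sup>2) > 1 - \<delta>\<^sup>2 \<and> a \<in> odd_freqs m"
    by (rule eventually_conj)
  then obtain m where m: "(\<Sum>n\<in>odd_freqs m. (cmod (wave_coeff n))\<^sup>2) > 1 - \<delta>\<^sup>2" "a \<in> odd_freqs m"
    by (auto simp: eventually_sequentially)
  define I where "I = odd_freqs m"
  define f where "f u = complex_of_real (square_wave (\<omega> * u))" for u
  define p where "p u = (\<Sum>n\<in>I. wave_coeff n * cis ((pi * of_int n * \<omega>) * u))" for u
  define \<xi> where "\<xi> = pi * (of_int a * \<omega> + of_int b * \<omega>')"
  define h where "h u = complex_of_real (square_wave (\<omega>' * u)) * cis (- \<xi> * u)" for u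
  have I: "finite I" "a \<in> I" "\<And>n. n \<in> I \<Longrightarrow> odd n" using m odd_freqs by (auto simp: I_def)
  have tm: "tame f" "tame p" "tame h" unfolding f_def [abs_def] p_def [abs_def] h_def [abs_def]
    by (intro tame_of_real tame_square_wave tame_sum tame_mult tame_const tame_cis_linear)+
  have h1: "cmod (h u) = 1" "cmod (f u) = 1" for u by (simp_all add: h_def f_def norm_mult)
  have "((\<lambda>T. integral {0..T} (\<lambda>u. (cmod (f u - p u))\<^sup>2) / T - integral {0..T} (\<lambda>u. (cmod (f u))\<^sup>2) / T)
     \<longlongrightarrow> - (\<Sum>n\<in>I. (cmod (wave_coeff n))\<^sup>2)) at_top"
    unfolding p_def
  proof (rule bessel_mean[OF tm(1) I(1)])
    show "inj_on (\<lambda>n. pi * of_int n * \<omega>) I" using \<omega> by (auto simp: inj_on_def)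
    fix n assume "n \<in> I"
    from avg_wave_resonant[OF \<omega>(1) I(3)[OF this]]
    show "((\<lambda>T. avg T (\<lambda>u. f u * cis (- (pi * of_int n * \<omega>) * u))) \<longlongrightarrow> wave_coeff n) at_top"
      unfolding f_def .
  qed
  \<comment> \<open>The mean square of \<open>f\<close> is 1, so the choice of \<open>m\<close>
    leaves a remainder below \<open>\<delta>\<^sup>2\<close>.\<close>
  then have "\<forall>\<^sub>F T in at_top. integral {0..T} (\<lambda>u. (cmod (f u - p u))\<^sup>2) / T - integral {0..T} (\<lambda>u. (cmod (f u))\<^sup>2) / T < \<delta>\<^sup>2 - 1"
    by (rule order_tendstoD(2)) (use m in \<open>simp add: I_def\<close>)
  then have close: "\<forall>\<^sub>F T in at_top. norm (avg T (\<lambda>u. (f u - p u) * h u)) < \<delta>"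
    using eventually_gt_at_top[of 0]
  proof eventually_elim
    case (elim T)
    have "norm (avg T (\<lambda>u. (f u - p u) * h u)) \<le> \<delta> / 2 + integral {0..T} (\<lambda>u. (cmod ((f u - p u) * h u))\<^sup>2) / T / (2 * \<delta>)"
      using \<delta> elim by (intro norm_avg_le_square tame_mult tame_diff tm)
    also have "integral {0..T} (\<lambda>u. (cmod ((f u - p u) * h u))\<^sup>2) / T / (2 * \<delta>) < \<delta>\<^sup>2 / (2 * \<delta>)"
      using elim \<delta> by (intro divide_strict_right_mono) (auto simp: norm_mult h1)
    also have "\<delta> / 2 + \<delta>\<^sup>2 / (2 * \<delta>) = \<delta>" using \<delta> by (simp add: power2_eq_square)
    finally show ?case by simp
  qed
  have "((\<lambda>T. avg T (\<lambda>u. p u * h u)) \<longlongrightarrow> wave_coeff a * wave_coeff b) at_top"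
  proof -
    have eq: "avg T (\<lambda>u. p u * h u) = (\<Sum>n\<in>I. wave_coeff n * avg T (\<lambda>u. complex_of_real (square_wave (\<omega>' * u)) * cis ((pi * of_int n * \<omega> - \<xi>) * u)))" for T
    proof -
      have cc: "cis ((pi * of_int n * \<omega> - \<xi>) * u) = cis ((pi * of_int n * \<omega>) * u) * cis (- \<xi> * u)" for n u
        by (simp add: cis_mult left_diff_distrib)
      have "p u * h u = (\<Sum>n\<in>I. wave_coeff n * (complex_of_real (square_wave (\<omega>' * u)) * cis ((pi * of_int n * \<omega> - \<xi>) * u)))" for u
        unfolding p_def h_def sum_distrib_right cc by (intro sum.cong refl) (simp only: mult_ac)
      then show ?thesis
        by (simp add: avg_sum avg_cmult tame_mult tame_const tame_cis_linear tame_of_real tame_square_wave)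
    qed
    have "((\<lambda>T. \<Sum>n\<in>I. wave_coeff n * avg T (\<lambda>u. complex_of_real (square_wave (\<omega>' * u)) * cis ((pi * of_int n * \<omega> - \<xi>) * u)))
       \<longlongrightarrow> (\<Sum>n\<in>I. wave_coeff n * (if n = a then wave_coeff b else 0))) at_top"
    proof (intro tendsto_sum tendsto_mult tendsto_const)
      fix n assume n: "n \<in> I"
      show "((\<lambda>T. avg T (\<lambda>u. complex_of_real (square_wave (\<omega>' * u)) * cis ((pi * of_int n * \<omega> - \<xi>) * u)))
        \<longlongrightarrow> (if n = a then wave_coeff b else 0)) at_top"
      proof (cases "n = a")
        case True
        have "pi * of_int n * \<omega> - \<xi> = - (pi * of_int b * \<omega>')" by (simp add: \<xi>_def True algebra_simps)
        then show ?thesis using True avg_wave_resonant[OF \<omega>(2) ab(2)] by simp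
      next
        case False
        define P where "P = 2 / \<omega>'"
        have P: "P > 0" "\<omega>' * P = 2" using \<omega> by (auto simp: P_def)
        have per: "complex_of_real (square_wave (\<omega>' * (u + P))) = of_real (square_wave (\<omega>' * u))" for u
        proof -
          have "\<omega>' * (u + P) = \<omega>' * u + 2 * of_int 1" using P by (simp add: distrib_left)
          then show ?thesis by (simp only: square_wave_add_even)
        qed
        \<comment> \<open>Resonance with the second wave would be an integer relation between
          \<open>\<omega>\<close> and \<open>\<omega>'\<close>, nontrivial because
          \<open>n \<noteq> a\<close>.\<close>
        have ne: "cis ((pi * of_int n * \<omega> - \<xi>) * P) \<noteq> 1"
        proof
          assume one: "cis ((pi * of_int n * \<omega> - \<xi>) * P) = 1"
          then have "cos ((pi * of_int n * \<omega> - \<xi>) * P) = 1" by (simp add: complex_eq_iff)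
          then obtain k :: int where "(pi * of_int n * \<omega> - \<xi>) * P = of_int k * 2 * pi"
            by (auto simp: cos_one_2pi_int)
          then have "pi * ((of_int (n - a) * \<omega> - of_int b * \<omega>') * (2 / \<omega>')) = pi * (2 * of_int k)"
            by (simp add: \<xi>_def P_def algebra_simps)
          then have "(of_int (n - a) * \<omega> - of_int b * \<omega>') * (2 / \<omega>') = 2 * of_int k"
            using mult_left_cancel[of pi] pi_neq_zero by blast
          then have "of_int (n - a) * \<omega> + of_int (- b - k) * \<omega>' = 0"
            using \<omega> by (simp add: field_simps)
          with indep[of "n - a" "- b - k"] False show False by simp
        qed
        have "((\<lambda>T. avg T (\<lambda>u. complex_of_real (square_wave (\<omega>' * u)) * cis ((pi * of_int n * \<omega> - \<xi>) * u))) \<longlongrightarrow> 0) at_top"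
          by (rule avg_periodic_nonresonant[where f = "\<lambda>u. complex_of_real (square_wave (\<omega>' * u))", OF _ per P(1) ne]) (intro tame_of_real tame_square_wave)
        then show ?thesis using False by simp
      qed
    qed
    moreover have "(\<Sum>n\<in>I. wave_coeff n * (if n = a then wave_coeff b else 0)) = wave_coeff a * wave_coeff b"
      using I by (simp add: if_distrib cong: if_cong)
    ultimately show ?thesis unfolding eq by simp
  qed
  then have "\<forall>\<^sub>F T in at_top. dist (avg T (\<lambda>u. p u * h u)) (wave_coeff a * wave_coeff b) < \<delta>"
    using \<delta> by (rule tendstoD)
  with close show "\<forall>\<^sub>F T in at_top. dist (avg T (\<lambda>u. of_real (square_wave (\<omega> * u) * square_wave (\<omega>' * u))
             * cis (- (pi * (of_int a * \<omega> + of_int b * \<omega>')) * u))) (wave_coeff a * wave_coeff b) < \<epsilon>"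
  proof eventually_elim
    case (elim T)
    have "of_real (square_wave (\<omega> * u) * square_wave (\<omega>' * u)) * cis (- (pi * (of_int a * \<omega> + of_int b * \<omega>')) * u)
       = (f u - p u) * h u + p u * h u" for u
      unfolding f_def h_def \<xi>_def by (simp add: algebra_simps)
    then have "avg T (\<lambda>u. of_real (square_wave (\<omega> * u) * square_wave (\<omega>' * u)) * cis (- (pi * (of_int a * \<omega> + of_int b * \<omega>')) * u))
       = avg T (\<lambda>u. (f u - p u) * h u) + avg T (\<lambda>u. p u * h u)"
      using tm by (simp add: avg_add tame_mult tame_diff)
    then have "dist (avg T (\<lambda>u. of_real (square_wave (\<omega> * u) * square_wave (\<omega>' * u)) * cis (- (pi * (of_int a * \<omega> + of_int b * \<omega>')) * u))) (wave_coeff a * wave_coeff b)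
       \<le> norm (avg T (\<lambda>u. (f u - p u) * h u)) + dist (avg T (\<lambda>u. p u * h u)) (wave_coeff a * wave_coeff b)"
      unfolding dist_norm by (simp only: add_diff_eq[symmetric] norm_triangle_ineq)
    with elim show ?case by (simp only: \<delta>_def)
  qed
qed

section \<open>Linear growth of the variance\<close>

context signed_waves
begin

text \<open>\<open>spec\<close> provides for each \<open>k\<close> a frequency whose coefficient in
  the sum of the first \<open>K > k\<close> waves is bounded below independently of
  \<open>K\<close>. Multiples of a fixed \<open>q\<close> give distinct frequencies, and Bessel's
  inequality adds up about \<open>K / q\<close> such coefficients.\<close>

lemma variance_lower:
  fixes \<gamma>0 :: real
  assumes \<gamma>0: "\<gamma>0 > 0"
    and spec: "\<And>k. \<exists>\<xi> (a :: nat \<Rightarrow> int) (b :: nat \<Rightarrow> int).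
         (\<forall>j. odd (a j) \<and> odd (b j) \<and> \<xi> = of_int (a j) * w j + of_int (b j) * w (Suc j)) \<and>
         \<gamma>0 * w k \<le> \<bar>\<xi>\<bar> \<and> \<bar>\<xi>\<bar> \<le> 2 * w k \<and> (\<forall>K>k. \<gamma>0 \<le> \<bar>\<Sum>j<K. c j / of_int (a j * b j)\<bar>)"
  shows "\<exists>\<gamma>>0. \<forall>K\<ge>1. \<forall>\<^sub>F S in at_top. \<gamma> * real K \<le> Bsq S K"
proof -
  \<comment> \<open>This \<open>q\<close> puts the upper bound \<open>2 * w\<close> at a selected
    index below the lower bound \<open>\<gamma>0 * w\<close> at every earlier selected
    index.\<close>
  obtain q where q: "q \<ge> 1" "\<theta> ^ q \<le> \<gamma>0 / 4" using exists_power_le[OF \<theta>, of "\<gamma>0 / 4"] \<gamma>0 by auto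
  define Q where "Q k \<xi> a b \<longleftrightarrow> (\<forall>j. odd (a j) \<and> odd (b j) \<and> \<xi> = of_int (a j) * w j + of_int (b j) * w (Suc j)) \<and>
      \<gamma>0 * w k \<le> \<bar>\<xi>\<bar> \<and> \<bar>\<xi>\<bar> \<le> 2 * w k \<and> (\<forall>K>k. \<gamma>0 \<le> \<bar>\<Sum>j<K. c j / of_int (a j * b j)\<bar>)"
    for k \<xi> and a b :: "nat \<Rightarrow> int"
  have "\<exists>\<xi> a b. Q k \<xi> a b" for k using spec unfolding Q_def .
  then obtain \<xi> a b where Q: "\<And>k. Q k (\<xi> k) (a k) (b k)" by metis
  have odd: "odd (a k j)" "odd (b k j)" and \<xi>: "\<xi> k = of_int (a k j) * w j + of_int (b k j) * w (Suc j)" for k j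
    using Q[of k] unfolding Q_def by blast+
  have \<xi>b: "\<gamma>0 * w k \<le> \<bar>\<xi> k\<bar>" "\<bar>\<xi> k\<bar> \<le> 2 * w k" for k
    using Q[of k] unfolding Q_def by blast+
  have coeff: "\<gamma>0 \<le> \<bar>\<Sum>j<K. c j / of_int (a k j * b k j)\<bar>" if "k < K" for k K
    using Q[of k] that unfolding Q_def by blast
  have indep: "of_int p * w j + of_int r * w (Suc j) \<noteq> 0" if "p \<noteq> 0 \<or> r \<noteq> 0" for p r :: int and j
  proof -
    have "(\<bar>of_int p\<bar> + \<bar>of_int r\<bar> :: real) > 0" using that by linarith
    then have "\<kappa> * w j / (\<bar>of_int p\<bar> + \<bar>of_int r\<bar>) > 0" using \<kappa> w_pos[of j] by simp
    with w_bad[OF that, of j] show ?thesis by auto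
  qed
  have less: "\<bar>\<xi> (q * i')\<bar> < \<bar>\<xi> (q * i)\<bar>" if "i < i'" for i i'
  proof -
    have "q * i + q \<le> q * i'" using that by (metis Suc_leI mult_Suc_right mult_le_mono2 add.commute)
    then have "w (q * i') \<le> w (q * i + q)" by (rule w_antimono)
    also have "\<dots> \<le> \<theta> ^ q * w (q * i)" by (rule w_upper_power)
    also have "\<dots> \<le> \<gamma>0 / 4 * w (q * i)" using q w_pos[of "q * i"] by (intro mult_right_mono) auto
    finally have "2 * w (q * i') < \<gamma>0 * w (q * i)"
      using mult_pos_pos[OF \<gamma>0 w_pos[of "q * i"]] by linarith
    with \<xi>b(1)[of "q * i"] \<xi>b(2)[of "q * i'"] show ?thesis by linarith
  qed
  define c0 where "c0 = 4 / pi\<^sup>2 * \<gamma>0"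
  have c0: "c0 > 0" using \<gamma>0 by (simp add: c0_def)
  \<comment> \<open>Half of the guaranteed \<open>c0\<^sup>2 / q\<close> per index; the strict gap
    turns the limit into an eventual inequality.\<close>
  define \<gamma> where "\<gamma> = c0\<^sup>2 / (2 * q)"
  have \<gamma>: "\<gamma> > 0" using c0 q(1) by (simp add: \<gamma>_def)
  have "\<forall>\<^sub>F S in at_top. \<gamma> * real K \<le> Bsq S K" if K: "K \<ge> 1" for K
  proof -
    define I where "I = {..(K - 1) div q}"
    have I: "finite I" "K \<le> q * card I" "\<And>i. i \<in> I \<Longrightarrow> q * i < K"
    proof -
      show "finite I" by (simp add: I_def)
      have "K - 1 < q * ((K - 1) div q) + q"
        using q(1) by (metis One_nat_def dividend_less_times_div less_eq_Suc_le add.commute)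
      then show "K \<le> q * card I" using K by (simp add: I_def)
      fix i assume "i \<in> I"
      then have "q * i \<le> q * ((K - 1) div q)" by (simp add: I_def)
      also have "\<dots> \<le> K - 1" by simp
      finally show "q * i < K" using K by linarith
    qed
    define f where "f u = complex_of_real (Z 0 K u)" for u
    define C where "C i = (\<Sum>j<K. of_real (c j) * (wave_coeff (a (q * i) j) * wave_coeff (b (q * i) j)))" for i
    have f: "tame f" unfolding f_def [abs_def] by (intro tame_of_real tame_Z)
    have lim: "((\<lambda>T. avg T (\<lambda>u. f u * cis (- (pi * \<xi> (q * i)) * u))) \<longlongrightarrow> C i) at_top" for i
    proof -
      have eq: "avg T (\<lambda>u. f u * cis (- (pi * \<xi> (q * i)) * u))
         = (\<Sum>j<K. of_real (c j) * avg T (\<lambda>u. of_real (X j u) * cis (- (pi * \<xi> (q * i)) * u)))" for T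
      proof -
        have "f u * cis (- (pi * \<xi> (q * i)) * u) = (\<Sum>j<K. of_real (c j) * (of_real (X j u) * cis (- (pi * \<xi> (q * i)) * u)))" for u
          unfolding f_def Z_def of_real_sum sum_distrib_right lessThan_atLeast0 by (intro sum.cong) (simp_all add: mult_ac)
        moreover have "tame (\<lambda>u. complex_of_real (X j u) * cis (- (pi * \<xi> (q * i)) * u))" for j
          by (intro tame_mult tame_of_real tame_X tame_cis_linear)
        ultimately show ?thesis
          by (simp only: avg_sum avg_cmult tame_mult tame_const)
      qed
      show ?thesis unfolding eq C_def
      proof (intro tendsto_sum tendsto_mult tendsto_const)
        fix j
        from avg_two_waves[OF w_pos[of j] w_pos[of "Suc j"] odd(1)[of "q * i" j] odd(2)[of "q * i" j] indep]
        show "((\<lambda>T. avg T (\<lambda>u. of_real (X j u) * cis (- (pi * \<xi> (q * i)) * u))) \<longlongrightarrow> wave_coeff (a (q * i) j) * wave_coeff (b (q * i) j)) at_top"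
          unfolding X_def \<xi>[of "q * i" j] by simp
      qed
    qed
    have C: "c0\<^sup>2 \<le> (cmod (C i))\<^sup>2" if "i \<in> I" for i
    proof -
      have "wave_coeff p * wave_coeff r = of_real (- (4 / pi\<^sup>2) / of_int (p * r))" for p r
      proof -
        have d: "(\<i> * x) * (\<i> * z) = - (x * z)" for x z :: complex by (simp add: algebra_simps)
        have "wave_coeff p * wave_coeff r = (2 * 2) / - (of_real (pi * of_int p) * of_real (pi * of_int r))"
          unfolding wave_coeff_def times_divide_times_eq d by (rule refl)
        then show ?thesis by (simp add: power2_eq_square mult_ac)
      qed
      then have "C i = of_real (- (4 / pi\<^sup>2) * (\<Sum>j<K. c j / of_int (a (q * i) j * b (q * i) j)))"
        unfolding C_def sum_distrib_left of_real_sum by (intro sum.cong) (simp_all add: mult_ac)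
      then have "cmod (C i) = 4 / pi\<^sup>2 * \<bar>\<Sum>j<K. c j / of_int (a (q * i) j * b (q * i) j)\<bar>"
        by (simp only: norm_of_real abs_mult) simp
      then have "c0 \<le> cmod (C i)"
        using mult_left_mono[OF coeff[OF I(3)[OF that]], of "4 / pi\<^sup>2"] by (simp add: c0_def)
      then show ?thesis using c0 by (intro power_mono) auto
    qed
    have "((\<lambda>T. integral {0..T} (\<lambda>u. (cmod (f u - (\<Sum>i\<in>I. C i * cis ((pi * \<xi> (q * i)) * u))))\<^sup>2) / T
            - integral {0..T} (\<lambda>u. (cmod (f u))\<^sup>2) / T) \<longlongrightarrow> - (\<Sum>i\<in>I. (cmod (C i))\<^sup>2)) at_top"
    proof (rule bessel_mean[OF f I(1) _ lim])
      show "inj_on (\<lambda>i. pi * \<xi> (q * i)) I"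
      proof (rule inj_onI)
        fix i i' assume "pi * \<xi> (q * i) = pi * \<xi> (q * i')"
        then have "\<bar>\<xi> (q * i)\<bar> = \<bar>\<xi> (q * i')\<bar>" by simp
        then show "i = i'" using less[of i i'] less[of i' i] by (cases i i' rule: linorder_cases) auto
      qed
    qed
    moreover have "- (\<Sum>i\<in>I. (cmod (C i))\<^sup>2) < - (\<gamma> * K)"
    proof -
      have "card I * c0\<^sup>2 \<le> (\<Sum>i\<in>I. (cmod (C i))\<^sup>2)" using sum_mono[of I "\<lambda>_. c0\<^sup>2"] C by simp
      moreover have "\<gamma> * K \<le> \<gamma> * (q * card I)" using I(2) \<gamma> by (intro mult_left_mono) (auto simp flip: of_nat_mult)
      moreover have "\<gamma> * (q * card I) = card I * c0\<^sup>2 / 2" using q(1) by (simp add: \<gamma>_def)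
      moreover have "card I * c0\<^sup>2 > 0" using c0 I_def by simp
      ultimately show ?thesis by linarith
    qed
    ultimately have "\<forall>\<^sub>F T in at_top. integral {0..T} (\<lambda>u. (cmod (f u - (\<Sum>i\<in>I. C i * cis ((pi * \<xi> (q * i)) * u))))\<^sup>2) / T
            - integral {0..T} (\<lambda>u. (cmod (f u))\<^sup>2) / T < - (\<gamma> * K)"
      by (rule order_tendstoD(2))
    then show ?thesis using eventually_gt_at_top[of 0]
    proof eventually_elim
      case (elim T)
      have "0 \<le> integral {0..T} (\<lambda>u. (cmod (f u - (\<Sum>i\<in>I. C i * cis ((pi * \<xi> (q * i)) * u))))\<^sup>2) / T"
        using elim by (intro divide_nonneg_pos integral_nonneg tame_integrable tame_power2 tame_norm tame_diff f tame_sum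
            tame_mult tame_const tame_cis_linear) auto
      then have "\<gamma> * K \<le> integral {0..T} (\<lambda>u. (cmod (f u))\<^sup>2) / T" using elim by linarith
      then show ?case by (simp add: Bsq_def f_def)
    qed
  qed
  with \<gamma> show ?thesis by blast
qed

end

section \<open>The waves attached to the even expansion\<close>

context badly_approximable_even_cf
begin

definition w :: "nat \<Rightarrow> real" where "w k = \<bar>P k\<bar>"

definition \<sigma> :: "nat \<Rightarrow> int" where "\<sigma> k = (if P k > 0 then 1 else -1)"

text \<open>\<open>(-1) ^ Suc j\<close> collects the sign changes of the reciprocity law, and the
  other factor is the sign of the tail inverted at that step. Even and odd \<open>j\<close> give the
  two kinds of terms in the drift.\<close>

definition signs :: "nat \<Rightarrow> real" where "signs j = (-1) ^ Suc j * of_int (sgn (m (Suc j)))"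

lemma \<sigma>: "\<sigma> k * \<sigma> k = 1" "\<bar>\<sigma> k\<bar> = 1" "odd (\<sigma> k)" "P k = of_int (\<sigma> k) * w k" "w k = of_int (\<sigma> k) * P k"
  by (auto simp: \<sigma>_def w_def)

lemma \<sigma>_mult: "\<sigma> j * \<sigma> (Suc j) = sgn (m (Suc j))"
proof -
  have "(of_int (\<sigma> j * \<sigma> (Suc j)) :: real) = sgn (P j) * sgn (P (Suc j))"
    using P_nonzero[of j] P_nonzero[of "Suc j"] by (auto simp: \<sigma>_def sgn_if simp del: P.simps)
  also have "\<dots> = sgn (y (Suc j))"
    using P_nonzero[of j] y_nonzero[of "Suc j"]
    by (cases "P j > 0"; cases "y (Suc j) > 0") (auto simp: sgn_if zero_less_divide_iff)
  also have "\<dots> = of_int (sgn (m (Suc j)))" by (rule sgn_y)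
  finally show ?thesis by linarith
qed

lemma w_bad:
  fixes a b :: int
  assumes "a \<noteq> 0 \<or> b \<noteq> 0"
  shows "c\<^sup>2 * w k / (\<bar>of_int a\<bar> + \<bar>of_int b\<bar>) \<le> \<bar>of_int a * w k + of_int b * w (Suc k)\<bar>"
proof -
  have "a * \<sigma> k \<noteq> 0 \<or> b * \<sigma> (Suc k) \<noteq> 0" using assms \<sigma>(3)[of k] \<sigma>(3)[of "Suc k"] by auto
  from P_badly_approximable[OF this, of k]
  have "c\<^sup>2 * w k / (\<bar>of_int (a * \<sigma> k)\<bar> + \<bar>of_int (b * \<sigma> (Suc k))\<bar>) \<le> \<bar>of_int (a * \<sigma> k) * P k + of_int (b * \<sigma> (Suc k)) * P (Suc k)\<bar>"
    by (simp add: w_def del: P.simps)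
  moreover have "(\<bar>of_int (a * \<sigma> k)\<bar> :: real) = \<bar>of_int a\<bar>" "(\<bar>of_int (b * \<sigma> (Suc k))\<bar> :: real) = \<bar>of_int b\<bar>"
    using \<sigma>(2)[of k] \<sigma>(2)[of "Suc k"] by (simp_all only: of_int_abs[symmetric] abs_mult mult_1_right)
  ultimately show ?thesis by (simp add: \<sigma>(5)[of k] \<sigma>(5)[of "Suc k"] mult.assoc del: P.simps)
qed

text \<open>The contraction comes from \<open>w_bad\<close> at \<open>(1, -1)\<close>: tails of an
  even expansion may a priori be close to 1 in modulus, and bad approximability separates
  \<open>w (Suc k)\<close> from \<open>w k\<close>. The last parameter bounds
  \<open>1 + \<bar>2 * m\<bar>\<close>, by way of
  \<open>c\<^sup>2 * \<bar>y (Suc k)\<bar> \<le> 1\<close>.\<close>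

lemma signed_waves_instance: "signed_waves w (c\<^sup>2) (1 - c\<^sup>2 / 2) (1 / c\<^sup>2 + 2) signs"
proof
  have c2: "0 < c\<^sup>2" "c\<^sup>2 \<le> 1" using c_pos c_le_1 by (auto simp: power_le_one)
  show "w k > 0" for k using P_nonzero[of k] by (simp add: w_def)
  show "w (Suc k) \<le> (1 - c\<^sup>2 / 2) * w k" for k
  proof -
    have "c\<^sup>2 * w k / 2 \<le> \<bar>w k - w (Suc k)\<bar>" using w_bad[of 1 "-1" k] by simp
    also have "\<dots> = w k - w (Suc k)" using P_decreasing[of k] by (simp add: w_def)
    finally show ?thesis by (simp add: algebra_simps)
  qed
  show "0 < 1 - c\<^sup>2 / 2" "1 - c\<^sup>2 / 2 < 1" "0 < c\<^sup>2" "c\<^sup>2 \<le> 1" using c2 by auto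
  show "1 / c\<^sup>2 \<le> 1 / c\<^sup>2 + 2" by simp
  show "\<bar>signs k\<bar> = 1" for k using m_nonzero[of k] by (simp add: signs_def abs_mult power_abs sgn_if)
  show "\<exists>(a::int) (b::int). w (Suc (Suc k)) = of_int a * w k + of_int b * w (Suc k) \<and> \<bar>of_int a\<bar> + \<bar>of_int b\<bar> \<le> 1 / c\<^sup>2 + 2" for k
  proof (intro exI conjI)
    define a where "a = \<sigma> (Suc (Suc k)) * \<sigma> k"
    define b where "b = - (2 * m (Suc k) * \<sigma> (Suc (Suc k)) * \<sigma> (Suc k))"
    have "P (Suc (Suc k)) = P k - 2 * of_int (m (Suc k)) * P (Suc k)" using P_rec[of k] by linarith
    then have "w (Suc (Suc k)) = of_int (\<sigma> (Suc (Suc k))) * (of_int (\<sigma> k) * w k - 2 * of_int (m (Suc k)) * (of_int (\<sigma> (Suc k)) * w (Suc k)))"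
      using \<sigma>(4)[of k] \<sigma>(4)[of "Suc k"] \<sigma>(5)[of "Suc (Suc k)"] by metis
    then show "w (Suc (Suc k)) = of_int a * w k + of_int b * w (Suc k)" by (simp add: a_def b_def algebra_simps)
    have "\<bar>a\<bar> = 1" "\<bar>b\<bar> = 2 * \<bar>m (Suc k)\<bar>" unfolding a_def b_def using \<sigma>(2) by (simp_all add: abs_mult)
    then have ab: "\<bar>of_int a\<bar> + \<bar>of_int b\<bar> = (1 + \<bar>2 * of_int (m (Suc k))\<bar> :: real)"
      by (simp flip: of_int_abs)
    have "c\<^sup>2 * w k \<le> w (Suc k)" using w_bad[of 0 1 k] by (simp add: w_def)
    then have "c\<^sup>2 * \<bar>y (Suc k)\<bar> \<le> 1"
      using P_nonzero[of k] abs_y[of k] by (simp add: w_def abs_divide field_simps)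
    then have "\<bar>y (Suc k)\<bar> \<le> 1 / c\<^sup>2" using c2 by (simp add: field_simps)
    moreover have "\<bar>1 / y (Suc (Suc k))\<bar> \<le> 1" using abs_y[of "Suc k"] by (simp add: field_simps)
    ultimately have "\<bar>2 * of_int (m (Suc k)) :: real\<bar> \<le> 1 / c\<^sup>2 + 1" using y_step[of "Suc k"] by linarith
    then show "\<bar>of_int a\<bar> + \<bar>of_int b\<bar> \<le> 1 / c\<^sup>2 + 2" unfolding ab by linarith
  qed
qed (rule w_bad)

sublocale signed_waves w "c\<^sup>2" "1 - c\<^sup>2 / 2" "1 / c\<^sup>2 + 2" signs
  by (rule signed_waves_instance)

text \<open>The witness is \<open>P k + P (Suc k)\<close>. Passing from \<open>P\<close> to absolute
  values inserts the signs \<open>\<sigma>\<close>, whose product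
  \<open>\<sigma> j * \<sigma> (Suc j)\<close> cancels against \<open>sgn (m (Suc j))\<close> in
  \<open>signs j\<close>, so exactly the telescoping sum remains.\<close>

lemma variance_linear: "\<exists>\<gamma>>0. \<forall>K\<ge>1. \<forall>\<^sub>F S in at_top. \<gamma> * real K \<le> Bsq S K"
proof (rule variance_lower)
  have c2: "0 < c\<^sup>2" using c_pos by simp
  show "min (c / 8) (c\<^sup>2 / 2) > 0" using c_pos by simp
  fix k
  show "\<exists>\<xi> (a :: nat \<Rightarrow> int) (b :: nat \<Rightarrow> int).
         (\<forall>j. odd (a j) \<and> odd (b j) \<and> \<xi> = of_int (a j) * w j + of_int (b j) * w (Suc j)) \<and>
         min (c / 8) (c\<^sup>2 / 2) * w k \<le> \<bar>\<xi>\<bar> \<and> \<bar>\<xi>\<bar> \<le> 2 * w k \<and> (\<forall>K>k. min (c / 8) (c\<^sup>2 / 2) \<le> \<bar>\<Sum>j<K. signs j / of_int (a j * b j)\<bar>)"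
  proof (intro exI conjI allI impI)
    fix j
    show "odd (A k (Suc j) * \<sigma> j)" "odd (A k j * \<sigma> (Suc j))" using A_odd \<sigma>(3) by simp_all
    show "P k + P (Suc k) = of_int (A k (Suc j) * \<sigma> j) * w j + of_int (A k j * \<sigma> (Suc j)) * w (Suc j)"
      unfolding A_frequency[of k j] \<sigma>(4)[of j] \<sigma>(4)[of "Suc j"] by simp
  next
    have "min (c / 8) (c\<^sup>2 / 2) * w k \<le> c\<^sup>2 / 2 * w k" by (intro mult_right_mono) (auto simp: w_def)
    also have "\<dots> \<le> \<bar>P k + P (Suc k)\<bar>"
      using P_badly_approximable[of 1 1 k] by (simp add: w_def del: P.simps)
    finally show "min (c / 8) (c\<^sup>2 / 2) * w k \<le> \<bar>P k + P (Suc k)\<bar>" .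
    show "\<bar>P k + P (Suc k)\<bar> \<le> 2 * w k" using P_decreasing[of k] unfolding w_def by linarith
  next
    fix K assume "k < K"
    have "(\<Sum>j<K. signs j / of_int ((A k (Suc j) * \<sigma> j) * (A k j * \<sigma> (Suc j)))) = (\<Sum>j<K. (-1) ^ Suc j / of_int (A k (Suc j) * A k j))"
    proof (rule sum.cong)
      fix j
      have "(A k (Suc j) * \<sigma> j) * (A k j * \<sigma> (Suc j)) = (A k (Suc j) * A k j) * sgn (m (Suc j))"
        unfolding \<sigma>_mult[symmetric] by simp
      then show "signs j / of_int ((A k (Suc j) * \<sigma> j) * (A k j * \<sigma> (Suc j))) = (-1) ^ Suc j / of_int (A k (Suc j) * A k j)"
        using m_nonzero[of j] by (simp only: signs_def of_int_mult) (auto simp: sgn_if)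
    qed simp
    then show "min (c / 8) (c\<^sup>2 / 2) \<le> \<bar>\<Sum>j<K. signs j / of_int ((A k (Suc j) * \<sigma> j) * (A k j * \<sigma> (Suc j)))\<bar>"
      using A_telescope_bound[OF \<open>k < K\<close>] by simp
  qed
qed

text \<open>The reciprocity law applied at a common real time \<open>u\<close> on every level.\<close>

lemma wave_sum_expansion:
  assumes "u \<ge> 0"
  shows "wave_sum \<beta> (nat \<lfloor>u\<rfloor>) = (\<Sum>j<K. signs j * (1 - X j u) / 2)
     + (-1) ^ K * wave_sum (1 / y (Suc K)) (nat \<lfloor>u * w K\<rfloor>)"
proof (induction K)
  case 0
  have "\<beta> = 1 / y (Suc 0) + 2 * of_int (m 0)" using y_step[of 0] by (simp add: y_0)
  then show ?case using wave_sum_add_even[of "1 / y (Suc 0)" "m 0"] by (simp add: w_def)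
next
  case (Suc K)
  have irr: "1 / y (Suc K) \<notin> \<rat>"
  proof
    assume "1 / y (Suc K) \<in> \<rat>"
    from Rats_inverse[OF this] y_irrational[of "Suc K"] show False by (simp add: inverse_eq_divide)
  qed
  have ww: "u * w K * \<bar>1 / y (Suc K)\<bar> = u * w (Suc K)" by (simp add: w_def abs_divide)
  have sg: "sgn (1 / y (Suc K)) = of_int (sgn (m (Suc K)))" 
  proof -
    have "sgn (1 / x) = sgn x" for x :: real by (auto simp: sgn_if)
    from trans[OF this sgn_y] show ?thesis .
  qed
  \<comment> \<open>The even digit \<open>2 * m (Suc K)\<close> is invisible to a 2-periodic
    sum.\<close>
  have "wave_sum (y (Suc K)) = wave_sum (1 / y (Suc (Suc K)))"
    using wave_sum_add_even[of "1 / y (Suc (Suc K))" "m (Suc K)"] y_step[of "Suc K"] by (auto simp: add.commute)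
  then have e: "wave_sum (1 / y (Suc K)) (nat \<lfloor>u * w K\<rfloor>)
     = - wave_sum (1 / y (Suc (Suc K))) (nat \<lfloor>u * w (Suc K)\<rfloor>) - of_int (sgn (m (Suc K))) * (1 - X K u) / 2"
    using wave_sum_inverse[OF irr, of "u * w K"] assms w_pos[of K] unfolding ww sg
    by (simp add: X_def mult.commute)
  show ?case unfolding Suc e by (simp add: signs_def right_diff_distrib) (simp add: field_simps)
qed

lemma sgn_drift_signs: "sgn_drift m \<nu> = 1 / 4 * (\<Sum>j<2 * \<nu>. signs j)"
proof -
  have "(\<Sum>j<2 * \<nu>. signs j) = (\<Sum>j=1..\<nu>. of_int (sgn (m (2 * j)) - sgn (m (2 * j - 1))))"
    by (induction \<nu>) (simp_all add: signs_def)
  then show ?thesis by (simp add: sgn_drift_def)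
qed

text \<open>At level \<open>2 * \<nu>\<close> less than one unit of time is left, so the remaining
  sum is empty. An even level pairs the signs as in \<open>sgn_drift\<close>.\<close>

lemma discrepancy_expansion:
  assumes "\<beta> = 2 * \<alpha> - 1" "0 \<le> u" "u * w (2 * \<nu>) < 1"
  shows "discrepancy (Suc (nat \<lfloor>u\<rfloor>)) \<alpha> - sgn_drift m \<nu> = 1 / 2 - Z 0 (2 * \<nu>) u / 4"
proof -
  have "0 \<le> u * w (2 * \<nu>)" using assms w_pos[of "2 * \<nu>"] by simp
  then have "\<lfloor>u * w (2 * \<nu>)\<rfloor> = 0" using assms(3) by (simp add: floor_eq_iff)
  then have "wave_sum \<beta> (nat \<lfloor>u\<rfloor>) = (\<Sum>j<2 * \<nu>. signs j * (1 - X j u) / 2)"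
    using wave_sum_expansion[OF assms(2), of "2 * \<nu>"] by simp
  also have "\<dots> = (\<Sum>j<2 * \<nu>. signs j) / 2 - Z 0 (2 * \<nu>) u / 2"
    by (simp add: Z_def lessThan_atLeast0 sum_divide_distrib right_diff_distrib diff_divide_distrib sum_subtractf)
  finally show ?thesis
    using discrepancy_wave_sum[of "Suc (nat \<lfloor>u\<rfloor>)" \<alpha>] assms(1) by (simp add: sgn_drift_signs)
qed

end

section \<open>The temporal limit theorem\<close>

lemma asymp_comparableI:
  assumes "c1 > 0" "c2 > 0" "\<forall>\<^sub>F n in sequentially. 0 < b n \<and> c1 * b n \<le> a n \<and> a n \<le> c2 * b n"
  shows "asymp_comparable a b"
proof -
  obtain N where N: "\<And>n. n \<ge> N \<Longrightarrow> 0 < b n \<and> c1 * b n \<le> a n \<and> a n \<le> c2 * b n"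
    using assms(3) unfolding eventually_sequentially by blast
  define C where "C = max (1 / c1) c2 + 1"
  have C: "C > 1" "1 / c1 \<le> C" "c2 \<le> C" using assms(1,2) by (auto simp: C_def max_def)
  have iC: "inverse C \<le> c1" using C assms(1) by (simp add: field_simps)
  show ?thesis unfolding asymp_comparable_def
  proof (intro exI[of _ C] conjI exI[of _ "N + 2"] allI impI)
    fix n assume "n > N + 2"
    then have n: "0 < b n" "c1 * b n \<le> a n" "a n \<le> c2 * b n" using N[of n] by auto
    then have "c1 \<le> a n / b n" "a n / b n \<le> c2" by (simp_all add: field_simps)
    with iC C show "inverse C \<le> a n / b n" "a n / b n \<le> C" by linarith+
  qed (use C in auto)
qed

text \<open>The counts are probabilities for the uniform distribution on \<open>{1..n}\<close>, so
  Levy continuity applies, and the interval is a continuity set because its end points are null. The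
  index is shifted by one to avoid the empty set at \<open>n = 0\<close>.\<close>

lemma finite_average_weak_limit:
  fixes f :: "nat \<Rightarrow> nat \<Rightarrow> real"
  assumes char: "\<And>t. (\<lambda>n. (\<Sum>N=1..n. cis (t * f n N)) / of_nat n) \<longlonglongrightarrow> of_real (exp (- (t\<^sup>2 / 2)))"
    and "a < b"
  shows "(\<lambda>n. real (card {N. 1 \<le> N \<and> N \<le> n \<and> f n N \<in> {a..b}}) / real n)
     \<longlonglongrightarrow> 1 / sqrt (2 * pi) * integral {a..b} (\<lambda>t. exp (- t\<^sup>2 / 2))"
proof -
  define p where "p n = pmf_of_set {1..Suc n}" for n
  define M where "M n = distr (measure_pmf (p n)) borel (f (Suc n))" for n
  have fin: "finite {1..Suc n}" "{1..Suc n} \<noteq> {}" for n by auto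
  have M: "real_distribution (M n)" for n
    unfolding M_def by (rule prob_space.real_distribution_distr[OF measure_pmf.prob_space_axioms]) simp
  have "char (M n) t = (\<Sum>N=1..Suc n. cis (t * f (Suc n) N)) / of_nat (Suc n)" for n t
  proof -
    have "char (M n) t = (CLINT N|measure_pmf (p n). iexp (t * f (Suc n) N))"
      unfolding char_def M_def by (subst integral_distr) auto
    also have "\<dots> = (\<Sum>N=1..Suc n. pmf (p n) N *\<^sub>R iexp (t * f (Suc n) N))"
      by (rule integral_measure_pmf) (use fin[of n] in \<open>auto simp: p_def\<close>)
    also have "\<dots> = (\<Sum>N=1..Suc n. cis (t * f (Suc n) N) / of_nat (Suc n))"
      using fin[of n] by (intro sum.cong) (auto simp: p_def cis_conv_exp scaleR_conv_of_real field_simps)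
    finally show ?thesis unfolding sum_divide_distrib .
  qed
  moreover have "(\<lambda>n. (\<Sum>N=1..Suc n. cis (t * f (Suc n) N)) / of_nat (Suc n)) \<longlonglongrightarrow> of_real (exp (- (t\<^sup>2 / 2)))" for t
    using char[of t] by (rule LIMSEQ_Suc)
  ultimately have "(\<lambda>n. char (M n) t) \<longlonglongrightarrow> char std_normal_distribution t" for t
    by (simp add: char_std_normal_distribution)
  then have w: "weak_conv_m M std_normal_distribution"
    by (intro levy_continuity M real_dist_normal_dist)
  have null: "emeasure std_normal_distribution {a, b} = 0"
    by (subst emeasure_density) (auto intro!: nn_integral_null_set finite_imp_null_set_lborel)
  have fr: "emeasure std_normal_distribution (frontier {a..b}) = 0"
  proof -
    have "frontier {a..b} = {a, b}" using assms(2) by (auto simp: frontier_def)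
    then show ?thesis using null by simp
  qed
  have "(\<lambda>n. measure (M n) {a..b}) \<longlonglongrightarrow> measure std_normal_distribution {a..b}"
    using weak_conv_imp_continuity_set_conv[OF M real_dist_normal_dist w _ fr] by simp
  moreover have "measure (M n) {a..b} = real (card {N. 1 \<le> N \<and> N \<le> Suc n \<and> f (Suc n) N \<in> {a..b}}) / real (Suc n)" for n
  proof -
    have "measure (M n) {a..b} = measure (measure_pmf (p n)) (f (Suc n) -` {a..b})"
      unfolding M_def by (subst measure_distr) auto
    also have "\<dots> = real (card ({1..Suc n} \<inter> f (Suc n) -` {a..b})) / real (card {1..Suc n})"
      unfolding p_def by (rule measure_pmf_of_set[OF fin(2,1)])
    also have "{1..Suc n} \<inter> f (Suc n) -` {a..b} = {N. 1 \<le> N \<and> N \<le> Suc n \<and> f (Suc n) N \<in> {a..b}}" by auto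
    finally show ?thesis by simp
  qed
  moreover have "measure std_normal_distribution {a..b} = 1 / sqrt (2 * pi) * integral {a..b} (\<lambda>t. exp (- t\<^sup>2 / 2))"
  proof -
    have "continuous_on {a..b} std_normal_density"
      unfolding std_normal_density_def by (intro continuous_intros) auto
    then have int: "set_integrable lborel {a..b} std_normal_density"
      by (rule borel_integrable_atLeastAtMost')
    have "measure std_normal_distribution {a..b} = (LINT x:{a..b}|lborel. std_normal_density x)"
    proof -
      have "emeasure std_normal_distribution {a..b} = (\<integral>\<^sup>+x. ennreal (indicator {a..b} x * std_normal_density x) \<partial>lborel)"
        by (subst emeasure_density) (auto intro!: nn_integral_cong simp: indicator_def)
      also have "\<dots> = ennreal (LINT x|lborel. indicator {a..b} x * std_normal_density x)"
        using int by (intro nn_integral_eq_integral) (auto simp: set_integrable_def)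
      finally show ?thesis
        by (simp add: measure_def set_lebesgue_integral_def integral_nonneg_AE)
    qed
    also have "\<dots> = integral {a..b} std_normal_density" by (rule set_borel_integral_eq_integral(2)[OF int])
    finally show ?thesis unfolding std_normal_density_def by simp
  qed
  ultimately have "(\<lambda>n. real (card {N. 1 \<le> N \<and> N \<le> Suc n \<and> f (Suc n) N \<in> {a..b}}) / real (Suc n))
     \<longlonglongrightarrow> 1 / sqrt (2 * pi) * integral {a..b} (\<lambda>t. exp (- t\<^sup>2 / 2))" by simp
  then show ?thesis by (rule LIMSEQ_imp_Suc)
qed

text \<open>A time in \<open>[N - 1, N)\<close> stands for \<open>N\<close>, so averages over
  integers are integrals without any error.\<close>

lemma integral_unit_steps:
  fixes g :: "real \<Rightarrow> complex"
  assumes g: "tame g" and step: "\<And>u. 0 \<le> u \<Longrightarrow> u < real n \<Longrightarrow> g u = h (Suc (nat \<lfloor>u\<rfloor>))"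
  shows "integral {0..real n} g = (\<Sum>N=1..n. h N)"
  using step
proof (induction n)
  case (Suc n)
  have "integral {0..real (Suc n)} g = integral {0..real n} g + integral {real n..real (Suc n)} g"
    by (intro tame_integral_combine g) auto
  also have "integral {real n..real (Suc n)} g = integral {real n..real (Suc n)} (\<lambda>_. h (Suc n))"
  proof (rule integral_spike[of "{real (Suc n)}"])
    fix u assume u: "u \<in> {real n..real (Suc n)} - {real (Suc n)}"
    then have "\<lfloor>u\<rfloor> = int n" by (auto simp: floor_eq_iff)
    with Suc.prems[of u] u show "h (Suc n) = g u" by auto
  qed auto
  finally show ?case using Suc by simp
qed simp

section \<open>Stopping level, normalisation and limit theorem\<close>

context badly_approximable_even_cf
begin

text \<open>The first even level at which the rescaled time \<open>n * w\<close> has fallen to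
  1.\<close>

definition \<nu> :: "nat \<Rightarrow> nat" where "\<nu> n = (LEAST k. real n * w (2 * k) \<le> 1)"

lemma w_0: "w 0 = 1" by (simp add: w_def)

lemma \<theta>_lt: "0 < 1 - c\<^sup>2 / 2" "1 - c\<^sup>2 / 2 < 1"
  by (rule \<theta>)+

lemma \<nu>_exists: "\<exists>k. real n * w (2 * k) \<le> 1"
proof -
  obtain k where k: "(1 - c\<^sup>2 / 2) ^ k \<le> 1 / (real n + 1)"
    using exists_power_le[OF \<theta>_lt, of "1 / (real n + 1)"] by auto
  have "w (2 * k) \<le> w k" by (rule w_antimono) simp
  also have "w k \<le> (1 - c\<^sup>2 / 2) ^ k * w 0" using w_upper_power[of 0 k] by simp
  also have "\<dots> \<le> 1 / (real n + 1)" using k by (simp add: w_0)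
  finally have "real n * w (2 * k) \<le> real n * (1 / (real n + 1))" by (intro mult_left_mono) auto
  also have "\<dots> \<le> 1" by simp
  finally show ?thesis by blast
qed

lemma \<nu>: "real n * w (2 * \<nu> n) \<le> 1"
  unfolding \<nu>_def by (rule LeastI_ex[OF \<nu>_exists])

lemma \<nu>_le: "real n * w (2 * k) \<le> 1 \<Longrightarrow> \<nu> n \<le> k"
  unfolding \<nu>_def by (rule Least_le)

lemma \<nu>_lower:
  assumes "n \<ge> 1"
  shows "(c\<^sup>2)\<^sup>2 \<le> real n * w (2 * \<nu> n)"
proof (cases "\<nu> n")
  case 0
  have "(c\<^sup>2)\<^sup>2 \<le> 1" using c_pos c_le_1 by (simp add: power_le_one)
  then show ?thesis using 0 assms by (simp add: w_0)
next
  case (Suc k)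
  then have "\<not> real n * w (2 * k) \<le> 1" using \<nu>_le[of n k] by auto
  then have "(c\<^sup>2)\<^sup>2 * 1 \<le> (c\<^sup>2)\<^sup>2 * (real n * w (2 * k))" by (intro mult_left_mono) auto
  also have "\<dots> = real n * ((c\<^sup>2) ^ 2 * w (2 * k))" by simp
  also have "\<dots> \<le> real n * w (2 * k + 2)" by (intro mult_left_mono w_lower_power) auto
  finally show ?thesis using Suc by simp
qed

lemma mono_\<nu>: "mono \<nu>"
proof (rule monoI)
  fix n n' :: nat assume "n \<le> n'"
  then have "real n * w (2 * \<nu> n') \<le> real n' * w (2 * \<nu> n')"
    using w_pos[of "2 * \<nu> n'"] by (intro mult_right_mono) auto
  with \<nu>[of n'] show "\<nu> n \<le> \<nu> n'" by (intro \<nu>_le) linarith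
qed

lemma \<nu>_jumps: "bdd_above (range (\<lambda>n. int (\<nu> (Suc n)) - int (\<nu> n)))"
proof -
  \<comment> \<open>Halving the frequency is enough: passing from \<open>n\<close> to
    \<open>Suc n\<close> adds at most \<open>w (2 * \<nu> n) \<le> 1\<close> to the rescaled
    time.\<close>
  obtain d where d: "(1 - c\<^sup>2 / 2) ^ d \<le> 1 / 2" using exists_power_le[OF \<theta>_lt, of "1 / 2"] by auto
  have "\<nu> (Suc n) \<le> \<nu> n + d" for n
  proof (rule \<nu>_le)
    have "w (2 * (\<nu> n + d)) \<le> w (2 * \<nu> n + d)" by (rule w_antimono) simp
    also have "\<dots> \<le> (1 - c\<^sup>2 / 2) ^ d * w (2 * \<nu> n)" by (rule w_upper_power)
    also have "\<dots> \<le> 1 / 2 * w (2 * \<nu> n)" using d w_pos[of "2 * \<nu> n"] by (intro mult_right_mono) auto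
    finally have "real (Suc n) * w (2 * (\<nu> n + d)) \<le> real (Suc n) * (1 / 2 * w (2 * \<nu> n))"
      by (intro mult_left_mono) auto
    also have "\<dots> = (real n * w (2 * \<nu> n)) / 2 + w (2 * \<nu> n) / 2" by (simp add: algebra_simps add_divide_distrib)
    also have "\<dots> \<le> 1 / 2 + 1 / 2"
      using \<nu>[of n] w_antimono[of 0 "2 * \<nu> n"] w_0 by (intro add_mono divide_right_mono) auto
    finally show "real (Suc n) * w (2 * (\<nu> n + d)) \<le> 1" by simp
  qed
  then have "int (\<nu> (Suc n)) - int (\<nu> n) \<le> int d" for n
    by (metis add.commute diff_le_eq of_nat_add of_nat_le_iff)
  then show ?thesis by (intro bdd_aboveI[of _ "int d"]) auto
qed

lemma c2_lt_1: "c\<^sup>2 < 1"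
proof -
  have "c\<^sup>2 * w 0 \<le> w 1" using w_lower[of 0] by simp
  also have "\<dots> \<le> (1 - c\<^sup>2 / 2) * w 0" using w_upper[of 0] by simp
  finally show ?thesis using \<theta>_lt by (simp add: w_0)
qed

lemma \<nu>_comparable:
  "\<exists>c1>0. \<exists>c2>0. \<forall>\<^sub>F n in sequentially. 0 < ln (real n) \<and> c1 * ln (real n) \<le> \<nu> n \<and> \<nu> n \<le> c2 * ln (real n)"
proof -
  define \<kappa> where "\<kappa> = c\<^sup>2"
  define \<theta> where "\<theta> = 1 - c\<^sup>2 / 2"
  have \<kappa>: "0 < \<kappa>" "\<kappa> < 1" using c_pos c2_lt_1 by (auto simp: \<kappa>_def)
  have \<theta>: "0 < \<theta>" "\<theta> < 1" using \<theta>_lt by (auto simp: \<theta>_def)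
  define a b where "a = - ln \<kappa>" and "b = - ln \<theta>"
  have ab: "a > 0" "b > 0" using \<kappa> \<theta> by (auto simp: a_def b_def)
  have low: "1 / (2 * a) * ln (real n) \<le> \<nu> n" if "n \<ge> 1" for n
  proof -
    have "real n * \<kappa> ^ (2 * \<nu> n) \<le> real n * w (2 * \<nu> n)"
      using w_lower_power[of "2 * \<nu> n" 0] by (intro mult_left_mono) (auto simp: w_0 \<kappa>_def)
    with \<nu>[of n] have "real n * \<kappa> ^ (2 * \<nu> n) \<le> 1" by linarith
    then have "ln (real n * \<kappa> ^ (2 * \<nu> n)) \<le> ln 1" using that \<kappa> by (subst ln_le_cancel_iff) auto
    then have "ln (real n) \<le> 2 * \<nu> n * a" using that \<kappa> by (simp add: ln_mult ln_realpow a_def)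
    then show ?thesis using ab by (simp add: field_simps)
  qed
  have up: "2 * \<nu> n * b \<le> ln (real n) + 2 * a" if "n \<ge> 1" for n
  proof -
    have "\<kappa>\<^sup>2 \<le> real n * w (2 * \<nu> n)" using \<nu>_lower[OF that] by (simp add: \<kappa>_def)
    also have "\<dots> \<le> real n * \<theta> ^ (2 * \<nu> n)"
      using w_upper_power[of 0 "2 * \<nu> n"] by (intro mult_left_mono) (auto simp: w_0 \<theta>_def)
    finally have "ln (\<kappa>\<^sup>2) \<le> ln (real n * \<theta> ^ (2 * \<nu> n))" using that \<kappa> \<theta> by (subst ln_le_cancel_iff) auto
    then show ?thesis using that \<kappa> \<theta> by (simp add: ln_mult ln_realpow a_def b_def)
  qed
  have "\<forall>\<^sub>F n in sequentially. ln (real n) \<ge> max 1 (2 * a)"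
    by (rule filterlim_compose[OF ln_at_top filterlim_real_sequentially, unfolded filterlim_at_top, rule_format])
  then have "\<forall>\<^sub>F n in sequentially. 0 < ln (real n) \<and> 1 / (2 * a) * ln (real n) \<le> \<nu> n \<and> \<nu> n \<le> 1 / b * ln (real n)"
    using eventually_ge_at_top[of 1]
  proof eventually_elim
    case (elim n)
    have "2 * \<nu> n * b \<le> 2 * ln (real n)" using up[OF elim(2)] elim(1) by linarith
    then have "\<nu> n \<le> 1 / b * ln (real n)" using ab by (simp add: field_simps)
    with low[OF elim(2)] elim(1) show ?case by auto
  qed
  moreover have "1 / (2 * a) > 0" "1 / b > 0" using ab by auto
  ultimately show ?thesis by blast
qed

lemma temporal_clt:
  assumes "\<beta> = 2 * \<alpha> - 1"
  shows "\<exists>(\<nu> :: nat \<Rightarrow> nat) (B :: nat \<Rightarrow> real).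
           mono \<nu> \<and>
           bdd_above (range (\<lambda>n. int (\<nu> (Suc n)) - int (\<nu> n))) \<and>
           asymp_comparable (\<lambda>n. real (\<nu> n)) (\<lambda>n. ln (real n)) \<and>
           (\<forall>n. B n > 0) \<and>
           asymp_comparable B (\<lambda>n. sqrt (ln (real n))) \<and>
           (\<forall>a b :: real. a < b \<longrightarrow>
              (\<lambda>n. real (card {N. 1 \<le> N \<and> N \<le> n \<and>
                     (discrepancy N \<alpha> - sgn_drift m (\<nu> n)) / B n \<in> {a..b}}) / real n)
              \<longlonglongrightarrow> 1 / sqrt (2 * pi) * integral {a..b} (\<lambda>t. exp (- t\<^sup>2 / 2)))"
proof -
  obtain \<gamma> where \<gamma>: "\<gamma> > 0" "\<And>K. K \<ge> 1 \<Longrightarrow> \<forall>\<^sub>F S in at_top. \<gamma> * real K \<le> Bsq S K"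
    using variance_linear by blast
  from wave_clt[OF \<gamma>] obtain b :: "nat \<Rightarrow> real" where 
    b: "\<And>K. K \<ge> 1 \<Longrightarrow> b K > 0 \<and> \<gamma> * K \<le> (b K)\<^sup>2 \<and> (b K)\<^sup>2 \<le> (1 + 2 * V) * K" and
    clt: "\<And>t \<epsilon>. \<epsilon> > 0 \<Longrightarrow> \<exists>N. \<forall>K\<ge>N. \<forall>T. (c\<^sup>2)\<^sup>2 \<le> T * w K \<longrightarrow> T * w K \<le> 1 \<longrightarrow>
        norm (avg T (\<lambda>u. cis (t / b K * Z 0 K u)) - of_real (exp (- (t\<^sup>2 / 2)))) < \<epsilon>"
    by blast
  obtain c1 c2 where c12: "c1 > 0" "c2 > 0" and
    \<nu>ln: "\<forall>\<^sub>F n in sequentially. 0 < ln (real n) \<and> c1 * ln (real n) \<le> \<nu> n \<and> \<nu> n \<le> c2 * ln (real n)"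
    using \<nu>_comparable by blast
  \<comment> \<open>The factor \<open>1 / 4\<close> is that of \<open>Z\<close> in
    \<open>discrepancy_expansion\<close>. The value 1 secures positivity at the finitely many
    \<open>n\<close> with \<open>\<nu> n = 0\<close>.\<close>
  define B where "B n = (if \<nu> n = 0 then 1 else b (2 * \<nu> n) / 4)" for n
  have Bpos: "B n > 0" for n using b[of "2 * \<nu> n"] by (simp add: B_def)
  have V1: "1 + 2 * V > 0" using V_nonneg by simp
  have Bcomp: "asymp_comparable B (\<lambda>n. sqrt (ln (real n)))"
  proof (rule asymp_comparableI)
    show "sqrt (2 * \<gamma> * c1) / 4 > 0" "sqrt (2 * (1 + 2 * V) * c2) / 4 > 0" using \<gamma> c12 V1 by auto
    show "\<forall>\<^sub>F n in sequentially. 0 < sqrt (ln (real n)) \<and> sqrt (2 * \<gamma> * c1) / 4 * sqrt (ln (real n)) \<le> B n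
       \<and> B n \<le> sqrt (2 * (1 + 2 * V) * c2) / 4 * sqrt (ln (real n))"
      using \<nu>ln
    proof eventually_elim
      case (elim n)
      have "c1 * ln (real n) > 0" using elim c12 by simp
      with elim have \<nu>0: "\<nu> n \<ge> 1" by (cases "\<nu> n") auto
      then have bb: "b (2 * \<nu> n) > 0" "\<gamma> * (2 * \<nu> n) \<le> (b (2 * \<nu> n))\<^sup>2" "(b (2 * \<nu> n))\<^sup>2 \<le> (1 + 2 * V) * (2 * \<nu> n)"
        using b[of "2 * \<nu> n"] by auto
      have "2 * \<gamma> * c1 * ln (real n) = 2 * \<gamma> * (c1 * ln (real n))" by simp
      also have "\<dots> \<le> 2 * \<gamma> * \<nu> n" using elim \<gamma> by (intro mult_left_mono) auto
      also have "\<dots> \<le> (b (2 * \<nu> n))\<^sup>2" using bb by simp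
      finally have l: "sqrt (2 * \<gamma> * c1 * ln (real n)) \<le> b (2 * \<nu> n)" using bb(1) by (intro real_le_lsqrt) auto
      have "(b (2 * \<nu> n))\<^sup>2 \<le> 2 * (1 + 2 * V) * \<nu> n" using bb(3) by (simp add: algebra_simps)
      also have "\<dots> \<le> 2 * (1 + 2 * V) * (c2 * ln (real n))" using elim V1 by (intro mult_left_mono) auto
      also have "\<dots> = 2 * (1 + 2 * V) * c2 * ln (real n)" by simp
      finally have u: "b (2 * \<nu> n) \<le> sqrt (2 * (1 + 2 * V) * c2 * ln (real n))" by (rule real_le_rsqrt)
      have "B n = b (2 * \<nu> n) / 4" using \<nu>0 by (simp add: B_def)
      with l u elim show ?case by (simp only: real_sqrt_mult) simp
    qed
  qed
  have \<nu>comp: "asymp_comparable (\<lambda>n. real (\<nu> n)) (\<lambda>n. ln (real n))"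
    by (rule asymp_comparableI[OF c12 \<nu>ln])
  have \<nu>inf: "filterlim (\<lambda>n. 2 * \<nu> n) at_top sequentially"
  proof (rule filterlim_at_top_mono)
    have "filterlim (\<lambda>n. c1 * ln (real n)) at_top sequentially"
      by (intro filterlim_tendsto_pos_mult_at_top[OF tendsto_const c12(1)]
          filterlim_compose[OF ln_at_top filterlim_real_sequentially])
    then show "filterlim (\<lambda>n. nat \<lfloor>c1 * ln (real n)\<rfloor>) at_top sequentially"
      by (intro filterlim_compose[OF filterlim_nat_sequentially] filterlim_compose[OF filterlim_floor_sequentially])
    show "\<forall>\<^sub>F n in sequentially. nat \<lfloor>c1 * ln (real n)\<rfloor> \<le> 2 * \<nu> n"
      using \<nu>ln
    proof eventually_elim
      case (elim n)
      then have "\<lfloor>c1 * ln (real n)\<rfloor> \<le> int (\<nu> n)" by linarith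
      then show ?case by simp
    qed
  qed
  have char: "(\<lambda>n. (\<Sum>N=1..n. cis (t * ((discrepancy N \<alpha> - sgn_drift m (\<nu> n)) / B n))) / of_nat n) 
      \<longlonglongrightarrow> of_real (exp (- (t\<^sup>2 / 2)))" for t
  proof -
    \<comment> \<open>The constant \<open>1 / 2\<close> in the expansion becomes the phase
      \<open>2 * t / b\<close>, which tends to 0, and the minus sign before \<open>Z\<close> turns
      \<open>t\<close> into \<open>- t\<close>.\<close>
    have eq: "(\<Sum>N=1..n. cis (t * ((discrepancy N \<alpha> - sgn_drift m (\<nu> n)) / B n))) / of_nat n
       = cis (2 * t / b (2 * \<nu> n)) * avg (real n) (\<lambda>u. cis ((- t) / b (2 * \<nu> n) * Z 0 (2 * \<nu> n) u))"
      if n: "\<nu> n \<ge> 1" for n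
    proof -
      have Bn: "B n = b (2 * \<nu> n) / 4" "b (2 * \<nu> n) > 0" using n b[of "2 * \<nu> n"] by (auto simp: B_def)
      define g where "g u = cis (2 * t / b (2 * \<nu> n)) * cis ((- t) / b (2 * \<nu> n) * Z 0 (2 * \<nu> n) u)" for u
      have "integral {0..real n} g = (\<Sum>N=1..n. cis (t * ((discrepancy N \<alpha> - sgn_drift m (\<nu> n)) / B n)))"
      proof (rule integral_unit_steps)
        show "tame g" unfolding g_def [abs_def] by (intro tame_mult tame_const tame_cis tame_Z)
        fix u assume u: "0 \<le> u" "u < real n"
        have "u * w (2 * \<nu> n) < real n * w (2 * \<nu> n)" using u w_pos by (intro mult_strict_right_mono)
        with \<nu>[of n] have "u * w (2 * \<nu> n) < 1" by linarith
        from discrepancy_expansion[OF assms u(1) this]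
        have de: "discrepancy (Suc (nat \<lfloor>u\<rfloor>)) \<alpha> - sgn_drift m (\<nu> n) = 1 / 2 - Z 0 (2 * \<nu> n) u / 4" .
        have "t * ((discrepancy (Suc (nat \<lfloor>u\<rfloor>)) \<alpha> - sgn_drift m (\<nu> n)) / B n)
          = 2 * t / b (2 * \<nu> n) + (- t) / b (2 * \<nu> n) * Z 0 (2 * \<nu> n) u"
          unfolding de Bn(1) using Bn(2) by (simp add: field_simps)
        then show "g u = cis (t * ((discrepancy (Suc (nat \<lfloor>u\<rfloor>)) \<alpha> - sgn_drift m (\<nu> n)) / B n))"
          by (simp only: g_def cis_mult)
      qed
      then have "(\<Sum>N=1..n. cis (t * ((discrepancy N \<alpha> - sgn_drift m (\<nu> n)) / B n))) / of_nat n = avg (real n) g"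
        by (simp add: avg_def)
      also have "\<dots> = cis (2 * t / b (2 * \<nu> n)) * avg (real n) (\<lambda>u. cis ((- t) / b (2 * \<nu> n) * Z 0 (2 * \<nu> n) u))"
        unfolding g_def by (rule avg_cmult)
      finally show ?thesis .
    qed
    have ev1: "\<forall>\<^sub>F n in sequentially. \<nu> n \<ge> 1"
    proof -
      have "\<forall>\<^sub>F n in sequentially. 2 * \<nu> n \<ge> 1"
        by (rule \<nu>inf[unfolded filterlim_at_top, rule_format])
      then show ?thesis by eventually_elim simp
    qed
    have l1: "(\<lambda>n. avg (real n) (\<lambda>u. cis ((- t) / b (2 * \<nu> n) * Z 0 (2 * \<nu> n) u))) \<longlonglongrightarrow> of_real (exp (- (t\<^sup>2 / 2)))"
    proof (rule tendstoI)
      fix \<epsilon> :: real assume "\<epsilon> > 0"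
      from clt[OF this, of "- t"] obtain N where N: "\<And>K T. K \<ge> N \<Longrightarrow> (c\<^sup>2)\<^sup>2 \<le> T * w K \<Longrightarrow> T * w K \<le> 1 \<Longrightarrow>
        norm (avg T (\<lambda>u. cis ((- t) / b K * Z 0 K u)) - of_real (exp (- ((- t)\<^sup>2 / 2)))) < \<epsilon>" by blast
      have "\<forall>\<^sub>F n in sequentially. 2 * \<nu> n \<ge> N"
        by (rule \<nu>inf[unfolded filterlim_at_top, rule_format])
      then show "\<forall>\<^sub>F n in sequentially. dist (avg (real n) (\<lambda>u. cis ((- t) / b (2 * \<nu> n) * Z 0 (2 * \<nu> n) u))) (of_real (exp (- (t\<^sup>2 / 2)))) < \<epsilon>"
        using eventually_ge_at_top[of 1]
      proof eventually_elim
        case (elim n)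
        from N[OF elim(1) \<nu>_lower[OF elim(2)] \<nu>] show ?case unfolding dist_norm power2_minus .
      qed
    qed
    have l2: "(\<lambda>n. cis (2 * t / b (2 * \<nu> n))) \<longlonglongrightarrow> 1"
    proof -
      have "filterlim b at_top sequentially"
      proof (rule filterlim_at_top_mono)
        show "filterlim (\<lambda>K. sqrt (\<gamma> * real K)) at_top sequentially"
          by (intro filterlim_compose[OF sqrt_at_top] filterlim_tendsto_pos_mult_at_top[OF tendsto_const \<gamma>(1)]
              filterlim_real_sequentially)
        show "\<forall>\<^sub>F K in sequentially. sqrt (\<gamma> * real K) \<le> b K"
          using eventually_ge_at_top[of 1]
        proof eventually_elim
          case (elim K)
          then show ?case using b[of K] by (intro real_le_lsqrt) auto
        qed
      qed
      then have "filterlim (\<lambda>n. b (2 * \<nu> n)) at_top sequentially" using \<nu>inf by (rule filterlim_compose)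
      then have lim0: "(\<lambda>n. 2 * t / b (2 * \<nu> n)) \<longlonglongrightarrow> 0"
        by (intro tendsto_divide_0[OF tendsto_const] filterlim_at_top_imp_at_infinity)
      have "(\<lambda>n. cis (2 * t / b (2 * \<nu> n)) - 1) \<longlonglongrightarrow> 0"
      proof (rule Lim_null_comparison)
        show "(\<lambda>n. \<bar>2 * t / b (2 * \<nu> n)\<bar>) \<longlonglongrightarrow> 0" using lim0 by (rule tendsto_rabs_zero)
        show "\<forall>\<^sub>F n in sequentially. norm (cis (2 * t / b (2 * \<nu> n)) - 1) \<le> \<bar>2 * t / b (2 * \<nu> n)\<bar>"
          by (intro always_eventually allI norm_cis_minus_1)
      qed
      then show ?thesis by (rule LIM_zero_cancel)
    qed
    have "(\<lambda>n. cis (2 * t / b (2 * \<nu> n)) * avg (real n) (\<lambda>u. cis ((- t) / b (2 * \<nu> n) * Z 0 (2 * \<nu> n) u)))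
       \<longlonglongrightarrow> 1 * of_real (exp (- (t\<^sup>2 / 2)))"
      by (intro tendsto_mult l1 l2)
    moreover have "\<forall>\<^sub>F n in sequentially. cis (2 * t / b (2 * \<nu> n)) * avg (real n) (\<lambda>u. cis ((- t) / b (2 * \<nu> n) * Z 0 (2 * \<nu> n) u))
       = (\<Sum>N=1..n. cis (t * ((discrepancy N \<alpha> - sgn_drift m (\<nu> n)) / B n))) / of_nat n"
      using ev1 by eventually_elim (rule eq[symmetric])
    ultimately show ?thesis by (simp only: mult_1 tendsto_cong)
  qed
  show ?thesis
    using mono_\<nu> \<nu>_jumps \<nu>comp Bpos Bcomp
    by (intro exI[of _ \<nu>] exI[of _ B] conjI allI impI finite_average_weak_limit[OF char]) auto
qed

end

theorem theorem1p10:
  fixes \<alpha> \<beta> :: real and m :: "nat \<Rightarrow> int"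
  assumes "\<alpha> \<notin> \<rat>"
    and "bounded_type \<alpha>"
    and "\<beta> = 2 * \<alpha> - 1"
    and "even_cf_expansion \<beta> m"
  shows "\<exists>(\<nu> :: nat \<Rightarrow> nat) (B :: nat \<Rightarrow> real).
           mono \<nu> \<and>
           bdd_above (range (\<lambda>n. int (\<nu> (Suc n)) - int (\<nu> n))) \<and>
           asymp_comparable (\<lambda>n. real (\<nu> n)) (\<lambda>n. ln (real n)) \<and>
           (\<forall>n. B n > 0) \<and>
           asymp_comparable B (\<lambda>n. sqrt (ln (real n))) \<and>
           (\<forall>a b :: real. a < b \<longrightarrow>
              (\<lambda>n. real (card {N. 1 \<le> N \<and> N \<le> n \<and>
                     (discrepancy N \<alpha> - sgn_drift m (\<nu> n)) / B n \<in> {a..b}}) / real n)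
              \<longlonglongrightarrow> 1 / sqrt (2 * pi) * integral {a..b} (\<lambda>t. exp (- t\<^sup>2 / 2)))"
proof -
  have irr: "\<beta> \<notin> \<rat>"
  proof
    assume "\<beta> \<in> \<rat>"
    then have "(\<beta> + 1) / 2 \<in> \<rat>" by (intro Rats_divide Rats_add) auto
    with assms show False by simp
  qed
  obtain c0 where c0: "c0 > 0" 
    "\<And>p q :: int. q \<noteq> 0 \<Longrightarrow> c0 \<le> \<bar>of_int q\<bar> * \<bar>of_int q * \<alpha> - of_int p\<bar>"
    using bounded_type_badly_approximable[OF assms(2)] by blast
  \<comment> \<open>\<open>q * \<beta> - p = (2 * q) * \<alpha> - (p + q)\<close>, so the doubled
    denominator costs a factor 2; the minimum with 1 meets the normalisation
    \<open>c \<le> 1\<close>.\<close>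
  interpret badly_approximable_even_cf \<beta> m "min 1 (c0 / 2)"
  proof
    fix p q :: int assume q: "q \<noteq> 0"
    have "c0 \<le> \<bar>of_int (2 * q)\<bar> * \<bar>of_int (2 * q) * \<alpha> - of_int (p + q)\<bar>" using q by (intro c0(2)) simp
    also have "of_int (2 * q) * \<alpha> - of_int (p + q) = of_int q * \<beta> - of_int p" unfolding assms(3) by (simp add: algebra_simps)
    finally show "min 1 (c0 / 2) \<le> \<bar>of_int q\<bar> * \<bar>of_int q * \<beta> - of_int p\<bar>" by (simp add: abs_mult)
  qed (use irr assms(4) c0 in auto)
  show ?thesis by (rule temporal_clt[OF assms(3)])
qed

end
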